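(* Let $\mathcal{D}_r^*(\mathbb{C})$ be the set of diagonalizable and invertible matrices in $\mathcal{M}_r(\mathbb{C})$ with $r$ different eigenvalues (an open subset of $\mathcal{M}_r(\mathbb{C})$). The map $$\Delta_\infty:(0,1)\times\mathcal{D}_r^*(\mathbb{C})\to\mathcal{M}_r(\mathbb{C}),\qquad \Delta_\infty(\lambda,T)=\Delta_\lambda^\infty(T),$$ is of class $C^\infty$.
   Context: $\mathcal{M}_r(\mathbb{C})$ is the space of complex $r\times r$ matrices. For $T\in\mathcal{M}_r(\mathbb{C})$ with polar decomposition $T=U|T|$, $|T|=(T^*T)^{1/2}$, and $\lambda\in(0,1)$, the $\lambda$-Aluthge transform is $\Delta_\lambda(T)=|T|^\lambda U|T|^{1-\lambda}$, with iterates $\Delta_\lambda^0(T)=T$, $\Delta_\lambda^n(T)=\Delta_\lambda(\Delta_\lambda^{n-1}(T))$. $\Delta_\lambda^\infty(T)=\lim_{n\to\infty}\Delta_\lambda^n(T)$, a limit which exists for every diagonalizable $T$. *)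

theory Defs
  imports "HOL-Analysis.Analysis"
begin

type_synonym 'n cmat = "complex ^ 'n ^ 'n"

definition cadjoint :: "'n::finite cmat \<Rightarrow> 'n cmat" where
  "cadjoint A = map_matrix cnj (transpose A)"

definition unitary_matrix :: "'n::finite cmat \<Rightarrow> bool" where
  "unitary_matrix U \<longleftrightarrow> cadjoint U ** U = mat 1 \<and> U ** cadjoint U = mat 1"

definition diag_matrix :: "('n \<Rightarrow> complex) \<Rightarrow> 'n::finite cmat" where
  "diag_matrix d = (\<chi> i j. if i = j then d i else 0)"

text \<open>The power \<open>A\<^sup>s\<close> of a positive semidefinite matrix by functional calculus: if
  \<open>A = V diag(d) V*\<close> with \<open>V\<close> unitary and \<open>d \<ge> 0\<close>, then \<open>A\<^sup>s = V diag(d\<^sup>s) V*\<close>, independently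
  of the chosen diagonalization. Only exponents \<open>s > 0\<close> are used, for which \<open>0 powr s = 0\<close>
  is the right value on the kernel. No meaning is attached to other matrices \<open>A\<close>.\<close>

definition psd_powr :: "'n::finite cmat \<Rightarrow> real \<Rightarrow> 'n cmat" where
  "psd_powr A s = (THE B. \<exists>V (d :: 'n \<Rightarrow> real).
     unitary_matrix V \<and> (\<forall>i. d i \<ge> 0) \<and>
     A = V ** diag_matrix (\<lambda>i. complex_of_real (d i)) ** cadjoint V \<and>
     B = V ** diag_matrix (\<lambda>i. complex_of_real (d i powr s)) ** cadjoint V)"

definition matrix_abs :: "'n::finite cmat \<Rightarrow> 'n cmat" where
  "matrix_abs T = psd_powr (cadjoint T ** T) (1/2)"

text \<open>The unitary factor of a polar decomposition is unique only for invertible \<open>T\<close>. It is,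
  however, always determined on the range of \<open>|T|\<close>, which is also the range of
  \<open>|T|\<^bsup>1-s\<^esup>\<close> for \<open>s < 1\<close>; so the transform is well defined for every square matrix.\<close>

definition polar_decomposition :: "'n::finite cmat \<Rightarrow> 'n cmat \<Rightarrow> bool" where
  "polar_decomposition T U \<longleftrightarrow> unitary_matrix U \<and> T = U ** matrix_abs T"

definition aluthge :: "real \<Rightarrow> 'n::finite cmat \<Rightarrow> 'n cmat" where
  "aluthge lam T = (THE B. \<exists>U. polar_decomposition T U \<and>
     B = psd_powr (matrix_abs T) lam ** U ** psd_powr (matrix_abs T) (1 - lam))"

definition aluthge_iter :: "real \<Rightarrow> nat \<Rightarrow> 'n::finite cmat \<Rightarrow> 'n cmat" where
  "aluthge_iter lam n T = (aluthge lam ^^ n) T"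

definition aluthge_limit :: "real \<Rightarrow> 'n::finite cmat \<Rightarrow> 'n cmat" where
  "aluthge_limit lam T = lim (\<lambda>n. aluthge_iter lam n T)"

definition eigenvalues :: "'n::finite cmat \<Rightarrow> complex set" where
  "eigenvalues T = {c. \<exists>v. v \<noteq> 0 \<and> T *v v = c *s v}"

definition diagonalizable :: "'n::finite cmat \<Rightarrow> bool" where
  "diagonalizable T \<longleftrightarrow>
     (\<exists>(P :: 'n cmat) (Q :: 'n cmat) d. P ** Q = mat 1 \<and> Q ** P = mat 1 \<and> T = P ** diag_matrix d ** Q)"

definition diag_inv_distinct :: "'n::finite cmat set" where
  "diag_inv_distinct =
     {T. diagonalizable T \<and> invertible T \<and> card (eigenvalues T) = CARD('n)}"

text \<open>\<open>C\<^sup>k\<close> and \<open>C\<^sup>\<infinity>\<close> in the real sense, meant for open sets \<open>S\<close>: all iterated directional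
  derivatives up to the given order exist, as values of Frechet derivatives, and are continuous.\<close>

primrec C_k_on :: "nat \<Rightarrow> 'a::real_normed_vector set \<Rightarrow> ('a \<Rightarrow> 'b::real_normed_vector) \<Rightarrow> bool" where
  "C_k_on 0 S f \<longleftrightarrow> continuous_on S f"
| "C_k_on (Suc k) S f \<longleftrightarrow> (\<forall>x\<in>S. f differentiable (at x)) \<and>
     (\<forall>v. C_k_on k S (\<lambda>x. frechet_derivative f (at x) v))"

definition C_inf_on :: "'a::real_normed_vector set \<Rightarrow> ('a \<Rightarrow> 'b::real_normed_vector) \<Rightarrow> bool" where
  "C_inf_on S f \<longleftrightarrow> (\<forall>k. C_k_on k S f)"

end

theory Submission
  imports Defs "HOL-Complex_Analysis.Complex_Analysis"
begin

text \<open>The transform extends holomorphically to triples \<open>(\<lambda>, T, S)\<close>, with \<open>S\<close> in the place of \<open>T\<^sup>*\<close>, and locally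
  uniform limits of holomorphic maps are holomorphic; so it suffices that the complexified iterates converge
  locally uniformly. Write \<open>T = P diag(d) P\<^sup>-\<^sup>1\<close> and \<open>K = P\<^sup>* P\<close>. The transform multiplies \<open>P\<close> from the right by a
  function of \<open>K\<close> and \<open>d\<close>, so it acts on \<open>K\<close> alone, with \<open>d\<close> as a parameter. Diagonal \<open>K\<close>, which belong to normal
  \<open>T\<close>, are fixed, and at \<open>K = 1\<close> the derivative multiplies the entry \<open>(i, j)\<close> by a number of modulus less than 1
  when \<open>d\<^sub>i \<noteq> d\<^sub>j\<close>; hence the iterates of all complexified points near a normal matrix converge geometrically.
  Every orbit comes near a normal matrix, since the Frobenius norm strictly decreases at non-normal matrices,
  and finitely many holomorphic steps carry the local result back to the start of the orbit.\<close>

text \<open>Monotonicity of the norm yields limit points but no rate, and it does not survive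
  complexification: for \<open>S\<close> other than the adjoint of \<open>T\<close> nothing is
  positive or unitary. Smoothness therefore rests on a contraction that is an open condition, a
  strict bound on a derivative, and the coordinates are chosen to exhibit one. In terms of
  \<open>T\<close> the fixed points form a curved set; in terms of \<open>K\<close>, with
  \<open>d\<close> frozen, they are the linear space of diagonal matrices, and the derivative acts
  entrywise on a complement. Since \<open>K\<close> alone does not determine \<open>T\<close>, the
  accumulated change of frame is carried along. Each frame change contains a factor that commutes
  with \<open>diag(d)\<close>; it does not affect the transform and is there to make the frame
  change the identity at a fixed point, so that the accumulated product can converge. Fractional
  powers are binomial series about a multiple of the identity, since these are jointly holomorphic
  in exponent and matrix and make sense for the non-Hermitian matrices that complexification
  creates.\<close>

no_notation fps_nth (infixl "$" 75)

section \<open>Holomorphic maps in several variables\<close>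

text \<open>A complex scalar multiplication on top of a real Euclidean space: real Frechet
  derivatives, compactness and inner products stay available, and complex linearity becomes an
  additional property.\<close>

class cvec = euclidean_space +
  fixes csc :: "complex \<Rightarrow> 'a \<Rightarrow> 'a"  (infixr "*\<^sub>C" 75)
  assumes csc_of_real: "complex_of_real r *\<^sub>C x = r *\<^sub>R x"
    and csc_add_left: "(a + b) *\<^sub>C x = a *\<^sub>C x + b *\<^sub>C x"
    and csc_add_right: "a *\<^sub>C (x + y) = a *\<^sub>C x + a *\<^sub>C y"
    and csc_csc: "a *\<^sub>C (b *\<^sub>C x) = (a * b) *\<^sub>C x"
    and norm_csc: "norm (a *\<^sub>C x) = cmod a * norm x"

instantiation complex :: cvec
begin
definition csc_complex :: "complex \<Rightarrow> complex \<Rightarrow> complex" where "csc_complex a x = a * x"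
instance
  by standard (auto simp: csc_complex_def algebra_simps norm_mult scaleR_conv_of_real)
end

instantiation prod :: (cvec, cvec) cvec
begin
definition csc_prod :: "complex \<Rightarrow> 'a \<times> 'b \<Rightarrow> 'a \<times> 'b"
  where "csc_prod a x = (a *\<^sub>C fst x, a *\<^sub>C snd x)"
instance
proof
  fix a :: complex and x :: "'a \<times> 'b"
  have "norm (a *\<^sub>C x) = sqrt ((cmod a)\<^sup>2 * ((norm (fst x))\<^sup>2 + (norm (snd x))\<^sup>2))"
    by (simp add: csc_prod_def norm_prod_def norm_csc power_mult_distrib distrib_left)
  then show "norm (a *\<^sub>C x) = cmod a * norm x"
    by (simp add: real_sqrt_mult norm_prod_def)
qed (auto simp: csc_prod_def csc_of_real csc_add_left csc_add_right csc_csc prod_eq_iff)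
end

instantiation vec :: (cvec, finite) cvec
begin
definition csc_vec :: "complex \<Rightarrow> ('a, 'b) vec \<Rightarrow> ('a, 'b) vec"
  where "csc_vec a x = (\<chi> i. a *\<^sub>C (x $ i))"
instance
proof
  fix a :: complex and x :: "('a, 'b) vec"
  show "norm (a *\<^sub>C x) = cmod a * norm x"
    by (simp add: csc_vec_def norm_vec_def norm_csc L2_set_right_distrib)
qed (auto simp: csc_vec_def csc_of_real csc_add_left csc_add_right csc_csc vec_eq_iff)
end

lemma csc_vec_nth [simp]: "(a *\<^sub>C x) $ i = a *\<^sub>C (x $ i)"
  by (simp add: csc_vec_def)

lemma csc_Pair: "a *\<^sub>C (x, y) = (a *\<^sub>C x, a *\<^sub>C y)"
  by (simp add: csc_prod_def)

lemma fst_csc [simp]: "fst (a *\<^sub>C x) = a *\<^sub>C fst x"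
  and snd_csc [simp]: "snd (a *\<^sub>C x) = a *\<^sub>C snd x"
  by (simp_all add: csc_prod_def)

lemma csc_complex [simp]: "a *\<^sub>C (x :: complex) = a * x"
  by (simp add: csc_complex_def)

lemma csc_scaleR: "(r *\<^sub>R a) *\<^sub>C x = r *\<^sub>R (a *\<^sub>C x)" "a *\<^sub>C (r *\<^sub>R x) = r *\<^sub>R (a *\<^sub>C x)"
  by (metis csc_csc csc_of_real scaleR_conv_of_real, metis csc_csc csc_of_real mult.commute)

lemma bounded_bilinear_csc: "bounded_bilinear (csc :: complex \<Rightarrow> 'a::cvec \<Rightarrow> 'a)"
  by standard (auto simp: csc_add_left csc_add_right csc_scaleR norm_csc intro!: exI[of _ 1])

interpretation csc: bounded_bilinear "csc :: complex \<Rightarrow> 'a::cvec \<Rightarrow> 'a"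
  by (rule bounded_bilinear_csc)

lemmas csc_zero [simp] = csc.zero_left csc.zero_right

lemma csc_one [simp]: "1 *\<^sub>C x = x"
  using csc_of_real[of 1 x] by simp

text \<open>Additivity of \<open>D\<close> is part of \<open>has_derivative\<close>, so complex
  homogeneity makes \<open>D\<close> complex linear.\<close>

definition has_cderiv :: "('a::cvec \<Rightarrow> 'b::cvec) \<Rightarrow> ('a \<Rightarrow> 'b) \<Rightarrow> 'a \<Rightarrow> bool" where
  "has_cderiv f D x \<longleftrightarrow> (f has_derivative D) (at x) \<and> (\<forall>c v. D (c *\<^sub>C v) = c *\<^sub>C D v)"

text \<open>The derivative is taken in the full space and not within \<open>S\<close>; hence the
  property is pointwise, passes to subsets at once, and for open \<open>S\<close> is holomorphy in
  several variables.\<close>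

definition hol_on :: "'a::cvec set \<Rightarrow> ('a \<Rightarrow> 'b::cvec) \<Rightarrow> bool" where
  "hol_on S f \<longleftrightarrow> (\<forall>x\<in>S. \<exists>D. has_cderiv f D x)"

definition fderiv :: "('a::real_normed_vector \<Rightarrow> 'b::real_normed_vector) \<Rightarrow> 'a \<Rightarrow> 'a \<Rightarrow> 'b" where
  "fderiv f x = frechet_derivative f (at x)"

lemma has_cderiv_fderiv: "has_cderiv f D x \<Longrightarrow> has_cderiv f (fderiv f x) x"
  unfolding has_cderiv_def fderiv_def using frechet_derivative_at by metis

lemma hol_fderiv:
  assumes "hol_on S f" "x \<in> S"
  shows "has_cderiv f (fderiv f x) x"
    and "(f has_derivative fderiv f x) (at x)"
    and "fderiv f x (c *\<^sub>C v) = c *\<^sub>C fderiv f x v"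
    and "isCont f x"
proof -
  show "has_cderiv f (fderiv f x) x"
    using assms has_cderiv_fderiv unfolding hol_on_def by blast
  then show "(f has_derivative fderiv f x) (at x)" "fderiv f x (c *\<^sub>C v) = c *\<^sub>C fderiv f x v"
    by (auto simp: has_cderiv_def)
  then show "isCont f x"
    using has_derivative_continuous by blast
qed

lemma fderiv_unique: "(f has_derivative D) (at x) \<Longrightarrow> fderiv f x = D"
  unfolding fderiv_def using frechet_derivative_at by metis

lemma hol_subset: "hol_on S f \<Longrightarrow> T \<subseteq> S \<Longrightarrow> hol_on T f"
  by (auto simp: hol_on_def)

lemma hol_ball_mono: "hol_on (ball x r) f \<Longrightarrow> s \<le> r \<Longrightarrow> hol_on (ball x s) f"
  using hol_subset subset_ball by blast

lemma hol_UnionI: "(\<And>x. x \<in> S \<Longrightarrow> \<exists>T. x \<in> T \<and> hol_on T f) \<Longrightarrow> hol_on S f"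
  by (meson hol_on_def)

lemma hol_continuous_on: "hol_on S f \<Longrightarrow> continuous_on S f"
  by (simp add: hol_fderiv(4) continuous_at_imp_continuous_on)

lemma has_cderiv_cong:
  assumes "has_cderiv f D x" "open S" "x \<in> S" "\<And>y. y \<in> S \<Longrightarrow> f y = g y"
  shows "has_cderiv g D x"
  using assms has_derivative_transform_within_open unfolding has_cderiv_def by blast

lemma hol_cong:
  assumes "hol_on S f" "open S" "\<And>y. y \<in> S \<Longrightarrow> f y = g y"
  shows "hol_on S g"
  using assms has_cderiv_cong unfolding hol_on_def by metis

lemma hol_const [intro, simp]: "hol_on S (\<lambda>_. c)"
  unfolding hol_on_def has_cderiv_def
  by (intro ballI exI[of _ "\<lambda>_. 0"]) auto

lemma hol_linear:
  assumes "bounded_linear f" "\<And>c v. f (c *\<^sub>C v) = c *\<^sub>C f v"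
  shows "hol_on S f"
  unfolding hol_on_def has_cderiv_def using assms bounded_linear_imp_has_derivative by blast

lemma hol_ident [intro, simp]: "hol_on S (\<lambda>x. x)"
  by (rule hol_linear) (auto intro: bounded_linear_ident)

lemma hol_compose:
  assumes "hol_on S f" "hol_on T g" "\<And>x. x \<in> S \<Longrightarrow> f x \<in> T"
  shows "hol_on S (\<lambda>x. g (f x))"
  unfolding hol_on_def
proof
  fix x assume x: "x \<in> S"
  obtain D where D: "has_cderiv f D x" using assms(1) x unfolding hol_on_def by blast
  obtain D' where D': "has_cderiv g D' (f x)" using assms(2,3) x unfolding hol_on_def by blast
  have "has_cderiv (\<lambda>x. g (f x)) (\<lambda>v. D' (D v)) x"
    using D D' unfolding has_cderiv_def by (auto intro: has_derivative_compose)
  then show "\<exists>D. has_cderiv (\<lambda>x. g (f x)) D x" by blast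
qed

lemma hol_compose_linear:
  assumes "hol_on S f" "bounded_linear g" "\<And>c v. g (c *\<^sub>C v) = c *\<^sub>C g v"
  shows "hol_on S (\<lambda>x. g (f x))"
  by (rule hol_compose[OF assms(1) hol_linear[OF assms(2,3), of UNIV]]) auto

lemma hol_bilinear:
  assumes "bounded_bilinear B" "\<And>c u v. B (c *\<^sub>C u) v = c *\<^sub>C B u v" "\<And>c u v. B u (c *\<^sub>C v) = c *\<^sub>C B u v"
    and "hol_on S f" "hol_on S g"
  shows "hol_on S (\<lambda>x. B (f x) (g x))"
  unfolding hol_on_def
proof
  fix x assume x: "x \<in> S"
  obtain D where D: "has_cderiv f D x" using assms(4) x unfolding hol_on_def by blast
  obtain D' where D': "has_cderiv g D' x" using assms(5) x unfolding hol_on_def by blast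
  have "has_cderiv (\<lambda>x. B (f x) (g x)) (\<lambda>h. B (f x) (D' h) + B (D h) (g x)) x"
    using D D' bounded_bilinear.FDERIV[OF assms(1), of f D x UNIV g D'] assms(2,3)
    unfolding has_cderiv_def by (auto simp: csc_add_right)
  then show "\<exists>D. has_cderiv (\<lambda>x. B (f x) (g x)) D x" by blast
qed

lemma has_cderiv_add:
  "has_cderiv f D x \<Longrightarrow> has_cderiv g E x \<Longrightarrow> has_cderiv (\<lambda>x. f x + g x) (\<lambda>v. D v + E v) x"
  by (auto simp: has_cderiv_def csc_add_right intro: has_derivative_add)

lemma has_cderiv_Pair:
  "has_cderiv f D x \<Longrightarrow> has_cderiv g E x \<Longrightarrow> has_cderiv (\<lambda>x. (f x, g x)) (\<lambda>v. (D v, E v)) x"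
  by (auto simp: has_cderiv_def csc_Pair intro: has_derivative_Pair)

lemma hol_add: "hol_on S f \<Longrightarrow> hol_on S g \<Longrightarrow> hol_on S (\<lambda>x. f x + g x)"
  unfolding hol_on_def using has_cderiv_add by fast

lemma hol_scaleR: "hol_on S f \<Longrightarrow> hol_on S (\<lambda>x. r *\<^sub>R f x)"
  by (erule hol_compose_linear) (auto simp: bounded_linear_scaleR_right csc_scaleR)

lemma hol_diff: "hol_on S f \<Longrightarrow> hol_on S g \<Longrightarrow> hol_on S (\<lambda>x. f x - g x)"
  using hol_add[OF _ hol_scaleR[of S g "-1"]] by simp

lemma hol_sum: "(\<And>i. i \<in> I \<Longrightarrow> hol_on S (f i)) \<Longrightarrow> hol_on S (\<lambda>x. \<Sum>i\<in>I. f i x)"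
  by (induction I rule: infinite_finite_induct) (auto intro: hol_add)

lemma hol_csc: "hol_on S f \<Longrightarrow> hol_on S g \<Longrightarrow> hol_on S (\<lambda>x. f x *\<^sub>C g x)"
  by (rule hol_bilinear[OF bounded_bilinear_csc]) (auto simp: csc_csc mult.commute)

lemma hol_mult: "hol_on S f \<Longrightarrow> hol_on S g \<Longrightarrow> hol_on S (\<lambda>x. f x * g x :: complex)"
  using hol_csc[of S f g] by simp

lemma hol_Pair: "hol_on S f \<Longrightarrow> hol_on S g \<Longrightarrow> hol_on S (\<lambda>x. (f x, g x))"
  unfolding hol_on_def using has_cderiv_Pair by fast

lemma hol_fst: "hol_on S f \<Longrightarrow> hol_on S (\<lambda>x. fst (f x))"
  and hol_snd: "hol_on S f \<Longrightarrow> hol_on S (\<lambda>x. snd (f x))"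
  by (erule hol_compose_linear; simp add: bounded_linear_fst bounded_linear_snd)+

lemma hol_nth: "hol_on S f \<Longrightarrow> hol_on S (\<lambda>x. f x $ i)"
  by (erule hol_compose_linear) (auto simp: bounded_linear_vec_nth)

lemma hol_vec:
  fixes f :: "'a::cvec \<Rightarrow> 'b::cvec ^ 'n::finite"
  assumes "\<And>i. hol_on S (\<lambda>x. f x $ i)"
  shows "hol_on S f"
proof -
  have *: "hol_on S (\<lambda>x. axis i (f x $ i) :: 'b ^ 'n)" for i
  proof (rule hol_compose_linear[OF assms])
    show "bounded_linear (axis i :: 'b \<Rightarrow> 'b ^ 'n)"
      by (intro linear_conv_bounded_linear[THEN iffD1] linearI)
         (auto simp: axis_def vec_eq_iff)
  qed (auto simp: axis_def vec_eq_iff)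
  have "f x = (\<Sum>i\<in>UNIV. axis i (f x $ i))" for x
    by (simp add: vec_eq_iff axis_def)
  then show ?thesis
    using hol_sum[of UNIV S "\<lambda>i x. axis i (f x $ i)", OF *] by presburger
qed

lemma hol_field:
  fixes f :: "complex \<Rightarrow> complex"
  assumes "\<And>z. z \<in> S \<Longrightarrow> \<exists>d. (f has_field_derivative d) (at z)"
  shows "hol_on S f"
  unfolding hol_on_def has_cderiv_def
proof
  fix z assume "z \<in> S"
  then obtain d where "(f has_field_derivative d) (at z)" using assms by blast
  then show "\<exists>D. (f has_derivative D) (at z) \<and> (\<forall>c v. D (c *\<^sub>C v) = c *\<^sub>C D v)"
    by (intro exI[of _ "(*) d"]) (auto simp: has_field_derivative_def mult_ac)
qed

text \<open>A real functional \<open>w \<mapsto> w \<bullet> b\<close> is the real part of a complex linear one, so that the scalar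
  Cauchy inequality applies.\<close>

definition cfunctional :: "'a::cvec \<Rightarrow> 'a \<Rightarrow> complex" where
  "cfunctional b w = Complex (w \<bullet> b) (- ((\<i> *\<^sub>C w) \<bullet> b))"

lemma csc_eq_Re_Im: "c *\<^sub>C v = Re c *\<^sub>R v + Im c *\<^sub>R (\<i> *\<^sub>C v)"
proof -
  have "c *\<^sub>C v = (of_real (Re c) + of_real (Im c) * \<i>) *\<^sub>C v"
    by (metis complex_eq mult.commute)
  then show ?thesis by (metis csc_add_left csc_csc csc_of_real)
qed

lemma i_csc_i: "\<i> *\<^sub>C \<i> *\<^sub>C v = - v"
  by (metis complex_i_mult_minus csc.minus_left csc_csc csc_one mult_1s(1) i_squared power2_eq_square)

lemma bounded_linear_cfunctional: "bounded_linear (cfunctional b)"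
  unfolding linear_conv_bounded_linear[symmetric]
  by (rule linearI) (auto simp: cfunctional_def csc_add_right csc_scaleR inner_add_left complex_eq_iff)

lemma cfunctional_csc: "cfunctional b (c *\<^sub>C v) = c * cfunctional b v"
  by (simp add: cfunctional_def csc_eq_Re_Im[of c] csc_add_right csc_scaleR i_csc_i inner_add_left
      inner_diff_left complex_eq_iff)

lemma norm_cfunctional_le: "norm (cfunctional b w) \<le> 2 * norm w * norm b"
proof -
  have "norm (cfunctional b w) \<le> \<bar>w \<bullet> b\<bar> + \<bar>(\<i> *\<^sub>C w) \<bullet> b\<bar>"
    using cmod_le[of "cfunctional b w"] by (simp add: cfunctional_def)
  also have "\<dots> \<le> norm w * norm b + norm (\<i> *\<^sub>C w) * norm b"
    by (intro add_mono Cauchy_Schwarz_ineq2)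
  finally show ?thesis by (simp add: norm_csc mult_ac)
qed

section \<open>Cauchy estimates and Weierstrass' theorem\<close>

lemma norm_eq_inner_unit: "\<exists>b. norm b \<le> 1 \<and> norm w = w \<bullet> b" for w :: "'a::real_inner"
proof (cases "w = 0")
  case True then show ?thesis by (intro exI[of _ 0]) auto
next
  case False
  then show ?thesis
    by (intro exI[of _ "(1 / norm w) *\<^sub>R w"]) (simp add: dot_square_norm power2_eq_square)
qed

text \<open>The one-variable Cauchy inequality is applied on the complex line
  \<open>x + t *\<^sub>C v\<close>, after composition with the functional whose real part attains
  the norm of the derivative in direction \<open>v\<close>. Of the constant 4, one factor 2 comes
  from \<open>norm_cfunctional_le\<close>, the other from halving the radius.\<close>

lemma cauchy_estimate:
  fixes f :: "'a::cvec \<Rightarrow> 'b::cvec"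
  assumes f: "hol_on (ball x r) f" and B: "\<And>y. y \<in> ball x r \<Longrightarrow> norm (f y) \<le> B"
    and r: "r > 0"
  shows "norm (fderiv f x v) \<le> 4 * B / r * norm v"
proof (cases "v = 0")
  case True
  have "linear (fderiv f x)"
    using hol_fderiv(2)[OF f, of x] r has_derivative_linear by auto
  then show ?thesis using True by (simp add: linear_0)
next
  case False
  \<comment> \<open>Half of the radius at which the line would leave the ball, so that the closed
    disc is mapped into the open ball.\<close>
  define \<rho> where "\<rho> = r / (2 * norm v)"
  have \<rho>: "\<rho> > 0" "\<rho> * norm v < r" using False r by (auto simp: \<rho>_def)
  obtain b where b: "norm b \<le> 1" "norm (fderiv f x v) = fderiv f x v \<bullet> b"
    using norm_eq_inner_unit by blast
  define g where "g t = cfunctional b (f (x + t *\<^sub>C v))" for t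
  have in_ball: "x + t *\<^sub>C v \<in> ball x r" if "cmod t \<le> \<rho>" for t
  proof -
    have "cmod t * norm v \<le> \<rho> * norm v" using that by (simp add: mult_right_mono)
    then show ?thesis using \<rho> by (simp add: dist_norm norm_csc)
  qed
  have deriv_g: "(g has_field_derivative cfunctional b (fderiv f (x + t *\<^sub>C v) v)) (at t)"
    if "cmod t \<le> \<rho>" for t
  proof -
    have "((\<lambda>t. x + t *\<^sub>C v) has_derivative (\<lambda>h. h *\<^sub>C v)) (at t)"
      by (auto intro!: derivative_eq_intros bounded_linear_imp_has_derivative csc.bounded_linear_left)
    from has_derivative_compose[OF this hol_fderiv(2)[OF f in_ball[OF that]]]
    have "((\<lambda>t. f (x + t *\<^sub>C v)) has_derivative (\<lambda>h. fderiv f (x + t *\<^sub>C v) (h *\<^sub>C v))) (at t)" .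
    from bounded_linear.has_derivative[OF bounded_linear_cfunctional this, of b]
    have "((\<lambda>t. cfunctional b (f (x + t *\<^sub>C v))) has_derivative
      (\<lambda>h. cfunctional b (fderiv f (x + t *\<^sub>C v) (h *\<^sub>C v)))) (at t)" .
    moreover have "(\<lambda>h. cfunctional b (fderiv f (x + t *\<^sub>C v) (h *\<^sub>C v))) = (*) (cfunctional b (fderiv f (x
        + t *\<^sub>C v) v))"
      by (simp add: hol_fderiv(3)[OF f in_ball[OF that]] cfunctional_csc fun_eq_iff mult.commute)
    ultimately show ?thesis
      unfolding has_field_derivative_def g_def by (metis (no_types))
  qed
  have "norm ((deriv ^^ 1) g 0) \<le> fact 1 * (2 * B) / \<rho> ^ 1"
  proof (rule Cauchy_inequality)
    have "g field_differentiable at t" if "cmod t \<le> \<rho>" for t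
      using deriv_g[OF that] field_differentiable_def by blast
    then show "g holomorphic_on ball 0 \<rho>" "continuous_on (cball 0 \<rho>) g"
      unfolding holomorphic_on_def
      by (simp_all add: field_differentiable_at_within continuous_at_imp_continuous_on
          field_differentiable_imp_continuous_at)
    fix t :: complex assume "norm (0 - t) = \<rho>"
    then have t: "cmod t \<le> \<rho>" by simp
    have "norm (g t) \<le> 2 * norm (f (x + t *\<^sub>C v)) * norm b"
      unfolding g_def by (rule norm_cfunctional_le)
    also have "\<dots> \<le> 2 * B * 1"
      using B[OF in_ball[OF t]] b(1) by (intro mult_mono) (auto intro: order_trans[OF norm_ge_zero])
    finally show "norm (g t) \<le> 2 * B" by simp
  qed (use \<rho> in auto)
  moreover have "deriv g 0 = cfunctional b (fderiv f x v)"
    using DERIV_imp_deriv[OF deriv_g[of 0]] \<rho> by simp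
  ultimately have "norm (cfunctional b (fderiv f x v)) \<le> 2 * B / \<rho>" by simp
  moreover have "fderiv f x v \<bullet> b \<le> norm (cfunctional b (fderiv f x v))"
    using complex_Re_le_cmod[of "cfunctional b (fderiv f x v)"] by (simp add: cfunctional_def)
  ultimately show ?thesis using b(2) by (simp add: \<rho>_def mult_ac)
qed

lemma cauchy_estimate_inner:
  fixes f :: "'a::cvec \<Rightarrow> 'b::cvec"
  assumes f: "hol_on (ball x (2 * r)) f" and B: "\<And>y. y \<in> ball x (2 * r) \<Longrightarrow> norm (f y) \<le> B"
    and y: "y \<in> ball x r"
  shows "norm (fderiv f y v) \<le> 4 * B / r * norm v"
proof (rule cauchy_estimate)
  have "ball y r \<subseteq> ball x (2 * r)"
  proof
    fix z assume "z \<in> ball y r"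
    then show "z \<in> ball x (2 * r)"
      using y dist_triangle[of x z y] by simp
  qed
  then show "hol_on (ball y r) f" "\<And>z. z \<in> ball y r \<Longrightarrow> norm (f z) \<le> B"
    using f B by (auto intro: hol_subset)
  show "r > 0" using y by (metis ball_empty empty_iff not_le)
qed

text \<open>The mean value inequality for \<open>f - D\<close>. Here \<open>D\<close> is one fixed
  linear map close to all derivatives on \<open>T\<close>, typically the derivative at a single
  point.\<close>

lemma linearization_error:
  fixes f :: "'a::cvec \<Rightarrow> 'b::cvec"
  assumes f: "hol_on T f" and T: "convex T" "y \<in> T" "z \<in> T" and D: "bounded_linear D"
    and e: "\<And>u v. u \<in> T \<Longrightarrow> norm (fderiv f u v - D v) \<le> e * norm v"
  shows "norm (f y - f z - D (y - z)) \<le> e * norm (y - z)"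
proof -
  interpret D: bounded_linear D by fact
  have "norm ((f y - D y) - (f z - D z)) \<le> e * norm (y - z)"
  proof (rule differentiable_bound[OF T(1) _ _ T(2,3), where f' = "\<lambda>u v. fderiv f u v - D v"])
    fix u assume u: "u \<in> T"
    show "((\<lambda>y. f y - D y) has_derivative (\<lambda>v. fderiv f u v - D v)) (at u within T)"
      by (intro has_derivative_diff bounded_linear_imp_has_derivative D)
         (use hol_fderiv(2)[OF f u] has_derivative_at_withinI in blast)
    show "onorm (\<lambda>v. fderiv f u v - D v) \<le> e"
      by (rule onorm_le) (rule e[OF u])
  qed
  then show ?thesis by (simp add: D.diff algebra_simps)
qed

text \<open>The Lipschitz bound for the derivative comes from a first-order estimate: the
  translation difference \<open>h u = f (u + (y - z)) - f u\<close> is bounded by a multiple of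
  \<open>norm (y - z)\<close>, and Cauchy's estimate for \<open>h\<close> at \<open>z\<close> bounds
  \<open>fderiv f y - fderiv f z\<close>.\<close>

lemma hol_fderiv_lipschitz:
  fixes f :: "'a::cvec \<Rightarrow> 'b::cvec"
  assumes f: "hol_on S f" and S: "open S" "x \<in> S"
  obtains r C where "r > 0" "C \<ge> 0" "ball x r \<subseteq> S"
    "\<And>y z v. y \<in> ball x r \<Longrightarrow> z \<in> ball x r \<Longrightarrow> norm (fderiv f y v - fderiv f z v) \<le> C * norm (y - z) * norm v"
    "\<And>y v. y \<in> ball x r \<Longrightarrow> norm (fderiv f y v) \<le> C * norm v"
    "\<And>y z. y \<in> ball x r \<Longrightarrow> z \<in> ball x r \<Longrightarrow> norm (f y - f z) \<le> C * norm (y - z)"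
proof -
  obtain r1 where r1: "r1 > 0" "ball x r1 \<subseteq> S"
    using S open_contains_ball by blast
  have "isCont f x" using hol_fderiv(4)[OF f S(2)] .
  then obtain r2 where r2: "r2 > 0" "\<And>y. dist y x < r2 \<Longrightarrow> dist (f y) (f x) < 1"
    unfolding continuous_at_eps_delta by (metis zero_less_one)
  \<comment> \<open>Room for two enlargements: the translate of \<open>ball z r\<close> by
    \<open>y - z\<close> stays within radius \<open>4 * r\<close>, and derivatives are bounded there
    because \<open>f\<close> is bounded up to radius \<open>8 * r\<close>.\<close>
  define r where "r = min r1 r2 / 8"
  have r: "r > 0" "8 * r \<le> r1" "8 * r \<le> r2" using r1 r2 by (auto simp: r_def)
  define B where "B = norm (f x) + 1"
  have B: "norm (f y) \<le> B" if "y \<in> ball x (2 * (4 * r))" for y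
  proof -
    have "dist (f y) (f x) < 1" using that r by (intro r2) (auto simp: dist_commute)
    then have "norm (f y - f x) < 1" by (simp add: dist_norm)
    then show ?thesis unfolding B_def using norm_triangle_sub[of "f y" "f x"] by simp
  qed
  have "B \<ge> 0" by (simp add: B_def)
  define L where "L = 4 * B / (4 * r)"
  have L: "L \<ge> 0" using r \<open>B \<ge> 0\<close> by (simp add: L_def)
  have hol: "hol_on (ball x (2 * (4 * r))) f"
    using r by (intro hol_ball_mono[OF hol_subset[OF f r1(2)]]) auto
  have hol4: "hol_on (ball x (4 * r)) f" using r by (intro hol_ball_mono[OF hol]) auto
  have dL: "norm (fderiv f y v) \<le> L * norm v" if "y \<in> ball x (4 * r)" for y v
    unfolding L_def by (rule cauchy_estimate_inner[OF hol B that]) auto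
  have lip: "norm (f y - f z) \<le> L * norm (y - z)" if "y \<in> ball x (4 * r)" "z \<in> ball x (4 * r)" for y z
    using linearization_error[OF hol4 convex_ball that, of "\<lambda>_. 0" L] dL by simp
  have dlip: "norm (fderiv f y v - fderiv f z v) \<le> (4 * L / r) * norm (y - z) * norm v"
    if yz: "y \<in> ball x r" "z \<in> ball x r" for y z v
  proof -
    define h where "h u = f (u + (y - z)) - f u" for u
    have sub: "u \<in> ball x (4 * r)" "u + (y - z) \<in> ball x (4 * r)" if "u \<in> ball z r" for u
    proof -
      have "norm (u - x) < 2 * r"
        using norm_triangle_lt[of "u - z" "z - x" "2 * r"] that yz
        by (simp add: dist_norm norm_minus_commute)
      moreover have "norm (y - z) < 2 * r"
        using norm_triangle_lt[of "y - x" "x - z" "2 * r"] yz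
        by (simp add: dist_norm norm_minus_commute)
      ultimately show "u \<in> ball x (4 * r)" "u + (y - z) \<in> ball x (4 * r)"
        using norm_triangle_lt[of "u - x" "y - z" "4 * r"] r
        by (auto simp: dist_norm norm_minus_commute algebra_simps)
    qed
    have "hol_on (ball z r) (\<lambda>u. f (u + (y - z)))"
      by (rule hol_compose[OF _ hol4]) (use sub in \<open>auto intro: hol_add\<close>)
    then have hh: "hol_on (ball z r) h"
      unfolding h_def using sub(1) hol4 by (intro hol_diff) (auto intro: hol_subset)
    have hb: "norm (h u) \<le> L * norm (y - z)" if "u \<in> ball z r" for u
      using lip[OF sub(2)[OF that] sub(1)[OF that]] by (simp add: h_def)
    have z: "z \<in> ball z r" using r by simp
    have "((\<lambda>u. u + (y - z)) has_derivative (\<lambda>h. h)) (at z)"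
      by (auto intro!: derivative_eq_intros)
    from has_derivative_compose[OF this, of f "fderiv f y"]
    have "((\<lambda>u. f (u + (y - z))) has_derivative fderiv f y) (at z)"
      using hol_fderiv(2)[OF hol4 sub(2)[OF z]] by simp
    then have "(h has_derivative (\<lambda>v. fderiv f y v - fderiv f z v)) (at z)"
      unfolding h_def by (rule has_derivative_diff) (rule hol_fderiv(2)[OF hol4 sub(1)[OF z]])
    then have "fderiv h z v = fderiv f y v - fderiv f z v"
      by (simp add: fderiv_unique)
    then show ?thesis
      using cauchy_estimate[OF hh hb r(1), of v] by (simp add: mult_ac)
  qed
  define C where "C = max L (4 * L / r)"
  have C: "L \<le> C" "4 * L / r \<le> C" "C \<ge> 0" using L by (auto simp: C_def)
  show thesis
  proof
    show "r > 0" "C \<ge> 0" "ball x r \<subseteq> S" using r C r1 by auto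
    show "norm (fderiv f y v - fderiv f z v) \<le> C * norm (y - z) * norm v"
      if "y \<in> ball x r" "z \<in> ball x r" for y z v
      using C by (intro order_trans[OF dlip[OF that]] mult_right_mono) auto
    show "norm (fderiv f y v) \<le> C * norm v" if "y \<in> ball x r" for y v
      using C r that by (intro order_trans[OF dL[of y v]] mult_right_mono) auto
    show "norm (f y - f z) \<le> C * norm (y - z)" if "y \<in> ball x r" "z \<in> ball x r" for y z
      using C r that by (intro order_trans[OF lip[of y z]] mult_right_mono) auto
  qed
qed

text \<open>Strict differentiability: both points vary, so near \<open>x\<close> the map is its
  derivative plus an \<open>e\<close>-Lipschitz remainder, the form in which contraction arguments
  use it.\<close>

lemma hol_strict_derivative:
  fixes f :: "'a::cvec \<Rightarrow> 'b::cvec"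
  assumes f: "hol_on S f" and S: "open S" "x \<in> S" and e: "e > 0"
  obtains \<delta> where "\<delta> > 0" "ball x \<delta> \<subseteq> S"
    "\<And>y z. y \<in> ball x \<delta> \<Longrightarrow> z \<in> ball x \<delta> \<Longrightarrow> norm (f y - f z - fderiv f x (y - z)) \<le> e * norm (y - z)"
proof -
  obtain r C where rC: "r > 0" "C \<ge> 0" "ball x r \<subseteq> S" and
    lip: "\<And>y z v. y \<in> ball x r \<Longrightarrow> z \<in> ball x r \<Longrightarrow> norm (fderiv f y v - fderiv f z v) \<le> C * norm (y - z) * norm v"
    using hol_fderiv_lipschitz[OF f S] by metis
  define \<delta> where "\<delta> = min r (e / (C + 1))"
  have \<delta>: "\<delta> > 0" "\<delta> \<le> r" "\<delta> \<le> e / (C + 1)" using rC e by (auto simp: \<delta>_def)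
  have hol: "hol_on (ball x \<delta>) f" using hol_ball_mono[OF hol_subset[OF f rC(3)] \<delta>(2)] .
  show thesis
  proof (rule that[of \<delta>])
    fix y z assume yz: "y \<in> ball x \<delta>" "z \<in> ball x \<delta>"
    show "norm (f y - f z - fderiv f x (y - z)) \<le> e * norm (y - z)"
    proof (rule linearization_error[OF hol convex_ball yz])
      fix u v assume u: "u \<in> ball x \<delta>"
      then have ux: "norm (u - x) \<le> e / (C + 1)" using \<delta> by (simp add: dist_norm norm_minus_commute)
      have "norm (fderiv f u v - fderiv f x v) \<le> C * norm (u - x) * norm v"
        using u \<delta> rC by (intro lip) auto
      also have "C * norm (u - x) \<le> C * (e / (C + 1))" using ux rC by (intro mult_left_mono) auto
      also have "\<dots> \<le> e" using rC e by (simp add: field_simps)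
      finally show "norm (fderiv f u v - fderiv f x v) \<le> e * norm v"
        by (simp add: mult_right_mono)
    next
      show "bounded_linear (fderiv f x)"
        using hol_fderiv(2)[OF f S(2)] has_derivative_bounded_linear by blast
    qed
  qed (use \<delta> rC in auto)
qed

text \<open>Weierstrass' theorem. Cauchy's estimate turns the uniform Cauchy property of
  \<open>f n\<close> into one for the derivatives on a ball of half the radius; then limit and
  derivative may be exchanged, and complex homogeneity passes to the limit.\<close>

lemma hol_uniform_limit:
  fixes f :: "nat \<Rightarrow> 'a::cvec \<Rightarrow> 'b::cvec"
  assumes f: "\<And>n. hol_on S (f n)" and S: "open S" and lim: "uniform_limit S f g sequentially"
  shows "hol_on S g"
proof (rule hol_UnionI)
  fix x assume "x \<in> S"
  then obtain r0 where r0: "r0 > 0" "ball x r0 \<subseteq> S"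
    using S open_contains_ball by blast
  define r where "r = r0 / 2"
  have r: "r > 0" "ball x (2 * r) \<subseteq> S" using r0 by (auto simp: r_def)
  have hol: "hol_on (ball x (2 * r)) (f n)" for n using f r by (auto intro: hol_subset)
  have holr: "hol_on (ball x r) (f n)" for n using r by (intro hol_ball_mono[OF hol]) auto
  have ucauchy: "\<exists>N. \<forall>m\<ge>N. \<forall>n\<ge>N. \<forall>y\<in>ball x r. \<forall>v. norm (fderiv (f m) y v - fderiv (f n) y v) \<le> e * norm v"
    if e: "e > 0" for e
  proof -
    \<comment> \<open>Two such deviations add up to \<open>e * r / 4\<close>, and the factor
      \<open>4 / r\<close> in Cauchy's estimate turns this into \<open>e\<close>.\<close>
    have e': "e * r / 8 > 0" using e r by simp
    obtain N where N: "\<And>n y. n \<ge> N \<Longrightarrow> y \<in> S \<Longrightarrow> dist (f n y) (g y) < e * r / 8"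
      using uniform_limitD[OF lim e'] unfolding eventually_sequentially by blast
    have "norm (fderiv (f m) y v - fderiv (f n) y v) \<le> e * norm v"
      if mn: "m \<ge> N" "n \<ge> N" and y: "y \<in> ball x r" for m n y v
    proof -
      have "norm (fderiv (\<lambda>y. f m y - f n y) y v) \<le> 4 * (e * r / 4) / r * norm v"
      proof (rule cauchy_estimate_inner[OF _ _ y])
        show "hol_on (ball x (2 * r)) (\<lambda>y. f m y - f n y)" by (intro hol_diff hol)
        fix z assume "z \<in> ball x (2 * r)"
        then have "z \<in> S" using r by auto
        then have "dist (f m z) (f n z) < e * r / 8 + e * r / 8"
          using N[OF mn(1)] N[OF mn(2)] by (metis add_strict_mono dist_commute dist_triangle_less_add)
        then show "norm (f m z - f n z) \<le> e * r / 4" by (simp add: dist_norm)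
      qed
      moreover have "fderiv (\<lambda>y. f m y - f n y) y = (\<lambda>v. fderiv (f m) y v - fderiv (f n) y v)"
        by (intro fderiv_unique has_derivative_diff hol_fderiv(2)[OF holr y])
      ultimately show ?thesis using r by simp
    qed
    then show ?thesis by blast
  qed
  have "\<exists>l. (\<lambda>n. fderiv (f n) y v) \<longlonglongrightarrow> l" if y: "y \<in> ball x r" for y v
  proof -
    have "Cauchy (\<lambda>n. fderiv (f n) y v)"
    proof (rule CauchyI)
      fix e :: real assume e: "e > 0"
      then have "e / (norm v + 1) > 0" by (simp add: add_nonneg_pos)
      from ucauchy[OF this] obtain N where
        N: "\<And>m n. m \<ge> N \<Longrightarrow> n \<ge> N \<Longrightarrow> norm (fderiv (f m) y v - fderiv (f n) y v) \<le> e / (norm v + 1) * norm v"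
        using y by blast
      have "e / (norm v + 1) * norm v < e"
        using e by (simp add: field_simps add_pos_nonneg add_nonneg_pos)
      then show "\<exists>M. \<forall>m\<ge>M. \<forall>n\<ge>M. norm (fderiv (f m) y v - fderiv (f n) y v) < e"
        using N by (meson order_le_less_trans)
    qed
    then show ?thesis by (simp add: Cauchy_convergent_iff convergent_def)
  qed
  then obtain D where D: "\<And>y v. y \<in> ball x r \<Longrightarrow> (\<lambda>n. fderiv (f n) y v) \<longlonglongrightarrow> D y v"
    by metis
  have unif: "\<forall>\<^sub>F n in sequentially. \<forall>y\<in>ball x r. \<forall>v. norm (fderiv (f n) y v - D y v) \<le> e * norm v"
    if e: "e > 0" for e
  proof -
    from ucauchy[OF e] obtain N where
      N: "\<And>m n y v. m \<ge> N \<Longrightarrow> n \<ge> N \<Longrightarrow> y \<in> ball x r \<Longrightarrow> norm (fderiv (f m) y v - fderiv (f n) y v) \<le> e * norm v"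
      by blast
    have "norm (fderiv (f m) y v - D y v) \<le> e * norm v" if "m \<ge> N" "y \<in> ball x r" for m y v
    proof (rule tendsto_upperbound)
      show "(\<lambda>n. norm (fderiv (f m) y v - fderiv (f n) y v)) \<longlonglongrightarrow> norm (fderiv (f m) y v - D y v)"
        by (intro tendsto_intros D that)
      show "\<forall>\<^sub>F n in sequentially. norm (fderiv (f m) y v - fderiv (f n) y v) \<le> e * norm v"
        using N[OF that(1) _ that(2)] unfolding eventually_sequentially by blast
    qed auto
    then show ?thesis unfolding eventually_sequentially by blast
  qed
  have limg: "(\<lambda>n. f n y) \<longlonglongrightarrow> g y" if "y \<in> ball x r" for y
    using tendsto_uniform_limitI[OF lim] that r(2) subset_ball[of r "2 * r" x] r(1) by (simp add: subset_iff)
  \<comment> \<open>The exchange theorem supplies its own limit function \<open>h\<close>,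
    identified with \<open>g\<close> at the end by uniqueness of limits.\<close>
  have "\<exists>h. \<forall>y\<in>ball x r. (\<lambda>n. f n y) \<longlonglongrightarrow> h y \<and> (h has_derivative D y) (at y within ball x r)"
  proof (rule has_derivative_sequence[OF _ _ unif _ limg])
    show "(f n has_derivative fderiv (f n) y) (at y within ball x r)" if "y \<in> ball x r" for n y
      using hol_fderiv(2)[OF holr that] has_derivative_at_withinI by blast
    show "x \<in> ball x r" "x \<in> ball x r" using r by auto
  qed auto
  then obtain h where h: "\<And>y. y \<in> ball x r \<Longrightarrow> (\<lambda>n. f n y) \<longlonglongrightarrow> h y"
    "\<And>y. y \<in> ball x r \<Longrightarrow> (h has_derivative D y) (at y)"
    using at_within_open[OF _ open_ball, of _ x r] by metis
  have "D y (c *\<^sub>C v) = c *\<^sub>C D y v" if "y \<in> ball x r" for y c v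
  proof (rule LIMSEQ_unique[OF D[OF that]])
    show "(\<lambda>n. fderiv (f n) y (c *\<^sub>C v)) \<longlonglongrightarrow> c *\<^sub>C D y v"
      unfolding hol_fderiv(3)[OF holr that] by (intro csc.tendsto tendsto_const D that)
  qed
  then have "hol_on (ball x r) h"
    using h(2) unfolding hol_on_def has_cderiv_def by blast
  moreover have "h y = g y" if "y \<in> ball x r" for y
    using LIMSEQ_unique[OF h(1) limg] that by blast
  ultimately have "hol_on (ball x r) g" by (blast intro: hol_cong)
  then show "\<exists>T. x \<in> T \<and> hol_on T g" using r by (intro exI[of _ "ball x r"]) auto
qed

text \<open>Difference quotients with steps \<open>t n\<close> are holomorphic, and the Lipschitz
  bound for the derivative makes them converge uniformly with an error of order \<open>t n\<close>;
  so Weierstrass' theorem applies.\<close>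

lemma hol_directional_derivative:
  fixes f :: "'a::cvec \<Rightarrow> 'b::cvec"
  assumes f: "hol_on S f" and S: "open S"
  shows "hol_on S (\<lambda>x. fderiv f x v)"
proof (rule hol_UnionI)
  fix x assume x: "x \<in> S"
  obtain r C where rC: "r > 0" "C \<ge> 0" "ball x r \<subseteq> S" and
    lip: "\<And>y z v. y \<in> ball x r \<Longrightarrow> z \<in> ball x r \<Longrightarrow> norm (fderiv f y v - fderiv f z v) \<le> C * norm (y - z) * norm v"
    using hol_fderiv_lipschitz[OF f S x] by metis
  define \<rho> where "\<rho> = r / 2"
  obtain N :: nat where N: "norm v / \<rho> < real N"
    using reals_Archimedean2 by blast
  have \<rho>: "\<rho> > 0" using rC by (simp add: \<rho>_def)
  \<comment> \<open>The shift by \<open>N\<close> keeps \<open>t n * norm v\<close> below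
    \<open>\<rho>\<close> already for \<open>n = 0\<close>.\<close>
  define t where "t n = 1 / real (Suc (N + n))" for n
  have t: "t n > 0" "t n * norm v < \<rho>" for n
  proof -
    show "t n > 0" by (simp add: t_def)
    have "norm v < \<rho> * real N" using N \<rho> by (simp add: field_simps)
    also have "\<dots> \<le> \<rho> * real (Suc (N + n))" using \<rho> by (intro mult_left_mono) auto
    finally show "t n * norm v < \<rho>" unfolding t_def by (simp add: field_simps)
  qed
  define q where "q n y = (1 / t n) *\<^sub>R (f (y + t n *\<^sub>R v) - f y)" for n y
  have hol: "hol_on (ball x r) f" using f rC by (auto intro: hol_subset)
  have in_ball: "y \<in> ball x r" "y + t n *\<^sub>R v \<in> ball x r" if "y \<in> ball x \<rho>" for y n
  proof -
    have "norm (y - x) < \<rho>" using that by (simp add: dist_norm norm_minus_commute)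
    moreover have "norm (t n *\<^sub>R v) < \<rho>" using t[of n] by simp
    ultimately have "norm (y - x) < r" "norm ((y - x) + t n *\<^sub>R v) < r"
      using norm_triangle_lt[of "y - x" "t n *\<^sub>R v" r] \<rho> by (auto simp: \<rho>_def)
    then show "y \<in> ball x r" "y + t n *\<^sub>R v \<in> ball x r"
      by (auto simp: dist_norm norm_minus_commute algebra_simps)
  qed
  have holq: "hol_on (ball x \<rho>) (q n)" for n
    unfolding q_def
  proof (intro hol_scaleR hol_diff)
    show "hol_on (ball x \<rho>) (\<lambda>y. f (y + t n *\<^sub>R v))"
      by (rule hol_compose[OF _ hol]) (use in_ball in \<open>auto intro: hol_add\<close>)
    show "hol_on (ball x \<rho>) f" using in_ball hol by (auto intro: hol_subset)
  qed
  have err: "norm (q n y - fderiv f y v) \<le> t n * (C * (norm v)\<^sup>2)" if y: "y \<in> ball x \<rho>" for n y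
  proof -
    define b where "b = t n * norm v"
    have b: "b \<ge> 0" using t[of n] by (simp add: b_def less_imp_le)
    define w where "w = y + t n *\<^sub>R v"
    have seg: "u \<in> ball x r" "norm (u - y) \<le> b" if "u \<in> closed_segment y w" for u
    proof -
      show "u \<in> ball x r" using in_ball(1)[OF y] in_ball(2)[OF y, of n] that unfolding w_def
        by (meson convex_ball convex_contains_segment subsetD)
      show "norm (u - y) \<le> b" using segment_bound(1)[OF that] t[of n] by (simp add: w_def b_def)
    qed
    \<comment> \<open>On the segment of length \<open>b\<close> the derivative deviates from
      \<open>fderiv f y\<close> by at most \<open>C * b\<close>, so the error is quadratic in
      \<open>b\<close>; division by \<open>t n\<close> leaves one factor \<open>t n\<close>.\<close>
    have "norm (f w - f y - fderiv f y (w - y)) \<le> (C * b) * norm (w - y)"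
    proof (rule linearization_error[OF hol_subset[OF hol] convex_closed_segment])
      show "closed_segment y w \<subseteq> ball x r" using seg(1) by blast
      show "bounded_linear (fderiv f y)"
        using hol_fderiv(2)[OF hol in_ball(1)[OF y]] has_derivative_bounded_linear by blast
      fix u v' assume u: "u \<in> closed_segment y w"
      have "norm (fderiv f u v' - fderiv f y v') \<le> C * norm (u - y) * norm v'"
        using lip[OF seg(1)[OF u] in_ball(1)[OF y]] .
      also have "\<dots> \<le> C * b * norm v'"
        using seg(2)[OF u] rC by (intro mult_right_mono mult_left_mono) auto
      finally show "norm (fderiv f u v' - fderiv f y v') \<le> C * b * norm v'" .
    qed auto
    moreover have "fderiv f y (w - y) = t n *\<^sub>R fderiv f y v"
      using has_derivative_linear[OF hol_fderiv(2)[OF hol in_ball(1)[OF y]]] by (simp add: w_def linear_scale)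
    ultimately have *: "norm (f w - f y - t n *\<^sub>R fderiv f y v) \<le> C * b * b"
      using t[of n] by (simp add: w_def b_def)
    have "q n y - fderiv f y v = (1 / t n) *\<^sub>R (f w - f y - t n *\<^sub>R fderiv f y v)"
      using t[of n] by (simp add: q_def w_def scaleR_diff_right)
    then have "norm (q n y - fderiv f y v) = norm (f w - f y - t n *\<^sub>R fderiv f y v) / t n"
      using t[of n] by simp
    also have "\<dots> \<le> (C * b * b) / t n" using * t[of n] by (intro divide_right_mono) auto
    also have "\<dots> = t n * (C * (norm v)\<^sup>2)" using t[of n] by (simp add: b_def power2_eq_square)
    finally show ?thesis .
  qed
  have tlim: "(\<lambda>n. t n * (C * (norm v)\<^sup>2)) \<longlonglongrightarrow> 0"
  proof -
    have "(\<lambda>n. t n) \<longlonglongrightarrow> 0"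
    proof -
      have "(\<lambda>n. 1 / real (n + Suc N)) \<longlonglongrightarrow> 0"
        by (rule LIMSEQ_ignore_initial_segment[OF lim_1_over_n])
      then show ?thesis unfolding t_def by (simp add: add_ac)
    qed
    then show ?thesis by (rule tendsto_mult_left_zero)
  qed
  have "uniform_limit (ball x \<rho>) q (\<lambda>y. fderiv f y v) sequentially"
    unfolding uniform_limit_iff
  proof clarify
    fix e :: real assume "e > 0"
    then have "\<forall>\<^sub>F n in sequentially. t n * (C * (norm v)\<^sup>2) < e"
      using tlim order_tendstoD(2) by blast
    then show "\<forall>\<^sub>F n in sequentially. \<forall>y\<in>ball x \<rho>. dist (q n y) (fderiv f y v) < e"
      by (rule eventually_mono) (use order_le_less_trans[OF err] in \<open>simp add: dist_norm\<close>)
  qed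
  then have "hol_on (ball x \<rho>) (\<lambda>y. fderiv f y v)"
    by (rule hol_uniform_limit[OF holq open_ball])
  then show "\<exists>T. x \<in> T \<and> hol_on T (\<lambda>y. fderiv f y v)" using \<rho> by (intro exI[of _ "ball x \<rho>"]) auto
qed

text \<open>The hypothesis reproduces itself: if \<open>G\<close> extends \<open>f\<close> near a
  point, then the derivative of \<open>G\<close> in direction \<open>\<iota> v\<close> extends the
  derivative of \<open>f\<close> in direction \<open>v\<close>, and it is again holomorphic. This
  drives the induction on the order.\<close>

lemma C_inf_on_of_local_extension:
  fixes f :: "'a::real_normed_vector \<Rightarrow> 'b::cvec" and \<iota> :: "'a \<Rightarrow> 'c::cvec"
  assumes S: "open S" and \<iota>: "bounded_linear \<iota>"
    and ext: "\<And>x. x \<in> S \<Longrightarrow> \<exists>U \<Omega> G. open U \<and> x \<in> U \<and> open \<Omega> \<and> hol_on \<Omega> G \<and>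
      (\<forall>y\<in>U \<inter> S. \<iota> y \<in> \<Omega> \<and> f y = G (\<iota> y))"
  shows "C_inf_on S f"
proof -
  have "C_k_on k S f" for k
    using ext
  proof (induction k arbitrary: f)
    case 0
    have "isCont f x" if x: "x \<in> S" for x
    proof -
      obtain U \<Omega> G where U: "open U" "x \<in> U" "open \<Omega>" "hol_on \<Omega> G"
        "\<And>y. y \<in> U \<inter> S \<Longrightarrow> \<iota> y \<in> \<Omega> \<and> f y = G (\<iota> y)"
        using 0[OF x] by blast
      have "isCont (\<lambda>y. G (\<iota> y)) x"
        using isCont_o2[OF linear_continuous_at[OF \<iota>] hol_fderiv(4)[OF U(4)]] U x by auto
      moreover have "\<forall>\<^sub>F y in nhds x. f y = G (\<iota> y)"
      proof -
        have "\<forall>\<^sub>F y in nhds x. y \<in> U \<inter> S"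
          using U(1,2) S x by (intro eventually_nhds_in_open) auto
        then show ?thesis by (rule eventually_mono) (use U(5) in blast)
      qed
      ultimately show ?thesis using isCont_cong by metis
    qed
    then show ?case by (simp add: continuous_at_imp_continuous_on)
  next
    case (Suc k)
    have der: "(f has_derivative (\<lambda>v. fderiv G (\<iota> y) (\<iota> v))) (at y)"
      if "open U" "open \<Omega>" "hol_on \<Omega> G" "\<And>y. y \<in> U \<inter> S \<Longrightarrow> \<iota> y \<in> \<Omega> \<and> f y = G (\<iota> y)" "y \<in> U \<inter> S"
      for U \<Omega> G y
    proof (rule has_derivative_transform_within_open)
      show "((\<lambda>y. G (\<iota> y)) has_derivative (\<lambda>v. fderiv G (\<iota> y) (\<iota> v))) (at y)"
        using that by (intro has_derivative_compose[OF bounded_linear_imp_has_derivative[OF \<iota>]]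
            hol_fderiv(2)[of \<Omega>]) auto
      show "open (U \<inter> S)" using that S by auto
    qed (use that in auto)
    show ?case
      unfolding C_k_on.simps
    proof (intro conjI ballI allI)
      fix x assume "x \<in> S"
      then show "f differentiable at x"
        using Suc.prems der unfolding differentiable_def by (metis IntI)
    next
      fix v
      show "C_k_on k S (\<lambda>x. frechet_derivative f (at x) v)"
      proof (rule Suc.IH)
        fix x assume x: "x \<in> S"
        obtain U \<Omega> G where U: "open U" "x \<in> U" "open \<Omega>" "hol_on \<Omega> G"
          "\<And>y. y \<in> U \<inter> S \<Longrightarrow> \<iota> y \<in> \<Omega> \<and> f y = G (\<iota> y)"
          using Suc.prems[OF x] by blast
        have "frechet_derivative f (at y) v = fderiv G (\<iota> y) (\<iota> v)" if "y \<in> U \<inter> S" for y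
          using frechet_derivative_at[OF der[OF U(1,3,4,5) that]] by metis
        then show "\<exists>U \<Omega> G. open U \<and> x \<in> U \<and> open \<Omega> \<and> hol_on \<Omega> G \<and>
          (\<forall>y\<in>U \<inter> S. \<iota> y \<in> \<Omega> \<and> frechet_derivative f (at y) v = G (\<iota> y))"
          using U hol_directional_derivative[OF U(4,3), of "\<iota> v"] by blast
      qed
    qed
  qed
  then show ?thesis by (simp add: C_inf_on_def)
qed

section \<open>Powers of complex matrices\<close>

lemma cadjoint_nth [simp]: "cadjoint A $ i $ j = cnj (A $ j $ i)"
  by (simp add: cadjoint_def transpose_def)

lemma cadjoint_cadjoint [simp]: "cadjoint (cadjoint A) = A"
  by (simp add: vec_eq_iff)

lemma cadjoint_mult: "cadjoint (A ** B) = cadjoint B ** cadjoint A"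
  by (simp add: vec_eq_iff matrix_matrix_mult_def mult.commute)

lemma cadjoint_mat_1 [simp]: "cadjoint (mat 1) = mat 1"
  by (simp add: vec_eq_iff mat_def)

lemma cadjoint_csc: "cadjoint (c *\<^sub>C A) = cnj c *\<^sub>C cadjoint A"
  by (simp add: vec_eq_iff)

lemma cadjoint_diff: "cadjoint (A - B) = cadjoint A - cadjoint B"
  by (simp add: vec_eq_iff)

lemma cadjoint_scaleR: "cadjoint (c *\<^sub>R A) = c *\<^sub>R cadjoint A"
  by (simp add: vec_eq_iff)

lemma bounded_linear_cadjoint: "bounded_linear (cadjoint :: 'n::finite cmat \<Rightarrow> 'n cmat)"
  unfolding linear_conv_bounded_linear[symmetric]
  by (rule linearI) (simp_all add: vec_eq_iff)

lemma diag_matrix_nth [simp]: "diag_matrix d $ i $ j = (if i = j then d i else 0)"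
  by (simp add: diag_matrix_def)

lemma diag_matrix_mult_nth [simp]:
  "(diag_matrix d ** A) $ i $ j = d i * A $ i $ j"
  "(A ** diag_matrix d) $ i $ j = A $ i $ j * d j"
  by (simp_all add: matrix_matrix_mult_def if_distrib[of "\<lambda>x. x * _"] if_distrib[of "\<lambda>x. _ * x"] cong: if_cong)

lemma diag_matrix_mult: "diag_matrix d ** diag_matrix e = diag_matrix (\<lambda>i. d i * e i)"
  by (simp add: vec_eq_iff)

lemma diag_matrix_1 [simp]: "diag_matrix (\<lambda>_. 1) = mat 1"
  by (simp add: vec_eq_iff mat_def)

lemma cadjoint_diag_matrix: "cadjoint (diag_matrix d) = diag_matrix (\<lambda>i. cnj (d i))"
  by (simp add: vec_eq_iff)

lemma csc_diag_matrix: "c *\<^sub>C diag_matrix d = diag_matrix (\<lambda>i. c * d i)"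
  by (simp add: vec_eq_iff)

lemma csc_matrix_mult_left: "(c *\<^sub>C A) ** B = c *\<^sub>C (A ** B)" for A B :: "'n::finite cmat"
  by (simp add: vec_eq_iff matrix_matrix_mult_def sum_distrib_left mult.assoc)

lemma csc_matrix_mult_right: "A ** (c *\<^sub>C B) = c *\<^sub>C (A ** B)" for A B :: "'n::finite cmat"
  by (simp add: vec_eq_iff matrix_matrix_mult_def sum_distrib_left mult_ac)

text \<open>The norm of the matrix type is the Frobenius norm. In the operator norm a diagonal
  matrix is bounded by its largest entry and a unitary one by 1, so for positive definite matrices
  the convergence condition of the binomial series becomes a condition on the spectrum.\<close>

definition opn :: "'n::finite cmat \<Rightarrow> real" where
  "opn A = onorm ((*v) A)"

lemma opn_bound: "norm (A *v x) \<le> opn A * norm x"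
  unfolding opn_def by (rule onorm) simp

lemma opn_nonneg: "0 \<le> opn A"
  unfolding opn_def by (rule onorm_pos_le) simp

lemma opn_leI: "(\<And>x. norm (A *v x) \<le> b * norm x) \<Longrightarrow> opn A \<le> b"
  unfolding opn_def by (rule onorm_le) auto

lemma opn_mult: "opn (A ** B) \<le> opn A * opn B"
proof (rule opn_leI)
  fix x
  have "norm ((A ** B) *v x) \<le> opn A * norm (B *v x)"
    using opn_bound[of A "B *v x"] by (simp add: matrix_vector_mul_assoc)
  also have "\<dots> \<le> opn A * (opn B * norm x)"
    by (intro mult_left_mono opn_bound opn_nonneg)
  finally show "norm ((A ** B) *v x) \<le> opn A * opn B * norm x" by (simp add: mult.assoc)
qed

lemma opn_mat_1: "opn (mat 1) \<le> 1"
  by (rule opn_leI) simp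

lemma opn_triangle: "opn (A + B) \<le> opn A + opn B"
proof (rule opn_leI)
  fix x
  have "norm ((A + B) *v x) \<le> norm (A *v x) + norm (B *v x)"
    by (simp add: matrix_vector_mult_add_rdistrib norm_triangle_ineq)
  also have "\<dots> \<le> opn A * norm x + opn B * norm x" by (intro add_mono opn_bound)
  finally show "norm ((A + B) *v x) \<le> (opn A + opn B) * norm x" by (simp add: distrib_right)
qed

lemma norm_nth_le_opn: "norm (A $ i $ j) \<le> opn A"
proof -
  have "A $ i $ j = (A *v axis j 1) $ i"
    by (simp add: matrix_vector_mult_def axis_def if_distrib cong: if_cong)
  also have "norm \<dots> \<le> norm (A *v axis j 1)" by (rule Finite_Cartesian_Product.norm_nth_le)
  also have "\<dots> \<le> opn A" using opn_bound[of A "axis j 1"] by simp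
  finally show ?thesis .
qed

lemma norm_le_opn: "norm A \<le> (real CARD('n))\<^sup>2 * opn A" for A :: "'n::finite cmat"
proof -
  have l1: "norm v \<le> (\<Sum>i\<in>UNIV. norm (v $ i))" for v :: "'b::real_normed_vector ^ 'n"
    unfolding norm_vec_def by (rule L2_set_le_sum) simp
  have "norm A \<le> (\<Sum>i\<in>UNIV. norm (A $ i))" by (rule l1)
  also have "\<dots> \<le> (\<Sum>i\<in>(UNIV::'n set). \<Sum>j\<in>(UNIV::'n set). opn A)"
    by (intro sum_mono order_trans[OF l1] norm_nth_le_opn)
  finally show ?thesis by (simp add: power2_eq_square mult.assoc)
qed

lemma opn_le_norm: "opn A \<le> norm A"
proof (rule opn_leI)
  fix x
  have "norm ((A *v x) $ i) \<le> norm (A $ i) * norm x" for i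
  proof -
    have "norm ((A *v x) $ i) \<le> (\<Sum>j\<in>UNIV. norm (A $ i $ j) * norm (x $ j))"
      unfolding matrix_vector_mult_def by (auto intro!: sum_norm_le simp: norm_mult)
    also have "\<dots> \<le> L2_set (\<lambda>j. norm (A $ i $ j)) UNIV * L2_set (\<lambda>j. norm (x $ j)) UNIV"
      using L2_set_mult_ineq[of "\<lambda>j. norm (A $ i $ j)" "\<lambda>j. norm (x $ j)" UNIV] by simp
    finally show ?thesis by (simp add: norm_vec_def)
  qed
  then have "norm (A *v x) \<le> L2_set (\<lambda>i. norm (A $ i) * norm x) UNIV"
    unfolding norm_vec_def[of "A *v x"] by (intro L2_set_mono) auto
  also have "\<dots> = norm A * norm x"
    by (simp add: norm_vec_def[of A] L2_set_left_distrib)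
  finally show "norm (A *v x) \<le> norm A * norm x" .
qed

lemma bounded_bilinear_matrix_mult:
  "bounded_bilinear ((**) :: 'n::finite cmat \<Rightarrow> 'n cmat \<Rightarrow> 'n cmat)"
proof
  show "\<exists>K. \<forall>(A :: 'n cmat) (B :: 'n cmat). norm (A ** B) \<le> norm A * norm B * K"
  proof (intro exI allI)
    fix A B :: "'n cmat"
    have "norm (A ** B) \<le> (real CARD('n))\<^sup>2 * (opn A * opn B)"
      by (intro order_trans[OF norm_le_opn] mult_left_mono opn_mult) auto
    also have "\<dots> \<le> (real CARD('n))\<^sup>2 * (norm A * norm B)"
      by (intro mult_left_mono mult_mono opn_le_norm opn_nonneg) auto
    finally show "norm (A ** B) \<le> norm A * norm B * (real CARD('n))\<^sup>2" by (simp add: mult_ac)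
  qed
qed (simp_all add: matrix_add_ldistrib vec_eq_iff matrix_matrix_mult_def
      scaleR_sum_right distrib_right distrib_left sum.distrib)

interpretation mmult: bounded_bilinear "(**) :: 'n::finite cmat \<Rightarrow> 'n cmat \<Rightarrow> 'n cmat"
  by (rule bounded_bilinear_matrix_mult)

lemma hol_matrix_mult:
  fixes f g :: "'a::cvec \<Rightarrow> 'n::finite cmat"
  shows "hol_on S f \<Longrightarrow> hol_on S g \<Longrightarrow> hol_on S (\<lambda>x. f x ** g x)"
  by (rule hol_bilinear[OF bounded_bilinear_matrix_mult])
     (simp_all add: csc_matrix_mult_left csc_matrix_mult_right)

lemma continuous_on_opn: "continuous_on UNIV (opn :: 'n::finite cmat \<Rightarrow> real)"
proof -
  have *: "opn A - opn B \<le> norm (A - B)" for A B :: "'n cmat"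
    using opn_triangle[of "A - B" B] opn_le_norm[of "A - B"] by simp
  have "\<bar>opn A - opn B\<bar> \<le> norm (A - B)" for A B :: "'n cmat"
    using *[of A B] *[of B A] by (simp add: norm_minus_commute abs_le_iff)
  then have "1-lipschitz_on UNIV (opn :: 'n cmat \<Rightarrow> real)"
    by (intro lipschitz_onI) (auto simp: dist_norm)
  then show ?thesis by (rule lipschitz_on_continuous_on)
qed

lemma open_opn_less: 
  assumes "continuous_on UNIV f" shows "open {x. opn (f x :: 'n::finite cmat) < q}"
  by (intro open_Collect_less continuous_on_compose2[OF continuous_on_opn assms] continuous_intros) auto

section \<open>Matrix powers by the binomial series\<close>

primrec mpow :: "'n::finite cmat \<Rightarrow> nat \<Rightarrow> 'n cmat" where
  "mpow X 0 = mat 1"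
| "mpow X (Suc k) = X ** mpow X k"

lemma opn_mpow: "opn (mpow X k) \<le> opn X ^ k"
proof (induction k)
  case (Suc k)
  have "opn (X ** mpow X k) \<le> opn X * opn (mpow X k)" by (rule opn_mult)
  also have "\<dots> \<le> opn X * opn X ^ k" by (intro mult_left_mono Suc opn_nonneg)
  finally show ?case by simp
qed (use opn_mat_1 in auto)

lemma mpow_commute: "X ** mpow X k = mpow X k ** X"
  by (induction k) (simp_all add: matrix_mul_assoc)

lemma mpow_conj:
  fixes P Q X :: "'n::finite cmat"
  assumes "Q ** P = mat 1" "P ** Q = mat 1"
  shows "mpow (P ** X ** Q) k = P ** mpow X k ** Q"
proof (induction k)
  case (Suc k)
  have "P ** X ** Q ** (P ** mpow X k ** Q) = P ** X ** (Q ** P) ** mpow X k ** Q"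
    by (simp only: matrix_mul_assoc)
  then show ?case using Suc assms by (simp add: matrix_mul_assoc)
qed (use assms in simp)

lemma mpow_cadjoint: "mpow (cadjoint X) k = cadjoint (mpow X k)"
  by (induction k) (simp_all add: cadjoint_mult mpow_commute)

lemma mpow_diag: "mpow (diag_matrix x) k = diag_matrix (\<lambda>i. x i ^ k)"
  by (induction k) (simp_all add: diag_matrix_mult)

lemma hol_mpow: "hol_on S f \<Longrightarrow> hol_on S (\<lambda>x. mpow (f x) k)"
  by (induction k) (auto intro: hol_matrix_mult)

text \<open>Pochhammer symbols are compared factor by factor,
  \<open>norm (i - s) \<le> R + i\<close>. The bound is the same for all \<open>s\<close> in the
  disc of radius \<open>R\<close>, which later gives one summable majorant for all these
  exponents.\<close>

lemma norm_gbinomial_le: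
  fixes s :: complex
  assumes "norm s \<le> R"
  shows "norm (s gchoose k) \<le> norm ((- R) gchoose k)"
proof -
  have R: "R \<ge> 0" using assms norm_ge_zero order_trans by blast
  have "norm (pochhammer (- s) k) \<le> pochhammer R k"
    unfolding pochhammer_prod prod_norm[symmetric]
  proof (intro prod_mono conjI)
    fix i
    have "norm (- s + of_nat i) \<le> norm (- s) + norm (of_nat i :: complex)" by (rule norm_triangle_ineq)
    then show "norm (- s + of_nat i) \<le> R + of_nat i" using assms by simp
  qed auto
  moreover have "pochhammer R k \<ge> 0" using R by (auto simp: pochhammer_prod intro!: prod_nonneg)
  ultimately show ?thesis
    by (simp add: gbinomial_pochhammer norm_mult norm_divide norm_power divide_right_mono abs_mult power_abs)
qed

lemma summable_gbinomial_norm: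
  fixes R q :: real
  assumes "0 \<le> q" "q < 1"
  shows "summable (\<lambda>k. norm (R gchoose k) * q ^ k)"
proof -
  have "ereal (norm q) < conv_radius (\<lambda>k. R gchoose k)"
    using assms by (simp add: conv_radius_gchoose)
  from abs_summable_in_conv_radius[OF this] show ?thesis
    using assms by (simp add: abs_mult power_abs)
qed

text \<open>The binomial series for the power of \<open>mat 1 + X\<close> with exponent
  \<open>s\<close>, which makes sense for complex \<open>s\<close> and non-Hermitian
  \<open>X\<close>.\<close>

definition binmat :: "complex \<Rightarrow> 'n::finite cmat \<Rightarrow> 'n cmat" where
  "binmat s X = (\<Sum>k. (s gchoose k) *\<^sub>C mpow X k)"

lemma norm_binmat_term:
  assumes "norm s \<le> R" "opn (X :: 'n::finite cmat) \<le> q"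
  shows "norm ((s gchoose k) *\<^sub>C mpow X k) \<le> (real CARD('n))\<^sup>2 * (norm ((- R) gchoose k) * q ^ k)"
proof -
  have "norm (mpow X k) \<le> (real CARD('n))\<^sup>2 * opn (mpow X k)" by (rule norm_le_opn)
  also have "opn (mpow X k) \<le> q ^ k"
    using opn_mpow[of X k] power_mono[OF assms(2) opn_nonneg] by (rule order_trans)
  finally have "norm (mpow X k) \<le> (real CARD('n))\<^sup>2 * q ^ k" by (simp add: mult_left_mono)
  then have "norm (s gchoose k) * norm (mpow X k) \<le> norm ((- R) gchoose k) * ((real CARD('n))\<^sup>2 * q ^ k)"
    by (intro mult_mono norm_gbinomial_le assms) auto
  then show ?thesis by (simp add: norm_csc mult_ac)
qed

lemma binmat_sums:
  assumes "opn X < 1"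
  shows "(\<lambda>k. (s gchoose k) *\<^sub>C mpow X k) sums binmat s X"
proof -
  have "summable (\<lambda>k. (s gchoose k) *\<^sub>C mpow X k)"
    by (rule summable_comparison_test'[OF summable_mult[OF summable_gbinomial_norm[OF opn_nonneg assms]]])
       (rule norm_binmat_term[OF order_refl order_refl])
  then show ?thesis unfolding binmat_def by (rule summable_sums)
qed

lemma hol_gbinomial: "hol_on S (\<lambda>s :: complex. s gchoose k)"
proof (induction k)
  case (Suc k)
  have "(\<lambda>s::complex. s gchoose Suc k) = (\<lambda>s. (s gchoose k) * ((s - of_nat k) * (1 / of_nat (Suc k))))"
    by (auto simp: fun_eq_iff field_simps gbinomial_pochhammer pochhammer_Suc)
  moreover have "hol_on S (\<lambda>s::complex. (s gchoose k) * ((s - of_nat k) * (1 / of_nat (Suc k))))"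
    by (intro hol_mult Suc hol_diff hol_const hol_ident)
  ultimately show ?case by metis
qed simp

text \<open>Where \<open>norm s < R\<close> and \<open>opn X < q < 1\<close>, the terms have a
  common summable majorant; the partial sums are polynomials in \<open>s\<close> and
  \<open>X\<close>, so Weierstrass' theorem applies.\<close>

lemma hol_binmat: "hol_on {p. opn (snd p :: 'n::finite cmat) < 1} (\<lambda>p. binmat (fst p) (snd p))"
proof (rule hol_UnionI)
  fix p :: "complex \<times> 'n cmat" assume "p \<in> {p. opn (snd p) < 1}"
  then obtain q where q: "opn (snd p) < q" "q < 1" using dense by blast
  have q0: "q \<ge> 0" using q(1) opn_nonneg[of "snd p"] by simp
  define R where "R = norm (fst p) + 1"
  define T where "T = {p' :: complex \<times> 'n cmat. norm (fst p') < R} \<inter> {p'. opn (snd p') < q}"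
  have T: "open T" "p \<in> T"
    unfolding T_def using q
    by (auto simp: R_def intro!: open_Int open_Collect_less open_opn_less continuous_intros)
  have "uniform_limit T (\<lambda>n p. \<Sum>k<n. (fst p gchoose k) *\<^sub>C mpow (snd p) k)
    (\<lambda>p. \<Sum>k. (fst p gchoose k) *\<^sub>C mpow (snd p) k) sequentially"
  proof (rule Weierstrass_m_test)
    show "summable (\<lambda>k. (real CARD('n))\<^sup>2 * (norm ((- R) gchoose k) * q ^ k))"
      by (intro summable_mult summable_gbinomial_norm q q0)
    show "norm ((fst p gchoose k) *\<^sub>C mpow (snd p) k) \<le> (real CARD('n))\<^sup>2 * (norm ((- R) gchoose k) * q ^ k)"
      if "p \<in> T" for k p
      using that by (intro norm_binmat_term) (auto simp: T_def)
  qed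
  then have lim: "uniform_limit T (\<lambda>n p. \<Sum>k<n. (fst p gchoose k) *\<^sub>C mpow (snd p) k)
    (\<lambda>p. binmat (fst p) (snd p)) sequentially"
    unfolding binmat_def .
  have fst: "hol_on T fst" and snd: "hol_on T snd"
    by (auto intro!: hol_linear bounded_linear_fst bounded_linear_snd)
  have "hol_on T (\<lambda>p. fst p gchoose k)" for k
    by (rule hol_compose[OF fst hol_gbinomial[of UNIV k]]) simp
  moreover have "hol_on T (\<lambda>p. mpow (snd p) k)" for k
    by (rule hol_mpow[OF snd])
  ultimately have "hol_on T (\<lambda>p. \<Sum>k<n. (fst p gchoose k) *\<^sub>C mpow (snd p) k)" for n
    by (intro hol_sum hol_csc)
  then have "hol_on T (\<lambda>p. binmat (fst p) (snd p))"
    by (rule hol_uniform_limit[OF _ T(1) lim])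
  then show "\<exists>T. p \<in> T \<and> hol_on T (\<lambda>p. binmat (fst p) (snd p))" using T by blast
qed

text \<open>Conjugation passes through the series termwise. The conjugate may have operator norm
  above 1; its series converges because that of \<open>X\<close> does.\<close>

lemma binmat_conj:
  fixes P Q X :: "'n::finite cmat"
  assumes "opn X < 1" "Q ** P = mat 1" "P ** Q = mat 1"
  shows "binmat s (P ** X ** Q) = P ** binmat s X ** Q"
proof -
  have "bounded_linear (\<lambda>Y. P ** Y ** Q)"
    using bounded_linear_compose[OF mmult.bounded_linear_left[of Q] mmult.bounded_linear_right[of P]]
    by simp
  from bounded_linear.sums[OF this binmat_sums[OF assms(1), of s]]
  have "(\<lambda>k. (s gchoose k) *\<^sub>C mpow (P ** X ** Q) k) sums (P ** binmat s X ** Q)"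
    by (simp add: mpow_conj[OF assms(2,3)] csc_matrix_mult_left csc_matrix_mult_right)
  then show ?thesis unfolding binmat_def by (rule sums_unique[symmetric])
qed

text \<open>Taking adjoints passes through the series because the binomial coefficients of a real
  exponent are real.\<close>

lemma binmat_cadjoint:
  assumes "opn X < 1"
  shows "binmat (of_real s) (cadjoint X) = cadjoint (binmat (of_real s) X)"
proof -
  have "cnj (of_real s gchoose k) = of_real s gchoose k" for k
    by (simp add: gbinomial_pochhammer pochhammer_prod)
  with bounded_linear.sums[OF bounded_linear_cadjoint binmat_sums[OF assms, of "of_real s"]]
  have "(\<lambda>k. (of_real s gchoose k) *\<^sub>C mpow (cadjoint X) k) sums (cadjoint (binmat (of_real s) X))"
    by (simp add: mpow_cadjoint cadjoint_csc)
  then show ?thesis unfolding binmat_def by (rule sums_unique[symmetric])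
qed

lemma sums_vecI:
  fixes l :: "'b::real_normed_vector ^ 'n::finite"
  assumes "\<And>i. (\<lambda>k. f k $ i) sums (l $ i)"
  shows "f sums l"
  using assms unfolding sums_def by (intro vec_tendstoI) simp

lemma binmat_diag:
  assumes "\<And>i. norm (x i) < 1"
  shows "binmat s (diag_matrix x) = diag_matrix (\<lambda>i. (1 + x i) powr s)"
proof -
  have "(\<lambda>k. (s gchoose k) *\<^sub>C mpow (diag_matrix x) k) sums diag_matrix (\<lambda>i. (1 + x i) powr s)"
    by (intro sums_vecI) (auto simp: mpow_diag intro!: gen_binomial_complex assms)
  then show ?thesis unfolding binmat_def by (rule sums_unique[symmetric])
qed

lemma opn_diag:
  fixes x :: "'n::finite \<Rightarrow> complex"
  assumes "\<And>i. norm (x i) \<le> b" "0 \<le> b"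
  shows "opn (diag_matrix x) \<le> b"
proof (rule opn_leI)
  fix v :: "complex ^ 'n"
  have "(diag_matrix x *v v) $ i = x i * v $ i" for i
    by (simp add: matrix_vector_mult_def if_distrib[of "\<lambda>x. x * _"] cong: if_cong)
  then have "norm (diag_matrix x *v v) = L2_set (\<lambda>i. norm (x i) * norm (v $ i)) UNIV"
    by (simp add: norm_vec_def norm_mult)
  also have "\<dots> \<le> L2_set (\<lambda>i. b * norm (v $ i)) UNIV"
    by (intro L2_set_mono mult_right_mono assms) auto
  also have "\<dots> = b * norm v" using assms by (simp add: norm_vec_def L2_set_right_distrib)
  finally show "norm (diag_matrix x *v v) \<le> b * norm v" .
qed

lemma opn_diag_less:
  assumes "\<And>i. norm (x i) < b"
  shows "opn (diag_matrix (x :: 'n::finite \<Rightarrow> complex)) < b"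
proof -
  define m where "m = Max (range (\<lambda>i. norm (x i)))"
  have m: "norm (x i) \<le> m" for i unfolding m_def by (intro Max_ge) auto
  have "m \<in> range (\<lambda>i. norm (x i))" unfolding m_def by (intro Max_in) auto
  then have "m < b" "0 \<le> m" using assms by auto
  then show ?thesis using opn_diag[of x m, OF m] by simp
qed

section \<open>Diagonal matrices with one additional entry\<close>

definition unit_entry :: "'n \<Rightarrow> 'n \<Rightarrow> complex \<Rightarrow> 'n::finite cmat" where
  "unit_entry i j u = (\<chi> k l. if k = i \<and> l = j then u else 0)"

lemma unit_entry_nth [simp]: "unit_entry i j u $ k $ l = (if k = i \<and> l = j then u else 0)"
  by (simp add: unit_entry_def)

lemma unit_entry_mult_unit_entry: "i \<noteq> j \<Longrightarrow> unit_entry i j u ** unit_entry i j v = 0"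
  by (auto simp: vec_eq_iff matrix_matrix_mult_def intro!: sum.neutral)

lemma unit_entry_diag:
  "unit_entry i j u ** diag_matrix d = unit_entry i j (u * d j)"
  "diag_matrix d ** unit_entry i j u = unit_entry i j (d i * u)"
  by (auto simp: vec_eq_iff)

lemma unit_entry_add: "unit_entry i j u + unit_entry i j v = unit_entry i j (u + v)"
  by (auto simp: vec_eq_iff)

text \<open>Powers of a diagonal matrix plus one off-diagonal entry stay of this form, the entry being a
  divided difference; this computes the derivative of the matrix power at a diagonal matrix.\<close>

lemma diag_plus_entry_mult:
  assumes "i \<noteq> j"
  shows "(diag_matrix x + unit_entry i j u) ** (diag_matrix y + unit_entry i j v)
    = diag_matrix (\<lambda>k. x k * y k) + unit_entry i j (x i * v + u * y j)"
  using assms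
  by (simp add: mmult.add_left mmult.add_right unit_entry_mult_unit_entry unit_entry_diag
      diag_matrix_mult unit_entry_add[symmetric] add_ac)

text \<open>The divided difference of the \<open>k\<close>-th power at \<open>a\<close> and
  \<open>b\<close>, written without division so that \<open>a = b\<close> is included.\<close>

primrec divdiff_pow :: "complex \<Rightarrow> complex \<Rightarrow> nat \<Rightarrow> complex" where
  "divdiff_pow a b 0 = 0"
| "divdiff_pow a b (Suc k) = a * divdiff_pow a b k + b ^ k"

lemma mpow_diag_plus_entry:
  assumes "i \<noteq> j"
  shows "mpow (diag_matrix x + unit_entry i j u) k
    = diag_matrix (\<lambda>l. x l ^ k) + unit_entry i j (u * divdiff_pow (x i) (x j) k)"
proof (induction k)
  case 0
  then show ?case by (simp add: vec_eq_iff mat_def)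
next
  case (Suc k)
  then show ?case by (simp add: diag_plus_entry_mult[OF assms] algebra_simps)
qed

lemma divdiff_pow_mult: "(a - b) * divdiff_pow a b k = a ^ k - b ^ k"
  by (induction k) (auto simp: algebra_simps, metis (no_types,
      lifting) add_diff_cancel distrib_left mult.left_commute right_diff_distrib)

lemma divdiff_pow_same: "divdiff_pow a a (Suc k) = of_nat (Suc k) * a ^ k"
  by (induction k) (auto simp: algebra_simps)

definition divdiff_powr :: "complex \<Rightarrow> complex \<Rightarrow> complex \<Rightarrow> complex" where
  "divdiff_powr s a b = (if a = b then s * (1 + a) powr (s - 1) else ((1 + a) powr s - (1 + b) powr s) / (a - b))"

lemma divdiff_powr_sums:
  assumes "norm a < 1" "norm b < 1"
  shows "(\<lambda>k. (s gchoose k) * divdiff_pow a b k) sums divdiff_powr s a b"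
proof (cases "a = b")
  case True
  have "(\<lambda>k. s * (((s - 1) gchoose k) * a ^ k)) sums (s * (1 + a) powr (s - 1))"
    by (intro sums_mult gen_binomial_complex assms)
  \<comment> \<open>For \<open>a = b\<close> this is the differentiated binomial series; the
    absorption identity \<open>(k + 1) (s gchoose (k + 1)) = s ((s - 1) gchoose k)\<close> matches
    the coefficients.\<close>
  also have "(\<lambda>k. s * (((s - 1) gchoose k) * a ^ k)) = (\<lambda>k. (s gchoose Suc k) * divdiff_pow a a (Suc k))"
    unfolding divdiff_pow_same using gbinomial_absorption[of _ s]
    by (metis (no_types, lifting) mult.assoc mult.left_commute)
  finally have "(\<lambda>k. (s gchoose Suc k) * divdiff_pow a a (Suc k)) sums (s * (1 + a) powr (s - 1))" .
  from sums_Suc[OF this] show ?thesis using True by (simp add: divdiff_powr_def)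
next
  case False
  have "(\<lambda>k. ((s gchoose k) * a ^ k - (s gchoose k) * b ^ k) / (a - b)) sums (((1 + a) powr s - (1
      + b) powr s) / (a - b))"
    by (intro sums_divide sums_diff gen_binomial_complex assms)
  moreover have "((s gchoose k) * a ^ k - (s gchoose k) * b ^ k) / (a - b)
      = (s gchoose k) * divdiff_pow a b k" for k
  proof -
    have "(s gchoose k) * a ^ k - (s gchoose k) * b ^ k = (s gchoose k) * (a ^ k - b ^ k)"
      by (simp add: right_diff_distrib)
    also have "\<dots> = (a - b) * ((s gchoose k) * divdiff_pow a b k)"
      by (simp only: divdiff_pow_mult[symmetric] mult_ac)
    finally have "(s gchoose k) * a ^ k - (s gchoose k) * b ^ k = (a - b) * ((s gchoose k) * divdiff_pow a b k)" .
    then show ?thesis using False by simp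
  qed
  ultimately show ?thesis using False by (simp add: divdiff_powr_def)
qed

text \<open>The series converges entry by entry, for \<open>u\<close> of any size. The result is
  affine in \<open>u\<close>, so the derivative in this direction can be read off from the
  formula.\<close>

lemma binmat_diag_plus_entry:
  assumes "i \<noteq> j" "\<And>k. norm (x k) < 1"
  shows "binmat s (diag_matrix x + unit_entry i j u)
    = diag_matrix (\<lambda>k. (1 + x k) powr s) + unit_entry i j (u * divdiff_powr s (x i) (x j))"
proof -
  have "(\<lambda>k. ((s gchoose k) *\<^sub>C mpow (diag_matrix x + unit_entry i j u) k) $ p $ q)
     sums ((diag_matrix (\<lambda>k. (1 + x k) powr s) + unit_entry i j (u * divdiff_powr s (x i) (x j))) $ p $ q)" for p q
  proof (cases "p = q")
    case True
    have "unit_entry i j v $ q $ q = 0" for v using assms(1) by auto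
    then show ?thesis
      using True gen_binomial_complex[OF assms(2), of s p]
      by (simp add: mpow_diag_plus_entry[OF assms(1)] del: unit_entry_nth)
  next
    case False
    then show ?thesis
      using sums_mult[OF divdiff_powr_sums[OF assms(2) assms(2), of s i j], of u]
      by (auto simp: mpow_diag_plus_entry[OF assms(1)] mult_ac)
  qed
  then have "(\<lambda>k. (s gchoose k) *\<^sub>C mpow (diag_matrix x + unit_entry i j u) k)
     sums (diag_matrix (\<lambda>k. (1 + x k) powr s) + unit_entry i j (u * divdiff_powr s (x i) (x j)))"
    by (intro sums_vecI)
  then show ?thesis unfolding binmat_def by (rule sums_unique[symmetric])
qed

text \<open>The coefficients are alternating signs, so this is a geometric series;
  \<open>t (Suc k) = - (X ** t k)\<close> yields the identity by comparing the series with its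
  shift.\<close>

lemma binmat_minus_one:
  assumes "opn X < 1"
  shows "(mat 1 + X) ** binmat (- 1) X = mat 1"
proof -
  define t where "t k = ((- 1) gchoose k :: complex) *\<^sub>C mpow X k" for k
  have coef: "((- 1) gchoose k :: complex) = (- 1) ^ k" for k
    using gbinomial_minus[of "1::complex" k] by (simp add: binomial_gbinomial[symmetric])
  have t: "t sums binmat (- 1) X" unfolding t_def by (rule binmat_sums[OF assms])
  have "t (Suc k) = - (X ** t k)" for k
    by (simp add: t_def coef csc_matrix_mult_right csc.minus_left)
  moreover have "(\<lambda>k. - (X ** t k)) sums (- (X ** binmat (- 1) X))"
    by (intro sums_minus bounded_linear.sums[OF mmult.bounded_linear_right t])
  ultimately have "(\<lambda>k. t (Suc k)) sums (- (X ** binmat (- 1) X))" by simp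
  from sums_Suc[OF this] have "t sums (- (X ** binmat (- 1) X) + mat 1)"
    using t_def[of 0] by simp
  then have "binmat (- 1) X = - (X ** binmat (- 1) X) + mat 1"
    using t sums_unique2 by blast
  then show ?thesis by (simp add: mmult.add_left algebra_simps)
qed

text \<open>On \<open>cpw_dom c\<close>, the matrix \<open>cpw c s A\<close> is the power \<open>A\<^sup>s\<close>, computed as \<open>c\<^sup>s (1 + X)\<^sup>s\<close> by the binomial
  series in \<open>X = A/c - 1\<close>. A positive definite \<open>A\<close> lies in the domain as soon as \<open>2 c\<close> exceeds its spectrum.\<close>

definition cpw :: "real \<Rightarrow> complex \<Rightarrow> 'n::finite cmat \<Rightarrow> 'n cmat" where
  "cpw c s A = exp (s * of_real (ln c)) *\<^sub>C binmat s ((1 / c) *\<^sub>R A - mat 1)"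

definition cpw_dom :: "real \<Rightarrow> 'n::finite cmat set" where
  "cpw_dom c = {A. opn ((1 / c) *\<^sub>R A - mat 1) < 1}"

lemma open_cpw_dom: "open (cpw_dom c)"
  unfolding cpw_dom_def by (intro open_opn_less continuous_intros)

lemma hol_cpw:
  assumes "hol_on S f" "hol_on S g" "\<And>x. x \<in> S \<Longrightarrow> g x \<in> cpw_dom c"
  shows "hol_on S (\<lambda>x. cpw c (f x) (g x))"
proof -
  have "hol_on UNIV (\<lambda>s :: complex. exp (s * of_real (ln c)))"
    by (rule hol_field) (auto intro!: derivative_eq_intros)
  then have 1: "hol_on S (\<lambda>x. exp (f x * of_real (ln c)))"
    using hol_compose[OF assms(1)] by blast
  have "hol_on S (\<lambda>x. (f x, (1 / c) *\<^sub>R g x - mat 1))"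
    by (intro hol_Pair assms hol_diff hol_scaleR hol_const)
  from hol_compose[OF this hol_binmat] assms(3)
  have "hol_on S (\<lambda>x. binmat (f x) ((1 / c) *\<^sub>R g x - mat 1))" by (simp add: cpw_dom_def)
  with 1 show ?thesis unfolding cpw_def by (rule hol_csc)
qed

lemma conj_shift:
  fixes P Q A :: "'n::finite cmat"
  assumes "P ** Q = mat 1"
  shows "(1 / c) *\<^sub>R (P ** A ** Q) - mat 1 = P ** ((1 / c) *\<^sub>R A - mat 1) ** Q"
  using assms by (simp add: mmult.diff_left mmult.diff_right mmult.scaleR_left mmult.scaleR_right)

lemma cpw_conj:
  fixes P Q A :: "'n::finite cmat"
  assumes "A \<in> cpw_dom c" "Q ** P = mat 1" "P ** Q = mat 1"
  shows "cpw c s (P ** A ** Q) = P ** cpw c s A ** Q"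
  using assms binmat_conj[of "(1 / c) *\<^sub>R A - mat 1" Q P s]
  by (simp add: cpw_def cpw_dom_def conj_shift csc_matrix_mult_left csc_matrix_mult_right)

lemma cpw_cadjoint:
  assumes "A \<in> cpw_dom c"
  shows "cpw c (of_real s) (cadjoint A) = cadjoint (cpw c (of_real s) A)"
proof -
  have "cnj (exp (of_real s * of_real (ln c))) = exp (of_real s * of_real (ln c))"
    by (metis complex_cnj_complex_of_real exp_of_real of_real_mult)
  then show ?thesis
    using assms binmat_cadjoint[of "(1 / c) *\<^sub>R A - mat 1" s]
    by (simp add: cpw_def cpw_dom_def cadjoint_csc cadjoint_diff cadjoint_scaleR)
qed

lemma scaleR_cmat_nth: "(r *\<^sub>R A) $ i $ j = of_real r * A $ i $ j" for A :: "'n::finite cmat"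
  by (simp add: scaleR_conv_of_real[where 'a = complex])

lemma diag_matrix_shift:
  "(1 / c) *\<^sub>R diag_matrix x - mat 1 = diag_matrix (\<lambda>i. x i / of_real c - 1)"
  by (simp add: vec_eq_iff mat_def scaleR_cmat_nth del: vector_scaleR_component)

lemma cpw_diag:
  assumes "\<And>i. norm (x i / of_real c - 1) < 1"
  shows "cpw c s (diag_matrix x) = diag_matrix (\<lambda>i. exp (s * of_real (ln c)) * (x i / of_real c) powr s)"
  by (simp add: cpw_def diag_matrix_shift binmat_diag[OF assms] csc_diag_matrix)

lemma cpw_diag_inverse:
  assumes "\<And>i. norm (x i / of_real c - 1) < 1"
  shows "cpw c s (diag_matrix x) ** cpw c (- s) (diag_matrix x) = mat 1"
proof -
  \<comment> \<open>A zero \<open>x i\<close> would put the quotient at distance exactly 1 from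
    1.\<close>
  have "(x i / of_real c) powr s \<noteq> 0" for i using assms[of i] by auto
  then have "exp (s * of_real (ln c)) * (x i / of_real c) powr s *
      (exp (- s * of_real (ln c)) * (x i / of_real c) powr (- s)) = 1" for i
    by (simp add: powr_minus exp_minus field_simps)
  then show ?thesis
    by (simp only: cpw_diag[OF assms] diag_matrix_mult diag_matrix_1)
qed

text \<open>For positive quotients the principal branch is the real power, and the exponential
  factor undoes the rescaling by \<open>c\<close>. Hence \<open>cpw c\<close> does not depend on
  \<open>c\<close> on the positive matrices in its domain.\<close>

lemma powr_of_real_scale:
  assumes "c > 0" "x > 0"
  shows "exp (of_real s * of_real (ln c)) * (of_real x / of_real c :: complex) powr (of_real s)
      = of_real (x powr s)"
proof -
  have "exp (of_real s * of_real (ln c)) = (of_real (c powr s) :: complex)"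
    using assms by (simp add: powr_def exp_of_real[symmetric])
  moreover have "(of_real x / of_real c :: complex) powr (of_real s) = of_real ((x / c) powr s)"
    using assms by (simp add: powr_of_real[symmetric])
  ultimately show ?thesis using assms by (simp add: powr_divide)
qed

lemma norm_shift_real:
  assumes "0 < x" "x < 2 * c" shows "norm (of_real x / of_real c - 1 :: complex) < 1"
proof -
  have 1: "norm (of_real x / of_real c - 1 :: complex) = \<bar>x / c - 1\<bar>"
    by (metis norm_of_real of_real_1 of_real_diff of_real_divide)
  have "\<bar>x / c - 1\<bar> < 1" using assms by (auto simp: abs_less_iff field_simps)
  then show ?thesis by (simp only: 1)
qed

lemma cpw_diag_real:
  assumes "\<And>i. 0 < x i" "\<And>i. x i < 2 * c" "c > 0"
  shows "cpw c (of_real s) (diag_matrix (\<lambda>i. of_real (x i))) = diag_matrix (\<lambda>i. of_real (x i powr s))"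
  using cpw_diag[of "\<lambda>i. of_real (x i)" c "of_real s"] norm_shift_real[OF assms(1,2)]
    powr_of_real_scale[OF assms(3,1)] by simp

definition rdivdiff_powr :: "real \<Rightarrow> real \<Rightarrow> real \<Rightarrow> real" where
  "rdivdiff_powr s a b = (if a = b then s * a powr (s - 1) else (a powr s - b powr s) / (a - b))"

lemma cpw_diag_plus_entry:
  assumes "i \<noteq> j" "\<And>i. 0 < x i" "\<And>i. x i < 2 * c" "c > 0"
  shows "cpw c (of_real s) (diag_matrix (\<lambda>i. of_real (x i)) + unit_entry i j u)
    = diag_matrix (\<lambda>i. of_real (x i powr s)) + unit_entry i j (u * of_real (rdivdiff_powr s (x i) (x j)))"
proof -
  define y where "y i = of_real (x i) / of_real c - (1 :: complex)" for i
  have y: "norm (y i) < 1" for i unfolding y_def by (rule norm_shift_real[OF assms(2,3)])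
  have 1: "(1 / c) *\<^sub>R (diag_matrix (\<lambda>i. of_real (x i)) + unit_entry i j u) - mat 1
    = diag_matrix y + unit_entry i j (u / of_real c)"
    using assms(1) by (auto simp: vec_eq_iff mat_def scaleR_cmat_nth y_def simp del: vector_scaleR_component)
  \<comment> \<open>In the variable \<open>y = x / c - 1\<close> the divided difference has
    denominator \<open>(x i - x j) / c\<close>; its factor \<open>1 / c\<close> cancels against the
    one in \<open>u / c\<close>. For \<open>x i = x j\<close> the same scaling appears in the
    derivative.\<close>
  have 2: "exp (of_real s * of_real (ln c)) * (u / of_real c * divdiff_powr (of_real s) (y i) (y j))
    = u * of_real (rdivdiff_powr s (x i) (x j))"
  proof (cases "x i = x j")
    case True
    have "(of_real (x i / c) :: complex) powr (of_real (s - 1)) = of_real ((x i / c) powr (s - 1))"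
      using assms(2)[of i] assms(4) by (intro powr_of_real) simp
    then have "(of_real (x i) / of_real c :: complex) powr (of_real s - 1) = of_real ((x i / c) powr (s - 1))"
      by simp
    moreover have "exp (of_real s * of_real (ln c)) = (of_real (c powr s) :: complex)"
      using assms by (simp add: powr_def exp_of_real[symmetric])
    moreover have "x i powr (s - 1) = c powr s / c * (x i / c) powr (s - 1)"
      using assms(2)[of i] assms(4) by (simp add: powr_divide powr_diff)
    then have "of_real (x i powr (s - 1)) = complex_of_real (c powr s) / of_real c * of_real ((x i / c) powr (s
        - 1))"
      by (metis of_real_divide of_real_mult)
    ultimately show ?thesis
      using True by (simp add: divdiff_powr_def rdivdiff_powr_def y_def mult_ac)
  next
    case False
    have y1: "1 + y k = of_real (x k) / of_real c" for k by (simp add: y_def)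
    have "y i \<noteq> y j" using False assms(4) by (simp add: y_def)
    then have "divdiff_powr (of_real s) (y i) (y j) =
      ((of_real (x i) / of_real c) powr of_real s - (of_real (x j) / of_real c) powr of_real s)
        / ((of_real (x i) - of_real (x j)) / of_real c)"
      unfolding divdiff_powr_def y1 by (simp only: if_False) (simp only: y_def diff_divide_distrib
          diff_diff_eq2 add_diff_cancel_right' diff_add_cancel)
    then have "exp (of_real s * of_real (ln c)) * (u / of_real c * divdiff_powr (of_real s) (y i) (y j))
      = u * (exp (of_real s * of_real (ln c)) * (of_real (x i) / of_real c) powr of_real s
        - exp (of_real s * of_real (ln c)) * (of_real (x j) / of_real c) powr of_real s) / (of_real (x i) -
            of_real (x j))"
      using False assms(4) by (simp add: right_diff_distrib)
    then show ?thesis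
      using False by (simp add: powr_of_real_scale[OF assms(4,2)] rdivdiff_powr_def)
  qed
  have 3: "exp (of_real s * of_real (ln c)) * (1 + y k) powr (of_real s) = of_real (x k powr s)" for k
    using powr_of_real_scale[OF assms(4,2), of s k] by (simp add: y_def)
  show ?thesis
    unfolding cpw_def 1 binmat_diag_plus_entry[OF assms(1) y]
    using 2 3 by (auto simp: vec_eq_iff distrib_left)
qed

text \<open>Centre 1 and exponent \<open>- 1\<close> give the geometric series of the inverse; in
  this way inversion near the identity becomes a holomorphic map.\<close>

lemma cpw_1_inverse:
  assumes "K \<in> cpw_dom 1"
  shows "K ** cpw 1 (- 1) K = mat 1" "cpw 1 (- 1) K ** K = mat 1"
proof -
  show "K ** cpw 1 (- 1) K = mat 1"
    using binmat_minus_one[of "K - mat 1"] assms by (simp add: cpw_def cpw_dom_def)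
  then show "cpw 1 (- 1) K ** K = mat 1"
    by (simp add: matrix_left_right_inverse)
qed

section \<open>Spectral calculus and the transform\<close>

definition hip :: "complex ^ 'n::finite \<Rightarrow> complex ^ 'n \<Rightarrow> complex" where
  "hip x y = (\<Sum>i\<in>UNIV. cnj (x $ i) * y $ i)"

lemma Re_hip: "Re (hip x y) = x \<bullet> y"
  by (simp add: hip_def inner_vec_def inner_complex_def)

lemma hip_add_right: "hip x (y + z) = hip x y + hip x z"
  by (simp add: hip_def distrib_left sum.distrib)

lemma hip_scale_right: "hip x (c *s y) = c * hip x y"
  by (simp add: hip_def sum_distrib_left mult_ac)

lemma hip_scale_left: "hip (c *s x) y = cnj c * hip x y"
  by (simp add: hip_def sum_distrib_left mult_ac)

lemma scaleR_eq_of_real_smult: "r *\<^sub>R x = of_real r *s x" for x :: "complex ^ 'n::finite"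
  by (simp add: vec_eq_iff scaleR_conv_of_real[where 'a = complex])

lemma hip_commute: "hip x y = cnj (hip y x)"
  by (simp add: hip_def mult.commute)

lemma hip_self: "hip x x = of_real ((norm x)\<^sup>2)"
proof -
  have "Re (hip x x) = (norm x)\<^sup>2" by (simp add: Re_hip power2_norm_eq_inner)
  moreover have "Im (hip x x) = 0" by (simp add: hip_def)
  ultimately show ?thesis by (simp add: complex_eq_iff)
qed

lemma hip_matrix: "hip x (A *v y) = hip (cadjoint A *v x) y"
proof -
  have "hip x (A *v y) = (\<Sum>i\<in>UNIV. \<Sum>j\<in>UNIV. cnj (x $ i) * (A $ i $ j * y $ j))"
    by (simp add: hip_def matrix_vector_mult_def sum_distrib_left)
  also have "\<dots> = (\<Sum>j\<in>UNIV. \<Sum>i\<in>UNIV. cnj (x $ i) * (A $ i $ j * y $ j))"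
    by (rule sum.swap)
  also have "\<dots> = hip (cadjoint A *v x) y"
    by (simp add: hip_def matrix_vector_mult_def sum_distrib_left sum_distrib_right mult_ac)
  finally show ?thesis .
qed

lemma inner_matrix: "x \<bullet> (A *v y) = (cadjoint A *v x) \<bullet> y" for x :: "complex ^ 'n::finite"
  by (metis Re_hip hip_matrix)

text \<open>First variation at a maximum: for small positive \<open>t\<close> the linear term
  dominates the quadratic one, so a positive \<open>a\<close> is impossible.\<close>

lemma quadratic_nonpos_imp_zero:
  fixes a C :: real
  assumes "\<And>t. 2 * t * a + t\<^sup>2 * C \<le> 0" "a \<ge> 0"
  shows "a = 0"
proof (rule ccontr)
  assume "a \<noteq> 0"
  then have a: "a > 0" using assms(2) by simp
  define t where "t = a / (\<bar>C\<bar> + 1)"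
  have t: "t > 0" "t * \<bar>C\<bar> < a"
    using a by (auto simp: t_def field_simps add_nonneg_pos)
  have "t * (2 * a + t * C) \<le> 0" using assms(1)[of t] by (simp add: power2_eq_square algebra_simps)
  moreover have "- (t * \<bar>C\<bar>) \<le> t * C" using t(1) by (simp add: abs_if)
  then have "2 * a + t * C > 0" using t a by linarith
  ultimately show False using t(1) mult_pos_pos by fastforce
qed

text \<open>The quadratic form \<open>q\<close> attains its maximum over the unit vectors in the
  orthogonal complement \<open>W\<close> of the given eigenvectors. As \<open>W\<close> is invariant
  under \<open>A\<close>, the residual \<open>A *v x - q x *\<^sub>R x\<close> is an admissible
  direction of variation, and the maximum property forces it to vanish.\<close>

lemma hermitian_eigenvector_orthogonal:
  fixes A :: "'n::finite cmat" and f :: "'n \<Rightarrow> complex ^ 'n"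
  assumes A: "cadjoint A = A" and I: "I \<noteq> UNIV"
    and f: "\<And>i. i \<in> I \<Longrightarrow> A *v f i = of_real (d i) *s f i"
  obtains x \<mu> where "norm x = 1" "\<And>i. i \<in> I \<Longrightarrow> hip (f i) x = 0" "A *v x = of_real \<mu> *s x"
proof -
  define W where "W = {x. \<forall>i\<in>I. hip (f i) x = 0}"
  have W_add: "x + y \<in> W" if "x \<in> W" "y \<in> W" for x y
    using that by (simp add: W_def hip_add_right)
  have W_scale: "r *\<^sub>R x \<in> W" if "x \<in> W" for r x
    using that by (simp add: W_def scaleR_eq_of_real_smult hip_scale_right)
  have W_A: "A *v x \<in> W" if "x \<in> W" for x
    using that f by (simp add: W_def hip_matrix A hip_scale_left)
  \<comment> \<open>Complex orthogonality to \<open>f i\<close> amounts to real orthogonality to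
    \<open>f i\<close> and to \<open>\<i> *s f i\<close>. At most \<open>2 * card I\<close> vectors
    cannot span the real dimension \<open>2 * CARD('n)\<close>.\<close>
  define S where "S = f ` I \<union> (\<lambda>i. \<i> *s f i) ` I"
  have "card I < CARD('n)"
    using I by (intro psubset_card_mono) auto
  then have "card S < DIM(complex ^ 'n)"
    using card_Un_le[of "f ` I" "(\<lambda>i. \<i> *s f i) ` I"] card_image_le[of I f] card_image_le[of I "\<lambda>i. \<i> *s f i"]
    unfolding S_def by simp
  then have "dim S < DIM(complex ^ 'n)"
    using dim_le_card'[of S] by (simp add: S_def)
  then obtain x0 where x0: "x0 \<noteq> 0" "\<And>y. y \<in> span S \<Longrightarrow> orthogonal x0 y"
    using orthogonal_to_subspace_exists by blast
  have "x0 \<in> W"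
    unfolding W_def
  proof clarify
    fix i assume i: "i \<in> I"
    have "x0 \<bullet> f i = 0" "x0 \<bullet> (\<i> *s f i) = 0"
      using i x0(2) by (auto simp: S_def orthogonal_def span_base)
    then have "Re (hip (f i) x0) = 0" "Re (hip (\<i> *s f i) x0) = 0"
      by (simp_all add: Re_hip inner_commute)
    then show "hip (f i) x0 = 0" by (simp add: hip_scale_left complex_eq_iff)
  qed
  define q where "q x = x \<bullet> (A *v x)" for x
  have cont_q: "continuous_on T q" for T
    unfolding q_def by (intro continuous_intros linear_continuous_on) simp
  have "closed W"
  proof -
    have "W = (\<Inter>i\<in>I. {x. hip (f i) x = 0})" by (auto simp: W_def)
    moreover have "closed {x. hip (f i) x = 0}" for i
      unfolding hip_def by (intro closed_Collect_eq continuous_intros)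
    ultimately show ?thesis by auto
  qed
  then have "compact (sphere 0 1 \<inter> W)"
    by (intro compact_Int_closed compact_sphere)
  moreover have "(1 / norm x0) *\<^sub>R x0 \<in> sphere 0 1 \<inter> W"
    using x0(1) W_scale[OF \<open>x0 \<in> W\<close>] by simp
  then have "sphere 0 1 \<inter> W \<noteq> {}" by blast
  ultimately obtain x where x: "x \<in> sphere 0 1 \<inter> W" "\<And>y. y \<in> sphere 0 1 \<inter> W \<Longrightarrow> q y \<le> q x"
    using continuous_attains_sup[OF _ _ cont_q] by metis
  have nx: "norm x = 1" "x \<bullet> x = 1" and xW: "x \<in> W" using x(1) by (auto simp: dot_square_norm)
  have q_scale: "q (r *\<^sub>R y) = r\<^sup>2 * q y" for r y
    unfolding q_def
    by (simp add: scaleR_eq_of_real_smult[symmetric] linear_scale[OF matrix_vector_mul_linear,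
        of A] power2_eq_square)
  have max: "q y \<le> q x * (y \<bullet> y)" if "y \<in> W" for y
  proof (cases "y = 0")
    case True then show ?thesis by (simp add: q_def)
  next
    case False
    have "q ((1 / norm y) *\<^sub>R y) \<le> q x"
      using False that by (intro x(2)) (simp add: W_scale)
    then show ?thesis
      using False by (simp add: q_scale power_one_over dot_square_norm field_simps)
  qed
  define z where "z = A *v x - q x *\<^sub>R x"
  have zW: "z \<in> W"
    using W_add[OF W_A[OF xW] W_scale[OF xW, of "- q x"]] by (simp add: z_def)
  \<comment> \<open>Compares \<open>q\<close> at \<open>x + t *\<^sub>R z\<close> with the maximum.
    The linear coefficient is the squared length of the residual, since the part of
    \<open>A *v x\<close> along \<open>x\<close> cancels.\<close>
  have "2 * t * (z \<bullet> z) + t\<^sup>2 * (q z - q x * (z \<bullet> z)) \<le> 0" for t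
  proof -
    have "A *v (x + t *\<^sub>R z) = A *v x + t *\<^sub>R (A *v z)"
      by (simp add: linear_add linear_scale)
    moreover have "x \<bullet> (A *v z) = z \<bullet> (A *v x)"
      using inner_matrix[of x A z] A by (simp add: inner_commute)
    ultimately have e1: "q (x + t *\<^sub>R z) = q x + 2 * t * (z \<bullet> (A *v x)) + t\<^sup>2 * q z"
      unfolding q_def by (simp add: inner_add_left inner_add_right power2_eq_square algebra_simps)
    have e2: "z \<bullet> (A *v x) = z \<bullet> z + q x * (z \<bullet> x)"
      by (simp add: z_def inner_diff_left inner_diff_right algebra_simps)
    have e3: "q (x + t *\<^sub>R z) \<le> q x * ((x + t *\<^sub>R z) \<bullet> (x + t *\<^sub>R z))"
      by (intro max W_add xW W_scale zW)
    have e4: "(x + t *\<^sub>R z) \<bullet> (x + t *\<^sub>R z) = 1 + 2 * t * (z \<bullet> x) + t\<^sup>2 * (z \<bullet> z)"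
      using nx by (simp add: inner_add_left inner_add_right inner_commute power2_eq_square algebra_simps)
    show ?thesis using e3 unfolding e1 e2 e4 by (simp add: algebra_simps)
  qed
  then have "z \<bullet> z = 0" by (rule quadratic_nonpos_imp_zero) simp
  then have "A *v x = of_real (q x) *s x" by (simp add: z_def scaleR_eq_of_real_smult)
  then show thesis using that[of x "q x"] nx xW by (auto simp: W_def)
qed

text \<open>Induction over the set \<open>I\<close> of indices already served; the final basis is
  then indexed by \<open>'n\<close> and can be read as the columns of a square matrix.\<close>

lemma hermitian_orthonormal_eigenbasis:
  fixes A :: "'n::finite cmat"
  assumes A: "cadjoint A = A"
  shows "\<exists>(f :: 'n \<Rightarrow> complex ^ 'n) d. (\<forall>i\<in>I. \<forall>j\<in>I. hip (f i) (f j) = (if i = j then 1 else 0)) \<and>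
    (\<forall>i\<in>I. A *v f i = of_real (d i) *s f i)"
proof (induction I rule: finite_induct[OF finite])
  case 1
  then show ?case by simp
next
  case (2 k I)
  then obtain f d where f: "\<And>i j. i \<in> I \<Longrightarrow> j \<in> I \<Longrightarrow> hip (f i) (f j) = (if i = j then 1 else 0)"
    "\<And>i. i \<in> I \<Longrightarrow> A *v f i = of_real (d i) *s f i" by blast
  obtain x \<mu> where x: "norm x = 1" "\<And>i. i \<in> I \<Longrightarrow> hip (f i) x = 0" "A *v x = of_real \<mu> *s x"
    using hermitian_eigenvector_orthogonal[OF A, of I f d] f(2) 2(2) by blast
  have x': "hip x (f i) = 0" if "i \<in> I" for i
    using x(2)[OF that] hip_commute[of x "f i"] by simp
  show ?case
    using f x x' 2(2) by (intro exI[of _ "f(k := x)"] exI[of _ "d(k := \<mu>)"]) (auto simp: hip_self[of x])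
qed

definition matrix_of_columns :: "('n \<Rightarrow> complex ^ 'n) \<Rightarrow> 'n::finite cmat" where
  "matrix_of_columns f = (\<chi> i j. f j $ i)"

lemma matrix_of_columns_gram: "(cadjoint (matrix_of_columns f) ** matrix_of_columns f) $ i $ j = hip (f i) (f j)"
  by (simp add: matrix_of_columns_def matrix_matrix_mult_def hip_def)

lemma matrix_of_columns_unitary:
  assumes "\<And>i j. hip (f i) (f j) = (if i = j then 1 else 0)"
  shows "unitary_matrix (matrix_of_columns f)"
proof -
  have "cadjoint (matrix_of_columns f) ** matrix_of_columns f = mat 1"
    by (simp add: vec_eq_iff matrix_of_columns_gram assms mat_def)
  then show ?thesis
    unfolding unitary_matrix_def by (simp add: matrix_left_right_inverse)
qed

lemma matrix_of_columns_eigen: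
  assumes "\<And>i. A *v f i = d i *s f i"
  shows "A ** matrix_of_columns f = matrix_of_columns f ** diag_matrix d"
proof -
  have "(A ** matrix_of_columns f) $ i $ j = (A *v f j) $ i" for i j
    by (simp add: matrix_of_columns_def matrix_matrix_mult_def matrix_vector_mult_def)
  then show ?thesis
    using assms by (simp add: vec_eq_iff matrix_of_columns_def mult.commute)
qed

lemma unitary_matrixD:
  assumes "unitary_matrix V"
  shows "cadjoint V ** V = mat 1" "V ** cadjoint V = mat 1"
  using assms by (auto simp: unitary_matrix_def)

lemma hermitian_diagonalization:
  fixes A :: "'n::finite cmat"
  assumes "cadjoint A = A"
  obtains V d where "unitary_matrix V" "A = V ** diag_matrix (\<lambda>i. of_real (d i)) ** cadjoint V"
proof -
  obtain f :: "'n \<Rightarrow> complex ^ 'n" and d :: "'n \<Rightarrow> real"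
    where f: "\<And>i j. hip (f i) (f j) = (if i = j then 1 else 0)"
      "\<And>i. A *v f i = of_real (d i) *s f i"
    using hermitian_orthonormal_eigenbasis[OF assms, of UNIV] unfolding ball_UNIV by blast
  let ?V = "matrix_of_columns f"
  have V: "unitary_matrix ?V" by (rule matrix_of_columns_unitary[OF f(1)])
  have "A = (A ** ?V) ** cadjoint ?V"
    by (simp add: matrix_mul_assoc[symmetric] unitary_matrixD[OF V])
  then have "A = ?V ** diag_matrix (\<lambda>i. of_real (d i)) ** cadjoint ?V"
    using matrix_of_columns_eigen[of A f "\<lambda>i. of_real (d i)", OF f(2)] by simp
  then show thesis using that V by blast
qed

lemma unitary_conj_cancel:
  assumes "unitary_matrix V"
  shows "cadjoint V ** (V ** A) = A" "V ** (cadjoint V ** A) = A"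
  using assms by (simp_all add: matrix_mul_assoc unitary_matrixD)

lemma unitary_conj_mult:
  assumes "unitary_matrix V"
  shows "(V ** A ** cadjoint V) ** (V ** B ** cadjoint V) = V ** (A ** B) ** cadjoint V"
  by (simp add: matrix_mul_assoc[symmetric] unitary_conj_cancel[OF assms])

lemma diag_matrix_vector_nth: "(diag_matrix x *v v) $ i = x i * v $ i"
  by (simp add: matrix_vector_mult_def if_distrib[of "\<lambda>x. x * _"] cong: if_cong)

section \<open>Functional calculus, independent of the diagonalization\<close>

definition real_diag :: "('n \<Rightarrow> real) \<Rightarrow> 'n::finite cmat" where
  "real_diag d = diag_matrix (\<lambda>i. of_real (d i))"

lemma real_diag_mult: "real_diag d ** real_diag e = real_diag (\<lambda>i. d i * e i)"
  by (simp add: real_diag_def diag_matrix_mult)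

lemma cadjoint_real_diag [simp]: "cadjoint (real_diag d) = real_diag d"
  by (simp add: real_diag_def cadjoint_diag_matrix)

definition fun_calc :: "'n::finite cmat \<Rightarrow> ('n \<Rightarrow> real) \<Rightarrow> 'n cmat" where
  "fun_calc V d = V ** real_diag d ** cadjoint V"

lemma fun_calc_mult: "unitary_matrix V \<Longrightarrow> fun_calc V d ** fun_calc V e = fun_calc V (\<lambda>i. d i * e i)"
  by (simp add: fun_calc_def unitary_conj_mult real_diag_mult)

lemma fun_calc_one: "unitary_matrix V \<Longrightarrow> fun_calc V (\<lambda>_. 1) = mat 1"
  by (simp add: fun_calc_def real_diag_def unitary_matrixD)

lemma cadjoint_fun_calc: "cadjoint (fun_calc V d) = fun_calc V d"
  by (simp add: fun_calc_def cadjoint_mult matrix_mul_assoc)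

text \<open>The entries of the intertwiner \<open>X = cadjoint W ** V\<close> vanish unless
  \<open>d j = e i\<close>. Where they do not vanish, \<open>g\<close> takes equal values, so
  \<open>X\<close> also intertwines the two diagonals after application of \<open>g\<close>.\<close>

lemma fun_calc_unique:
  assumes V: "unitary_matrix V" and W: "unitary_matrix W" and eq: "fun_calc V d = fun_calc W e"
  shows "fun_calc V (\<lambda>i. g (d i)) = fun_calc W (\<lambda>i. g (e i))"
proof -
  define X where "X = cadjoint W ** V"
  have "X ** real_diag d = cadjoint W ** fun_calc V d ** V"
    by (simp add: X_def fun_calc_def matrix_mul_assoc[symmetric] unitary_matrixD[OF V])
  also have "\<dots> = real_diag e ** X"
    unfolding eq by (simp add: X_def fun_calc_def matrix_mul_assoc unitary_matrixD[OF W])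
  finally have "(X ** real_diag d) $ i $ j = (real_diag e ** X) $ i $ j" for i j by simp
  then have *: "X $ i $ j * of_real (d j) = of_real (e i) * X $ i $ j" for i j
    by (simp add: real_diag_def)
  have "X $ i $ j * of_real (g (d j)) = of_real (g (e i)) * X $ i $ j" for i j
  proof (cases "X $ i $ j = 0")
    case False
    then have "of_real (d j) = (of_real (e i) :: complex)" using *[of i j] by simp
    then show ?thesis by simp
  qed simp
  then have "X ** real_diag (\<lambda>i. g (d i)) = real_diag (\<lambda>i. g (e i)) ** X"
    by (simp add: vec_eq_iff real_diag_def)
  then have "W ** (X ** real_diag (\<lambda>i. g (d i))) ** cadjoint V = W ** (real_diag (\<lambda>i. g (e i)) ** X) ** cadjoint V"
    by simp
  then show ?thesis
    by (simp add: X_def fun_calc_def matrix_mul_assoc unitary_matrixD[OF W])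
       (simp add: matrix_mul_assoc[symmetric] unitary_matrixD[OF V])
qed

lemma psd_powr_fun_calc:
  assumes V: "unitary_matrix V" and d: "\<And>i. 0 \<le> d i"
  shows "psd_powr (fun_calc V d) s = fun_calc V (\<lambda>i. d i powr s)"
  unfolding psd_powr_def
proof (rule the_equality)
  show "\<exists>W e. unitary_matrix W \<and> (\<forall>i. 0 \<le> e i) \<and>
      fun_calc V d = W ** diag_matrix (\<lambda>i. complex_of_real (e i)) ** cadjoint W \<and>
      fun_calc V (\<lambda>i. d i powr s) = W ** diag_matrix (\<lambda>i. complex_of_real (e i powr s)) ** cadjoint W"
    using assms by (intro exI[of _ V] exI[of _ d]) (simp add: fun_calc_def real_diag_def)
next
  fix B
  assume "\<exists>W e. unitary_matrix W \<and> (\<forall>i. 0 \<le> e i) \<and>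
      fun_calc V d = W ** diag_matrix (\<lambda>i. complex_of_real (e i)) ** cadjoint W \<and>
      B = W ** diag_matrix (\<lambda>i. complex_of_real (e i powr s)) ** cadjoint W"
  then obtain W e where W: "unitary_matrix W" "fun_calc V d = fun_calc W e" "B = fun_calc W (\<lambda>i. e i powr s)"
    unfolding fun_calc_def real_diag_def by blast
  then show "B = fun_calc V (\<lambda>i. d i powr s)"
    using fun_calc_unique[OF V W(1,2), of "\<lambda>x. x powr s"] by simp
qed

text \<open>Each \<open>d i\<close> is the squared length of column \<open>i\<close> of
  \<open>T ** V\<close>, and no column of an invertible matrix vanishes.\<close>

lemma gram_diagonalization:
  fixes T :: "'n::finite cmat"
  assumes T: "invertible T"
  obtains V d where "unitary_matrix V" "\<And>i. 0 < d i" "cadjoint T ** T = fun_calc V d"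
proof -
  have "cadjoint (cadjoint T ** T) = cadjoint T ** T" by (simp add: cadjoint_mult)
  then obtain V d where V: "unitary_matrix V" "cadjoint T ** T = fun_calc V d"
    using hermitian_diagonalization unfolding fun_calc_def real_diag_def by metis
  have "0 < d i" for i
  proof -
    have inv: "invertible (T ** V)"
      using T V(1) by (intro invertible_mult) (auto simp: invertible_def unitary_matrix_def)
    have "cadjoint (T ** V) ** (T ** V) = cadjoint V ** fun_calc V d ** V"
      by (simp add: V(2)[symmetric] cadjoint_mult matrix_mul_assoc)
    also have "\<dots> = real_diag d"
      by (simp add: fun_calc_def matrix_mul_assoc[symmetric] unitary_conj_cancel[OF V(1)] unitary_matrixD[OF V(1)])
    finally have D: "cadjoint (T ** V) ** (T ** V) = real_diag d" .
    have "of_real (d i) = (cadjoint (T ** V) ** (T ** V)) $ i $ i" by (simp add: D real_diag_def)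
    also have "\<dots> = (\<Sum>k\<in>UNIV. of_real ((norm ((T ** V) $ k $ i))\<^sup>2))"
      by (simp add: matrix_matrix_mult_def[of "cadjoint _"] complex_norm_square mult.commute del: of_real_power)
    finally have di: "d i = (\<Sum>k\<in>UNIV. (norm ((T ** V) $ k $ i))\<^sup>2)"
      by (simp only: of_real_sum[symmetric] of_real_eq_iff)
    have "d i \<noteq> 0"
    proof
      assume "d i = 0"
      then have "(T ** V) $ k $ i = 0" for k
        using di by (simp add: sum_nonneg_eq_0_iff)
      then have "(T ** V) *v axis i 1 = 0"
        by (simp add: vec_eq_iff matrix_vector_mult_def[of "T ** V"] axis_def if_distrib cong: if_cong)
      moreover obtain X where "X ** (T ** V) = mat 1" using inv by (auto simp: invertible_def)
      ultimately have "axis i (1 :: complex) = 0"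
        by (metis matrix_vector_mul_assoc matrix_vector_mul_lid matrix_vector_mult_0_right)
      then show False by (simp add: axis_eq_0_iff)
    qed
    moreover have "d i \<ge> 0" unfolding di by (intro sum_nonneg) auto
    ultimately show ?thesis by simp
  qed
  then show thesis using that V by blast
qed

text \<open>Since \<open>matrix_abs T\<close> has the inverse \<open>H'\<close>, the polar factor
  can only be \<open>T ** H'\<close>; this makes the description in \<open>aluthge_def\<close>
  unique.\<close>

lemma aluthge_polar:
  assumes V: "unitary_matrix V" and d: "\<And>i. 0 < d i" and T: "cadjoint T ** T = fun_calc V d"
  obtains U where "unitary_matrix U" "T = U ** fun_calc V (\<lambda>i. d i powr (1/2))"
    "aluthge l T = fun_calc V (\<lambda>i. d i powr (l/2)) ** U ** fun_calc V (\<lambda>i. d i powr ((1 - l)/2))"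
proof -
  have abs: "matrix_abs T = fun_calc V (\<lambda>i. d i powr (1/2))"
    unfolding matrix_abs_def T using d by (intro psd_powr_fun_calc V) (auto intro: less_imp_le)
  have abs_powr: "psd_powr (matrix_abs T) s = fun_calc V (\<lambda>i. d i powr (s/2))" for s
    unfolding abs using psd_powr_fun_calc[OF V, of "\<lambda>i. d i powr (1/2)" s] by (simp add: powr_powr)
  define H' where "H' = fun_calc V (\<lambda>i. d i powr (- (1/2)))"
  have HH': "matrix_abs T ** H' = mat 1" "H' ** matrix_abs T = mat 1"
    using d unfolding abs H'_def
    by (simp_all add: fun_calc_mult[OF V] powr_add[symmetric] less_imp_neq[THEN not_sym] fun_calc_one[OF V])
  define U where "U = T ** H'"
  have "cadjoint U ** U = H' ** (fun_calc V d) ** H'"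
    unfolding U_def T[symmetric] by (simp add: cadjoint_mult H'_def cadjoint_fun_calc matrix_mul_assoc)
  also have "\<dots> = mat 1"
    using d fun_calc_one[OF V] powr_add[of "d _" "-(1/2)" 1] powr_add[of "d _" "1/2" "- (1/2)"]
    by (simp add: H'_def fun_calc_mult[OF V] less_imp_neq[THEN not_sym] less_imp_le)
  finally have U: "unitary_matrix U"
    unfolding unitary_matrix_def by (simp add: matrix_left_right_inverse)
  have TU: "T = U ** matrix_abs T"
    by (simp add: U_def matrix_mul_assoc[symmetric] HH')
  have "aluthge l T = psd_powr (matrix_abs T) l ** U ** psd_powr (matrix_abs T) (1 - l)"
    unfolding aluthge_def
  proof (rule the_equality)
    show "\<exists>Ua. polar_decomposition T Ua \<and> psd_powr (matrix_abs T) l ** U ** psd_powr (matrix_abs T) (1 - l)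
      = psd_powr (matrix_abs T) l ** Ua ** psd_powr (matrix_abs T) (1 - l)"
      using U TU unfolding polar_decomposition_def by blast
    fix B assume "\<exists>Ua. polar_decomposition T Ua \<and> B
        = psd_powr (matrix_abs T) l ** Ua ** psd_powr (matrix_abs T) (1 - l)"
    then obtain U' where U': "T = U' ** matrix_abs T"
      "B = psd_powr (matrix_abs T) l ** U' ** psd_powr (matrix_abs T) (1 - l)"
      unfolding polar_decomposition_def by blast
    have "U' = U' ** (matrix_abs T ** H')" by (simp add: HH')
    also have "\<dots> = U" unfolding U_def matrix_mul_assoc U'(1)[symmetric] ..
    finally show "B = psd_powr (matrix_abs T) l ** U ** psd_powr (matrix_abs T) (1 - l)"
      using U'(2) by simp
  qed
  then show thesis using that[OF U] TU abs abs_powr by simp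
qed

text \<open>Absorbing the polar factor leaves a similarity by a power of
  \<open>cadjoint T ** T\<close>, with exponent \<open>l/2\<close> because the \<open>d i\<close>
  are squares of singular values. In this form the transform is an expression in \<open>T\<close>
  and its adjoint that extends holomorphically.\<close>

lemma aluthge_eq:
  assumes V: "unitary_matrix V" and d: "\<And>i. 0 < d i" and T: "cadjoint T ** T = fun_calc V d"
  shows "aluthge l T = fun_calc V (\<lambda>i. d i powr (l/2)) ** T ** fun_calc V (\<lambda>i. d i powr (- (l/2)))"
proof -
  obtain U where U: "unitary_matrix U" "T = U ** fun_calc V (\<lambda>i. d i powr (1/2))"
    "aluthge l T = fun_calc V (\<lambda>i. d i powr (l/2)) ** U ** fun_calc V (\<lambda>i. d i powr ((1 - l)/2))"
    using aluthge_polar[OF assms] by blast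
  have "fun_calc V (\<lambda>i. d i powr ((1 - l)/2))
      = fun_calc V (\<lambda>i. d i powr (1/2)) ** fun_calc V (\<lambda>i. d i powr (- (l/2)))"
    using V by (simp add: fun_calc_mult powr_add[symmetric] diff_divide_distrib)
  then show ?thesis unfolding U(3) using U(2) by (simp add: matrix_mul_assoc)
qed

text \<open>The vector \<open>R *v axis i 1\<close> is an eigenvector of \<open>B\<close>, so
  \<open>d i / c - 1\<close> is an eigenvalue of \<open>(1 / c) *\<^sub>R B - mat 1\<close> and is
  bounded by its operator norm.\<close>

lemma diag_cpw_domain:
  fixes R R' B :: "'n::finite cmat"
  assumes B: "B \<in> cpw_dom c" and R: "R ** R' = mat 1" "R' ** R = mat 1"
    and eq: "B = R ** real_diag d ** R'" and c: "c > 0"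
  shows "\<bar>d i / c - 1\<bar> < 1"
proof -
  define M where "M = (1 / c) *\<^sub>R B - mat 1"
  define v where "v = R *v axis i 1"
  have "v \<noteq> 0"
  proof
    assume "v = 0"
    then have "axis i (1 :: complex) = 0"
      unfolding v_def by (metis R(2) matrix_vector_mul_assoc matrix_vector_mul_lid matrix_vector_mult_0_right)
    then show False by (simp add: axis_eq_0_iff)
  qed
  have "real_diag d *v axis i 1 = of_real (d i) *s axis i 1"
    by (simp add: real_diag_def diag_matrix_vector_nth vec_eq_iff axis_def)
  then have "B *v v = of_real (d i) *s v"
    unfolding eq v_def
    by (metis (no_types, lifting) R(2) matrix_mul_assoc matrix_mul_rid matrix_vector_mul_assoc
        vector_scalar_commute)
  moreover have "((1 / c) *\<^sub>R B) *v v = (1 / c) *\<^sub>R (B *v v)"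
    by (simp add: vec_eq_iff matrix_vector_mult_def scaleR_sum_right)
  ultimately have "M *v v = of_real (d i / c - 1) *s v"
    unfolding M_def
    by (simp add: matrix_vector_mult_diff_rdistrib vec_eq_iff
        scaleR_conv_of_real[where 'a = complex] algebra_simps)
  then have "\<bar>d i / c - 1\<bar> * norm v = norm (M *v v)"
    by (metis norm_scaleR scaleR_eq_of_real_smult)
  also have "\<dots> \<le> opn M * norm v" by (rule opn_bound)
  finally have "\<bar>d i / c - 1\<bar> \<le> opn M" using \<open>v \<noteq> 0\<close> by simp
  also have "opn M < 1" using B by (simp add: M_def cpw_dom_def)
  finally show ?thesis .
qed

text \<open>\<open>B\<close> is in general not Hermitian, only similar to a positive matrix.
  Membership in \<open>cpw_dom c\<close> confines its eigenvalues to the open interval from 0 to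
  \<open>2 * c\<close>; there the series is compatible with diagonalization, and the two notions of
  power agree.\<close>

lemma cpw_eq_fun_calc:
  fixes P Q B V :: "'n::finite cmat"
  assumes B: "B \<in> cpw_dom c" and PQ: "P ** Q = mat 1" "Q ** P = mat 1" and V: "unitary_matrix V"
    and eq: "P ** B ** Q = fun_calc V d" and c: "c > 0"
  shows "P ** cpw c (of_real s) B ** Q = fun_calc V (\<lambda>i. d i powr s)"
proof -
  define R R' where "R = Q ** V" and "R' = cadjoint V ** P"
  have R: "R ** R' = mat 1" "R' ** R = mat 1"
    using PQ V unfolding R_def R'_def
    by (metis matrix_mul_assoc matrix_mul_rid unitary_matrixD(2),
        metis matrix_mul_assoc matrix_mul_rid unitary_matrixD(1))
  have B_eq: "B = R ** real_diag d ** R'"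
  proof -
    have "B = (Q ** P) ** B ** (Q ** P)" by (simp add: PQ)
    also have "\<dots> = Q ** (P ** B ** Q) ** P" by (simp only: matrix_mul_assoc)
    finally show ?thesis unfolding eq by (simp add: R_def R'_def fun_calc_def matrix_mul_assoc)
  qed
  have "\<bar>d i / c - 1\<bar> < 1" for i by (rule diag_cpw_domain[OF B R B_eq c])
  then have "0 < d i / c \<and> d i / c < 2" for i by (simp add: abs_less_iff)
  then have dom: "0 < d i" "d i < 2 * c" for i
    using c by (auto simp: field_simps zero_less_divide_iff)
  have D: "real_diag d \<in> cpw_dom c"
    unfolding cpw_dom_def mem_Collect_eq real_diag_def diag_matrix_shift
    by (rule opn_diag_less) (rule norm_shift_real[OF dom])
  have "cpw c (of_real s) B = R ** real_diag (\<lambda>i. d i powr s) ** R'"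
    unfolding B_eq cpw_conj[OF D R(2,1)] using cpw_diag_real[of d c s, OF dom c] by (simp add: real_diag_def)
  then have "P ** cpw c (of_real s) B ** Q = (P ** Q) ** V ** real_diag (\<lambda>i. d i powr s) ** cadjoint V ** (P ** Q)"
    by (simp only: R_def R'_def matrix_mul_assoc)
  then show ?thesis by (simp add: PQ fun_calc_def)
qed

section \<open>Limit points of the iteration\<close>

lemma norm_cmat_sq: "(norm A)\<^sup>2 = (\<Sum>i\<in>UNIV. \<Sum>j\<in>UNIV. (norm (A $ i $ j))\<^sup>2)" for A :: "'n::finite cmat"
  by (simp add: norm_vec_def L2_set_def sum_nonneg)

lemma norm_cmat_trace: "of_real ((norm A)\<^sup>2) = trace (cadjoint A ** A)" for A :: "'n::finite cmat"
proof -
  have "trace (cadjoint A ** A) = (\<Sum>j\<in>UNIV. \<Sum>i\<in>UNIV. of_real ((norm (A $ i $ j))\<^sup>2))"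
    by (simp add: trace_def matrix_matrix_mult_def complex_norm_square mult.commute del: of_real_power)
  also have "\<dots> = (\<Sum>i\<in>UNIV. \<Sum>j\<in>UNIV. of_real ((norm (A $ i $ j))\<^sup>2))" by (rule sum.swap)
  finally show ?thesis by (simp only: norm_cmat_sq of_real_sum)
qed

lemma norm_unitary_mult:
  fixes A V :: "'n::finite cmat"
  assumes V: "unitary_matrix V"
  shows "norm (V ** A) = norm A" "norm (A ** V) = norm A"
proof -
  have "complex_of_real ((norm (V ** A))\<^sup>2) = of_real ((norm A)\<^sup>2)"
    unfolding norm_cmat_trace
    by (simp add: cadjoint_mult matrix_mul_assoc[symmetric] unitary_conj_cancel[OF V])
  then show "norm (V ** A) = norm A"
    by (metis norm_ge_zero of_real_eq_iff power2_eq_iff_nonneg)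
  have "trace (cadjoint (A ** V) ** (A ** V)) = trace ((cadjoint V ** (cadjoint A ** A)) ** V)"
    by (simp add: cadjoint_mult matrix_mul_assoc)
  also have "\<dots> = trace (V ** (cadjoint V ** (cadjoint A ** A)))" by (rule trace_mul_sym)
  finally have "complex_of_real ((norm (A ** V))\<^sup>2) = of_real ((norm A)\<^sup>2)"
    unfolding norm_cmat_trace by (simp add: unitary_conj_cancel[OF V])
  then show "norm (A ** V) = norm A"
    by (metis norm_ge_zero of_real_eq_iff power2_eq_iff_nonneg)
qed

lemma unitary_cadjoint: "unitary_matrix V \<Longrightarrow> unitary_matrix (cadjoint V)"
  by (simp add: unitary_matrix_def)

lemma unitary_mult: "unitary_matrix U \<Longrightarrow> unitary_matrix V \<Longrightarrow> unitary_matrix (U ** V)"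
  unfolding unitary_matrix_def by (metis cadjoint_mult matrix_mul_assoc matrix_mul_rid)

lemma unitary_row_sum:
  assumes "unitary_matrix W"
  shows "(\<Sum>j\<in>UNIV. (norm (W $ i $ j))\<^sup>2) = 1" "(\<Sum>i\<in>UNIV. (norm (W $ i $ j))\<^sup>2) = 1"
proof -
  have "of_real (\<Sum>j\<in>UNIV. (norm (W $ i $ j))\<^sup>2) = (W ** cadjoint W) $ i $ i"
    by (simp add: matrix_matrix_mult_def complex_norm_square del: of_real_power)
  then show "(\<Sum>j\<in>UNIV. (norm (W $ i $ j))\<^sup>2) = 1"
    unfolding unitary_matrixD[OF assms] by (simp add: mat_def del: of_real_sum of_real_power)
  have "of_real (\<Sum>i\<in>UNIV. (norm (W $ i $ j))\<^sup>2) = (cadjoint W ** W) $ j $ j"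
    by (simp add: matrix_matrix_mult_def complex_norm_square mult.commute del: of_real_power)
  then show "(\<Sum>i\<in>UNIV. (norm (W $ i $ j))\<^sup>2) = 1"
    unfolding unitary_matrixD[OF assms] by (simp add: mat_def del: of_real_sum of_real_power)
qed

text \<open>With the mean \<open>m\<close> as unit, \<open>ln t \<le> t - 1\<close> at
  \<open>x / m\<close> and \<open>y / m\<close> is summed with weights \<open>l\<close> and
  \<open>1 - l\<close>; the right sides cancel. Equality holds only at \<open>t = 1\<close>, which
  settles the second claim.\<close>

lemma weighted_am_gm:
  fixes x y l :: real
  assumes "x > 0" "y > 0" "0 < l" "l < 1"
  shows "x powr l * y powr (1 - l) \<le> l * x + (1 - l) * y"
    and "x powr l * y powr (1 - l) = l * x + (1 - l) * y \<Longrightarrow> x = y"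
proof -
  define m where "m = l * x + (1 - l) * y"
  have m: "m > 0" using assms by (simp add: m_def add_pos_pos)
  have lnx: "ln (x / m) \<le> x / m - 1" "ln (y / m) \<le> y / m - 1"
    using assms m by (simp_all add: ln_le_minus_one)
  have sum0: "l * (x / m - 1) + (1 - l) * (y / m - 1) = 0"
    using m by (simp add: m_def field_simps)
  have key: "ln (x powr l * y powr (1 - l)) - ln m = l * ln (x / m) + (1 - l) * ln (y / m)"
    using assms m by (simp add: ln_mult ln_powr ln_div algebra_simps)
  have 1: "l * ln (x / m) \<le> l * (x / m - 1)" "(1 - l) * ln (y / m) \<le> (1 - l) * (y / m - 1)"
    using assms lnx by (auto intro: mult_left_mono)
  have pos: "x powr l * y powr (1 - l) > 0" using assms by simp
  have "ln (x powr l * y powr (1 - l)) \<le> ln m" using key sum0 1 by linarith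
  then show "x powr l * y powr (1 - l) \<le> l * x + (1 - l) * y"
    using pos m by (simp add: m_def)
  assume "x powr l * y powr (1 - l) = l * x + (1 - l) * y"
  then have "ln (x powr l * y powr (1 - l)) - ln m = 0" by (simp add: m_def)
  then have "l * ln (x / m) = l * (x / m - 1)" "(1 - l) * ln (y / m) = (1 - l) * (y / m - 1)"
    using key sum0 1 by linarith+
  then have "ln (x / m) = x / m - 1" "ln (y / m) = y / m - 1" using assms by auto
  then have "x / m = 1" "y / m = 1"
    using assms m ln_eq_minus_one[of "x / m"] ln_eq_minus_one[of "y / m"] by auto
  then show "x = y" using m by simp
qed

definition normal_matrix :: "'n::finite cmat \<Rightarrow> bool" where
  "normal_matrix T \<longleftrightarrow> cadjoint T ** T = T ** cadjoint T"

text \<open>In a basis of right singular vectors, the entry \<open>(i, j)\<close> of the transform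
  has the squared modulus of the entry of a unitary \<open>W\<close>, times
  \<open>d i powr l * d j powr (1 - l)\<close>. The squared moduli of \<open>W\<close> have row and
  column sums 1, so the weighted inequality between geometric and arithmetic mean sums up to the
  trace of \<open>cadjoint T ** T\<close>. Equality makes \<open>W\<close> commute with the diagonal
  \<open>d\<close>, hence \<open>U\<close> with \<open>cadjoint T ** T\<close>, and this is
  normality of \<open>T\<close>.\<close>

lemma norm_aluthge:
  fixes T :: "'n::finite cmat"
  assumes inv: "invertible T" and l: "0 < l" "l < 1"
  shows "norm (aluthge l T) \<le> norm T"
    and "norm (aluthge l T) = norm T \<Longrightarrow> normal_matrix T"
proof -
  obtain V d where V: "unitary_matrix V" and d: "\<And>i. 0 < d i" and T: "cadjoint T ** T = fun_calc V d"
    using gram_diagonalization[OF inv] by blast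
  obtain U where U: "unitary_matrix U" "T = U ** fun_calc V (\<lambda>i. d i powr (1/2))"
    "aluthge l T = fun_calc V (\<lambda>i. d i powr (l/2)) ** U ** fun_calc V (\<lambda>i. d i powr ((1 - l)/2))"
    using aluthge_polar[OF V d T] by blast
  note V' = unitary_cadjoint[OF V]
  define W where "W = cadjoint V ** U ** V"
  have W: "unitary_matrix W" unfolding W_def by (intro unitary_mult V V' U(1))
  have "aluthge l T = V ** (real_diag (\<lambda>i. d i powr (l/2)) ** W ** real_diag (\<lambda>i. d i powr ((1 - l)/2))) **
      cadjoint V"
    unfolding U(3) W_def fun_calc_def by (simp add: matrix_mul_assoc)
  then have "norm (aluthge l T) = norm (real_diag (\<lambda>i. d i powr (l/2)) ** W ** real_diag (\<lambda>i. d i powr ((1 -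
      l)/2)))"
    by (simp add: norm_unitary_mult V V')
  moreover have "(norm ((real_diag (\<lambda>i. d i powr (l/2)) ** W ** real_diag (\<lambda>i. d i powr ((1 - l)/2))) $ i $ j))\<^sup>2
    = (norm (W $ i $ j))\<^sup>2 * (d i powr l * d j powr (1 - l))" for i j
  proof -
    have "(d k powr (s/2))\<^sup>2 = d k powr s" for k s by (simp add: powr_power less_imp_neq[OF d, THEN not_sym])
    then show ?thesis
      by (simp add: real_diag_def norm_mult power_mult_distrib mult_ac)
  qed
  ultimately have nA: "(norm (aluthge l T))\<^sup>2
      = (\<Sum>i\<in>UNIV. \<Sum>j\<in>UNIV. (norm (W $ i $ j))\<^sup>2 * (d i powr l * d j powr (1 - l)))"
    by (simp add: norm_cmat_sq)
  have "of_real ((norm T)\<^sup>2) = trace (fun_calc V d)" unfolding norm_cmat_trace T ..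
  also have "\<dots> = trace (cadjoint V ** (V ** real_diag d))"
    unfolding fun_calc_def by (rule trace_mul_sym)
  also have "\<dots> = of_real (\<Sum>i\<in>UNIV. d i)"
    by (simp add: unitary_conj_cancel[OF V] trace_def real_diag_def)
  finally have nT: "(norm T)\<^sup>2 = (\<Sum>i\<in>UNIV. d i)" by (simp only: of_real_eq_iff)
  have "(\<Sum>i\<in>UNIV. \<Sum>j\<in>UNIV. (norm (W $ i $ j))\<^sup>2 * (l * d i + (1 - l) * d j))
    = (\<Sum>i\<in>UNIV. l * d i * (\<Sum>j\<in>UNIV. (norm (W $ i $ j))\<^sup>2))
        + (\<Sum>i\<in>UNIV. \<Sum>j\<in>UNIV. (1 - l) * d j * (norm (W $ i $ j))\<^sup>2)"
    by (simp add: distrib_left sum.distrib sum_distrib_left mult_ac)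
  also have "(\<Sum>i\<in>UNIV. \<Sum>j\<in>UNIV. (1 - l) * d j * (norm (W $ i $ j))\<^sup>2)
      = (\<Sum>j\<in>UNIV. (1 - l) * d j * (\<Sum>i\<in>UNIV. (norm (W $ i $ j))\<^sup>2))"
    by (subst sum.swap) (simp add: sum_distrib_left)
  also have "(\<Sum>i\<in>UNIV. l * d i * (\<Sum>j\<in>UNIV. (norm (W $ i $ j))\<^sup>2))
      + (\<Sum>j\<in>UNIV. (1 - l) * d j * (\<Sum>i\<in>UNIV. (norm (W $ i $ j))\<^sup>2)) = (\<Sum>i\<in>UNIV. d i)"
    by (simp add: unitary_row_sum[OF W] sum.distrib[symmetric] algebra_simps)
  finally have bound: "(\<Sum>i\<in>UNIV. \<Sum>j\<in>UNIV. (norm (W $ i $ j))\<^sup>2 * (l * d i + (1 - l) * d j)) = (norm T)\<^sup>2"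
    using nT by simp
  have term_le: "(norm (W $ i $ j))\<^sup>2 * (d i powr l * d j powr (1 - l)) \<le> (norm (W $ i $ j))\<^sup>2 * (l * d i
      + (1 - l) * d j)" for i j
    by (intro mult_left_mono weighted_am_gm(1) d l) auto
  have "(norm (aluthge l T))\<^sup>2 \<le> (norm T)\<^sup>2"
    unfolding nA bound[symmetric] by (intro sum_mono term_le)
  then show "norm (aluthge l T) \<le> norm T" by simp
  assume "norm (aluthge l T) = norm T"
  then have "(\<Sum>i\<in>UNIV. \<Sum>j\<in>UNIV. (norm (W $ i $ j))\<^sup>2 * (l * d i
      + (1 - l) * d j) - (norm (W $ i $ j))\<^sup>2 * (d i powr l * d j powr (1 - l))) = 0"
    using nA bound by (simp add: sum_subtractf)
  then have eq: "(norm (W $ i $ j))\<^sup>2 * (l * d i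
      + (1 - l) * d j) - (norm (W $ i $ j))\<^sup>2 * (d i powr l * d j powr (1 - l)) = 0" for i j
    using term_le by (simp add: sum_nonneg_eq_0_iff sum_nonneg)
  \<comment> \<open>Equality holds in every single term; where the entry of \<open>W\<close> is
    non-zero it gives \<open>d i = d j\<close>.\<close>
  have comm: "W $ i $ j * of_real (d j) = of_real (d i) * W $ i $ j" for i j
  proof (cases "W $ i $ j = 0")
    case False
    then have "d i powr l * d j powr (1 - l) = l * d i + (1 - l) * d j" using eq[of i j] by simp
    then have "d i = d j" using weighted_am_gm(2)[OF d d l] by blast
    then show ?thesis by simp
  qed simp
  then have WD: "W ** real_diag d = real_diag d ** W"
    by (simp add: vec_eq_iff real_diag_def)
  have "U ** fun_calc V d = V ** (W ** real_diag d) ** cadjoint V"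
    unfolding W_def fun_calc_def by (simp add: matrix_mul_assoc unitary_matrixD[OF V])
  also have "\<dots> = fun_calc V d ** U"
    unfolding WD unfolding W_def fun_calc_def
    by (simp add: matrix_mul_assoc[symmetric] unitary_matrixD[OF V] unitary_conj_cancel[OF V])
  finally have UG: "U ** fun_calc V d = fun_calc V d ** U" .
  have "T ** cadjoint T = U ** fun_calc V d ** cadjoint U"
  proof -
    have "fun_calc V (\<lambda>i. d i powr (1/2)) ** fun_calc V (\<lambda>i. d i powr (1/2)) = fun_calc V d"
      using d by (simp add: fun_calc_mult[OF V] powr_add[symmetric] less_imp_le)
    then show ?thesis
      unfolding U(2) cadjoint_mult cadjoint_fun_calc by (metis matrix_mul_assoc)
  qed
  also have "\<dots> = cadjoint T ** T"
    unfolding UG T by (simp add: matrix_mul_assoc[symmetric] unitary_matrixD[OF U(1)])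
  finally show "normal_matrix T" by (simp add: normal_matrix_def)
qed

text \<open>Expressed by a determinant, spectral information is continuous in \<open>T\<close> and
  can be carried over to limit points.\<close>

lemma eigenvalues_iff_det: "c \<in> eigenvalues T \<longleftrightarrow> det (T - mat c) = 0" for T :: "'n::finite cmat"
proof -
  have mc: "(T - mat c) *v v = T *v v - c *s v" for v
    by (simp add: vec_eq_iff matrix_vector_mult_def mat_def left_diff_distrib sum_subtractf
        if_distrib[of "\<lambda>x. x * _"] cong: if_cong)
  have "det (T - mat c) = 0 \<longleftrightarrow> \<not> invertible (T - mat c)" by (simp add: invertible_det_nz)
  also have "\<dots> \<longleftrightarrow> \<not> (\<forall>v. (T - mat c) *v v = 0 \<longrightarrow> v = 0)"
    by (simp add: invertible_left_inverse matrix_left_invertible_ker)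
  finally show ?thesis unfolding eigenvalues_def mc by auto
qed

lemma eigenvalues_similar:
  fixes T G G' :: "'n::finite cmat"
  assumes "G ** G' = mat 1" "G' ** G = mat 1"
  shows "det (G ** T ** G' - mat c) = det (T - mat c)"
proof -
  have mc: "mat c ** A = A ** mat c" for A :: "'n cmat"
    by (simp add: vec_eq_iff matrix_matrix_mult_def mat_def if_distrib[of "\<lambda>x. x * _"]
        if_distrib[of "\<lambda>x. _ * x"] mult.commute cong: if_cong)
  have "G ** mat c ** G' = mat c"
    unfolding mc[symmetric] by (simp add: matrix_mul_assoc[symmetric] assms)
  then have "G ** T ** G' - mat c = G ** (T - mat c) ** G'"
    by (simp add: mmult.diff_left mmult.diff_right)
  then have "det (G ** T ** G' - mat c) = (det G * det G') * det (T - mat c)"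
    by (simp add: det_mul mult_ac)
  also have "det G * det G' = 1" by (metis assms(1) det_I det_mul)
  finally show ?thesis by simp
qed

lemma aluthge_similar:
  fixes T :: "'n::finite cmat"
  assumes "invertible T"
  obtains G G' where "G ** G' = mat 1" "G' ** G = mat 1" "aluthge l T = G ** T ** G'"
proof -
  obtain V d where V: "unitary_matrix V" and d: "\<And>i. 0 < d i" and T: "cadjoint T ** T = fun_calc V d"
    using gram_diagonalization[OF assms] by blast
  have "fun_calc V (\<lambda>i. d i powr s) ** fun_calc V (\<lambda>i. d i powr (- s)) = mat 1" for s
    using d by (simp add: fun_calc_mult[OF V] powr_add[symmetric] less_imp_neq[THEN not_sym] fun_calc_one[OF V])
  from this[of "l/2"] this[of "- (l/2)"] show thesis
    using that aluthge_eq[OF V d T, of l] by simp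
qed

lemma det_aluthge: "invertible T \<Longrightarrow> det (aluthge l T - mat c) = det (T - mat c)" for T :: "'n::finite cmat"
  by (metis aluthge_similar eigenvalues_similar)

lemma mat_0 [simp]: "mat 0 = 0"
  by (simp add: vec_eq_iff mat_def)

lemma invertible_aluthge: "invertible T \<Longrightarrow> invertible (aluthge l T)" for T :: "'n::finite cmat"
  using det_aluthge[of T l 0] by (simp add: invertible_det_nz)

lemma aluthge_iter_Suc: "aluthge_iter l (Suc n) T = aluthge l (aluthge_iter l n T)"
  by (simp add: aluthge_iter_def)

lemma invertible_aluthge_iter: "invertible T \<Longrightarrow> invertible (aluthge_iter l n T)" for T :: "'n::finite cmat"
  by (induction n) (simp_all add: aluthge_iter_Suc invertible_aluthge aluthge_iter_def[of l 0])

lemma det_aluthge_iter: "invertible T \<Longrightarrow> det (aluthge_iter l n T - mat c)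
    = det (T - mat c)" for T :: "'n::finite cmat"
  by (induction n) (simp_all add: aluthge_iter_Suc det_aluthge invertible_aluthge_iter aluthge_iter_def[of l 0])

lemma continuous_det: "continuous_on UNIV (det :: 'n::finite cmat \<Rightarrow> complex)"
  unfolding det_def by (intro continuous_intros)

text \<open>The norms along the orbit decrease to some \<open>L\<close>. A limit point
  \<open>N\<close> has norm \<open>L\<close>, and by continuity so has its transform, so the
  equality case of \<open>norm_aluthge\<close> makes \<open>N\<close> normal. The determinants
  \<open>det (X n - mat c)\<close> do not depend on \<open>n\<close>, so \<open>N\<close> keeps the
  eigenvalues of \<open>T\<close>.\<close>

lemma aluthge_iter_limit_point:
  fixes T :: "'n::finite cmat"
  assumes inv: "invertible T" and l: "0 < l" "l < 1"
    and cont: "\<And>N :: 'n cmat. invertible N \<Longrightarrow> isCont (aluthge l) N"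
  obtains N r where "strict_mono r" "(\<lambda>k. aluthge_iter l (r k) T) \<longlonglongrightarrow> N" "normal_matrix N" "invertible N"
    "eigenvalues N = eigenvalues T"
proof -
  define X where "X n = aluthge_iter l n T" for n
  have invX: "invertible (X n)" for n unfolding X_def by (rule invertible_aluthge_iter[OF inv])
  have decr: "norm (X (Suc n)) \<le> norm (X n)" for n
    unfolding X_def aluthge_iter_Suc using norm_aluthge(1)[OF invX l] by (simp add: X_def)
  then have dec: "decseq (\<lambda>n. norm (X n))" by (simp add: decseq_Suc_iff)
  have bnd: "norm (X n) \<le> norm (X 0)" for n using decseqD[OF dec, of 0 n] by simp
  obtain L where L: "(\<lambda>n. norm (X n)) \<longlonglongrightarrow> L"
    using decseq_convergent[OF dec, of 0] by auto
  have "bounded (range X)" using bnd by (auto simp: bounded_iff)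
  then obtain N r where r: "strict_mono r" "(X \<circ> r) \<longlonglongrightarrow> N"
    using bounded_imp_convergent_subsequence by blast
  have rl: "(\<lambda>k. X (r k)) \<longlonglongrightarrow> N" using r(2) by (simp add: o_def)
  have detN: "det (N - mat c) = det (T - mat c)" for c
  proof (rule LIMSEQ_unique)
    show "(\<lambda>k. det (X (r k) - mat c)) \<longlonglongrightarrow> det (N - mat c)"
      by (rule continuous_on_tendsto_compose[OF continuous_det]) (auto intro!: tendsto_intros rl)
    show "(\<lambda>k. det (X (r k) - mat c)) \<longlonglongrightarrow> det (T - mat c)"
      by (simp add: X_def det_aluthge_iter[OF inv])
  qed
  then have invN: "invertible N" using inv detN[of 0] by (simp add: invertible_det_nz)
  have eig: "eigenvalues N = eigenvalues T"
    using detN by (auto simp: eigenvalues_iff_det)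
  have nN: "norm N = L"
    using LIMSEQ_unique[OF tendsto_norm[OF rl] LIMSEQ_subseq_LIMSEQ[OF L r(1), unfolded o_def]] .
  have "(\<lambda>k. norm (aluthge l (X (r k)))) \<longlonglongrightarrow> norm (aluthge l N)"
    by (intro tendsto_norm isCont_tendsto_compose[OF cont[OF invN]] rl)
  moreover have "(\<lambda>k. norm (aluthge l (X (r k)))) = (\<lambda>k. norm (X (Suc (r k))))"
    by (simp add: X_def aluthge_iter_Suc)
  moreover have "(\<lambda>k. norm (X (Suc (r k)))) \<longlonglongrightarrow> L"
    using LIMSEQ_subseq_LIMSEQ[OF LIMSEQ_Suc[OF L] r(1)] by (simp add: o_def)
  ultimately have "norm (aluthge l N) = norm N" using nN LIMSEQ_unique by metis
  then have "normal_matrix N" using norm_aluthge(2)[OF invN l] by blast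
  then show thesis using that r(1) rl invN eig by (simp add: X_def)
qed

text \<open>For normal \<open>N\<close> the vectors \<open>cadjoint N *v v - cnj c *s v\<close> and
  \<open>N *v v - c *s v\<close> have the same length.\<close>

lemma normal_matrix_eigen_cadjoint:
  assumes N: "normal_matrix N" and v: "N *v v = c *s v"
  shows "cadjoint N *v v = cnj c *s v"
proof -
  have "hip (cadjoint N *v v - cnj c *s v) (cadjoint N *v v - cnj c *s v) = 0"
  proof -
    have sub: "hip x (y - z) = hip x y - hip x z" "hip (y - z) x = hip y x - hip z x" for x y z
      by (simp_all add: hip_def right_diff_distrib left_diff_distrib sum_subtractf)
    have 1: "hip (cadjoint N *v v) (cadjoint N *v v) = hip (N *v v) (N *v v)"
    proof -
      have "hip (cadjoint N *v v) (cadjoint N *v v) = hip (N *v (cadjoint N *v v)) v"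
        using hip_matrix[of "cadjoint N *v v" "cadjoint N" v] by simp
      also have "\<dots> = hip (cadjoint N *v (N *v v)) v"
        using N by (simp add: matrix_vector_mul_assoc normal_matrix_def)
      also have "\<dots> = hip (N *v v) (N *v v)" using hip_matrix[of "N *v v" N v] by simp
      finally show ?thesis .
    qed
    have 2: "hip v (cadjoint N *v v) = hip (N *v v) v" using hip_matrix[of v "cadjoint N" v] by simp
    have 3: "hip (cadjoint N *v v) v = hip v (N *v v)" using hip_matrix[of v N v] by simp
    show ?thesis
      unfolding sub hip_scale_left hip_scale_right 1 2 3 v
          by (simp add: hip_scale_left hip_scale_right algebra_simps)
  qed
  then show ?thesis by (simp add: hip_self)
qed

text \<open>A simple spectrum provides one unit eigenvector per index. Eigenvectors for different
  eigenvalues are orthogonal, since each is also an eigenvector of the adjoint for the conjugate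
  eigenvalue.\<close>

lemma normal_matrix_diagonalization:
  fixes N :: "'n::finite cmat"
  assumes N: "normal_matrix N" and card: "card (eigenvalues N) = CARD('n)"
  obtains V d where "unitary_matrix V" "inj d" "N = V ** diag_matrix d ** cadjoint V"
proof -
  have "finite (eigenvalues N)" using card card_ge_0_finite[of "eigenvalues N"] by simp
  then obtain d :: "'n \<Rightarrow> complex" where d: "bij_betw d UNIV (eigenvalues N)"
    using card finite_same_card_bij[of "UNIV :: 'n set" "eigenvalues N"] by auto
  have "\<exists>v. norm v = 1 \<and> N *v v = d i *s v" for i
  proof -
    have "d i \<in> eigenvalues N" using d bij_betwE by blast
    then obtain v where v: "v \<noteq> 0" "N *v v = d i *s v" unfolding eigenvalues_def by blast
    have "N *v ((1 / norm v) *\<^sub>R v) = (1 / norm v) *\<^sub>R (N *v v)"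
      by (rule linear_scale[OF matrix_vector_mul_linear])
    also have "\<dots> = d i *s ((1 / norm v) *\<^sub>R v)"
      unfolding v(2) by (simp add: vec_eq_iff)
    finally show ?thesis using v(1) by (intro exI[of _ "(1 / norm v) *\<^sub>R v"]) simp
  qed
  then obtain f where f: "\<And>i. norm (f i) = 1" "\<And>i. N *v f i = d i *s f i" by metis
  have inj: "inj d" using d bij_betw_imp_inj_on by blast
  have orth: "hip (f i) (f j) = (if i = j then 1 else 0)" for i j
  proof (cases "i = j")
    case True then show ?thesis using f(1) by (simp add: hip_self[of "f j"])
  next
    case False
    have "d j * hip (f i) (f j) = hip (cadjoint N *v f i) (f j)"
      using hip_matrix[of "f i" N "f j"] by (simp add: f(2) hip_scale_right)
    also have "\<dots> = d i * hip (f i) (f j)"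
      unfolding normal_matrix_eigen_cadjoint[OF N f(2)] by (simp add: hip_scale_left)
    finally have "hip (f i) (f j) = 0" using False inj by (auto simp: inj_def)
    then show ?thesis using False by simp
  qed
  let ?V = "matrix_of_columns f"
  have V: "unitary_matrix ?V" by (rule matrix_of_columns_unitary[OF orth])
  have "N = (N ** ?V) ** cadjoint ?V"
    by (simp add: matrix_mul_assoc[symmetric] unitary_matrixD[OF V])
  then have "N = ?V ** diag_matrix d ** cadjoint ?V"
    using matrix_of_columns_eigen[of N f d, OF f(2)] by simp
  then show thesis using that V inj by blast
qed

section \<open>Holomorphic limits of iterations\<close>

lemma geometric_uniform_limit:
  fixes f :: "nat \<Rightarrow> 'a \<Rightarrow> 'b::banach"
  assumes "\<And>n x. x \<in> S \<Longrightarrow> norm (f (Suc n) x - f n x) \<le> C * q ^ n" "0 \<le> q" "q < 1"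
  obtains g where "uniform_limit S f g sequentially"
proof -
  have "uniform_limit S (\<lambda>n x. \<Sum>k<n. f (Suc k) x - f k x) (\<lambda>x. \<Sum>k. f (Suc k) x - f k x) sequentially"
    by (rule Weierstrass_m_test[where M = "\<lambda>k. C * q ^ k"])
       (use assms in \<open>auto intro: summable_mult summable_geometric\<close>)
  then have "uniform_limit S (\<lambda>n x. f 0 x + (\<Sum>k<n. f (Suc k) x - f k x)) (\<lambda>x. f 0 x
      + (\<Sum>k. f (Suc k) x - f k x)) sequentially"
    by (intro uniform_limit_add uniform_limit_const)
  moreover have "f 0 x + (\<Sum>k<n. f (Suc k) x - f k x) = f n x" for n x
    using sum_lessThan_telescope[of "\<lambda>k. f k x" n] by simp
  ultimately show thesis using that by simp
qed

text \<open>Uniqueness of derivatives on a line where \<open>f\<close> is affine. Derivatives are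
  found below by evaluating maps exactly along such lines.\<close>

lemma fderiv_along_line:
  fixes f :: "'a::real_normed_vector \<Rightarrow> 'b::real_normed_vector"
  assumes f: "(f has_derivative D) (at x)" and line: "\<And>t. f (x + t *\<^sub>R v) = f x + t *\<^sub>R w"
  shows "D v = w"
proof -
  have "((\<lambda>t::real. x + t *\<^sub>R v) has_derivative (\<lambda>h. h *\<^sub>R v)) (at 0)"
    by (auto intro!: derivative_eq_intros)
  from has_derivative_compose[OF this, of f D] f
  have "((\<lambda>t. f (x + t *\<^sub>R v)) has_derivative (\<lambda>h. D (h *\<^sub>R v))) (at 0)" by simp
  then have 1: "((\<lambda>t. f x + t *\<^sub>R w) has_derivative (\<lambda>h. D (h *\<^sub>R v))) (at (0::real))"
    unfolding line .
  have 2: "((\<lambda>t. f x + t *\<^sub>R w) has_derivative (\<lambda>h. h *\<^sub>R w)) (at (0::real))"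
    by (auto intro!: derivative_eq_intros)
  have "(\<lambda>h. D (h *\<^sub>R v)) = (\<lambda>h::real. h *\<^sub>R w)" by (rule has_derivative_unique[OF 1 2])
  then have "D (1 *\<^sub>R v) = 1 *\<^sub>R w" by (rule fun_cong)
  then show ?thesis by simp
qed

lemma dist_Pair_le: "dist (a, b) (a', b') \<le> dist a a' + dist b b'"
  unfolding dist_Pair_Pair by (rule sqrt_sum_squares_le_sum) auto

text \<open>The parameter \<open>h p\<close> stays fixed while \<open>Z n p\<close> is iterated, so
  each \<open>Z n\<close> is holomorphic by induction; the geometric bound on the steps gives
  uniform convergence on \<open>B\<close>.\<close>

lemma hol_iterate_limit:
  fixes F :: "'a::cvec \<times> 'b::cvec \<Rightarrow> 'b" and h :: "'c::cvec \<Rightarrow> 'a"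
  assumes F: "hol_on S F" and B: "open B" and h: "hol_on B h" and Z0: "hol_on B (Z 0)"
    and Z: "\<And>n. Z (Suc n) = (\<lambda>p. F (h p, Z n p))" and dom: "\<And>n p. p \<in> B \<Longrightarrow> (h p, Z n p) \<in> S"
    and step: "\<And>n p. p \<in> B \<Longrightarrow> norm (Z (Suc n) p - Z n p) \<le> C * q ^ n" and q: "0 \<le> q" "q < 1"
  obtains G where "hol_on B G" "\<And>p. p \<in> B \<Longrightarrow> (\<lambda>n. Z n p) \<longlonglongrightarrow> G p"
proof -
  have "hol_on B (Z n)" for n
  proof (induction n)
    case (Suc n)
    then show ?case
      unfolding Z by (rule hol_compose[OF hol_Pair[OF h] F]) (rule dom)
  qed (rule Z0)
  moreover obtain G where G: "uniform_limit B Z G sequentially"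
    by (rule geometric_uniform_limit[of B Z C q]) (use step q in auto)
  ultimately have "hol_on B G" by (rule hol_uniform_limit[OF _ B])
  then show thesis using that tendsto_uniform_limitI[OF G] by blast
qed

text \<open>A holomorphic implicit function theorem in fixed-point form. The partial derivative in
  the second argument vanishes at the base point, so nearby \<open>\<Psi>\<close> contracts that
  argument by 1/2, and Picard iteration from the constant \<open>y0\<close> converges uniformly in
  the parameter.\<close>

lemma hol_fixed_point:
  fixes \<Psi> :: "'a::cvec \<times> 'b::cvec \<Rightarrow> 'b"
  assumes hol: "hol_on S \<Psi>" and S: "open S" "(a0, y0) \<in> S" and fix0: "\<Psi> (a0, y0) = y0"
    and der: "\<And>w. fderiv \<Psi> (a0, y0) (0, w) = 0"
  obtains r y where "r > 0" "hol_on (ball a0 r) y" "y a0 = y0"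
    "\<And>a. a \<in> ball a0 r \<Longrightarrow> \<Psi> (a, y a) = y a"
proof -
  obtain \<delta> where \<delta>: "\<delta> > 0" "ball (a0, y0) \<delta> \<subseteq> S" and
    strict: "\<And>p q. p \<in> ball (a0, y0) \<delta> \<Longrightarrow> q \<in> ball (a0, y0) \<delta> \<Longrightarrow>
      norm (\<Psi> p - \<Psi> q - fderiv \<Psi> (a0, y0) (p - q)) \<le> (1/2) * norm (p - q)"
    using hol_strict_derivative[OF hol S, of "1/2"] by (metis half_gt_zero zero_less_one)
  have lip: "norm (\<Psi> (a, y) - \<Psi> (a, y')) \<le> (1/2) * norm (y - y')"
    if "(a, y) \<in> ball (a0, y0) \<delta>" "(a, y') \<in> ball (a0, y0) \<delta>" for a y y'
    using strict[OF that] der by (simp add: norm_Pair)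
  have "isCont \<Psi> (a0, y0)" by (rule hol_fderiv(4)[OF hol S(2)])
  then obtain r1 where r1: "r1 > 0" "\<And>p. dist p (a0, y0) < r1 \<Longrightarrow> dist (\<Psi> p) (\<Psi> (a0, y0)) < \<delta> / 8"
    using \<delta>(1) unfolding continuous_at_eps_delta by (metis divide_pos_pos zero_less_numeral)
  define r where "r = min r1 (\<delta> / 4)"
  have r: "r > 0" "r \<le> r1" "r \<le> \<delta> / 4" using r1 \<delta> by (auto simp: r_def)
  have start: "norm (\<Psi> (a, y0) - y0) \<le> \<delta> / 8" if "a \<in> ball a0 r" for a
    using r1(2)[of "(a, y0)"] that r fix0 by (simp add: dist_Pair_Pair dist_norm norm_minus_commute)
  have dom: "(a, y) \<in> ball (a0, y0) \<delta>" if "a \<in> ball a0 r" "norm (y - y0) \<le> \<delta> / 2" for a y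
    using dist_Pair_le[of a0 y0 a y] that r \<delta>(1) by (simp add: dist_norm norm_minus_commute)
  define Y where "Y n a = ((\<lambda>y. \<Psi> (a, y)) ^^ n) y0" for n a
  have Y0: "Y 0 a = y0" and YS: "Y (Suc n) a = \<Psi> (a, Y n a)" for n a by (simp_all add: Y_def)
  \<comment> \<open>The first step has length at most \<open>\<delta> / 8\<close> and each next one
    at most half of the previous bound; so the iterates stay within \<open>\<delta> / 4\<close> of
    \<open>y0\<close>, where the contraction holds.\<close>
  have bounds: "norm (Y (Suc n) a - Y n a) \<le> \<delta> / 8 * (1/2) ^ n \<and> norm (Y (Suc n) a - y0)
      \<le> \<delta> / 4 * (1 - (1/2) ^ Suc n)
      \<and> norm (Y n a - y0) \<le> \<delta> / 4"
    if a: "a \<in> ball a0 r" for n a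
  proof (induction n)
    case 0
    then show ?case using start[OF a] \<delta>(1) by (simp add: Y0 YS)
  next
    case (Suc n)
    have "\<delta> / 4 * (1 - (1/2) ^ Suc n) \<le> \<delta> / 4 * 1"
      using \<delta>(1) by (intro mult_left_mono) auto
    then have n1: "norm (Y (Suc n) a - y0) \<le> \<delta> / 4" using Suc by linarith
    have "norm (Y (Suc (Suc n)) a - Y (Suc n) a) \<le> (1/2) * norm (Y (Suc n) a - Y n a)"
      unfolding YS[of "Suc n"] YS[of n] using Suc n1 \<delta>(1) unfolding YS[of n]
      by (intro lip dom[OF a]) auto
    also have "\<dots> \<le> (1/2) * (\<delta> / 8 * (1/2) ^ n)" using Suc by (intro mult_left_mono) auto
    finally have n2: "norm (Y (Suc (Suc n)) a - Y (Suc n) a) \<le> \<delta> / 8 * (1/2) ^ Suc n" by simp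
    have "norm (Y (Suc (Suc n)) a - y0) \<le> norm (Y (Suc (Suc n)) a - Y (Suc n) a) + norm (Y (Suc n) a - y0)"
      using norm_triangle_ineq[of "Y (Suc (Suc n)) a - Y (Suc n) a" "Y (Suc n) a - y0"] by simp
    also have "\<dots> \<le> \<delta> / 8 * (1/2) ^ Suc n + \<delta> / 4 * (1 - (1/2) ^ Suc n)" using n2 Suc by linarith
    also have "\<dots> = \<delta> / 4 * (1 - (1/2) ^ Suc (Suc n))" by (simp add: algebra_simps)
    finally show ?case using n1 n2 by blast
  qed
  have domY: "(a, Y n a) \<in> ball (a0, y0) \<delta>" if "a \<in> ball a0 r" for n a
    using bounds[OF that, of n] \<delta>(1) by (intro dom that) auto
  obtain y where y: "hol_on (ball a0 r) y" and ylim: "\<And>a. a \<in> ball a0 r \<Longrightarrow> (\<lambda>n. Y n a) \<longlonglongrightarrow> y a"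
  proof (rule hol_iterate_limit[where Z = Y and B = "ball a0 r" and C = "\<delta> / 8" and q
      = "1/2", OF hol open_ball hol_ident])
    show "hol_on (ball a0 r) (Y 0)" "Y (Suc n) = (\<lambda>a. \<Psi> (a, Y n a))" for n
      by (simp_all add: Y_def[abs_def])
  qed (use domY \<delta>(2) bounds in auto)
  show thesis
  proof (rule that[OF r(1) y])
    have "Y n a0 = y0" for n by (induction n) (simp_all add: Y0 YS fix0)
    then have "(\<lambda>n. y0) \<longlonglongrightarrow> y a0" using ylim[of a0] r(1) by simp
    then show "y a0 = y0" by (metis LIMSEQ_unique tendsto_const)
    fix a assume a: "a \<in> ball a0 r"
    have "norm (y a - y0) \<le> \<delta> / 4"
      by (rule Lim_norm_ubound[OF _ tendsto_diff[OF ylim[OF a] tendsto_const]]) (use bounds[OF a] in auto)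
    then have ya: "(a, y a) \<in> ball (a0, y0) \<delta>" using \<delta>(1) by (intro dom a) auto
    then have "isCont \<Psi> (a, y a)" using \<delta>(2) hol_fderiv(4)[OF hol] by blast
    then have "(\<lambda>n. \<Psi> (a, Y n a)) \<longlonglongrightarrow> \<Psi> (a, y a)"
      by (rule isCont_tendsto_compose) (intro tendsto_intros ylim a)
    moreover have "(\<lambda>n. \<Psi> (a, Y n a)) \<longlonglongrightarrow> y a"
      using LIMSEQ_Suc[OF ylim[OF a]] by (simp add: YS)
    ultimately show "\<Psi> (a, y a) = y a" by (rule LIMSEQ_unique)
  qed
qed

text \<open>The component \<open>off z\<close> transversal to the linear manifold of fixed points shrinks geometrically,
  and it bounds the step \<open>F z - z\<close>; hence the iterates converge geometrically.\<close>

lemma attracting_fixed_points: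
  fixes F :: "'a::cvec \<times> 'b::cvec \<Rightarrow> 'b" and off :: "'b \<Rightarrow> 'b"
  assumes hol: "hol_on S F" and S: "open S" "(\<theta>0, z0) \<in> S"
    and off: "bounded_linear off" "\<And>z. norm (off z) \<le> norm z" "\<And>z. off (off z) = off z" "off z0 = 0"
    and fixed: "\<And>\<theta> z. (\<theta>, z) \<in> S \<Longrightarrow> off z = 0 \<Longrightarrow> F (\<theta>, z) = z"
    and der: "\<And>z. norm (off (fderiv F (\<theta>0, z0) (0, off z))) \<le> q * norm (off z)" and q: "0 \<le> q" "q < 1"
  obtains r G where "r > 0" "hol_on (ball (\<theta>0, z0) r) G"
    "\<And>\<theta> z n. (\<theta>, z) \<in> ball (\<theta>0, z0) r \<Longrightarrow> (\<theta>, ((\<lambda>z. F (\<theta>, z)) ^^ n) z) \<in> S"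
    "\<And>\<theta> z. (\<theta>, z) \<in> ball (\<theta>0, z0) r \<Longrightarrow> (\<lambda>n. ((\<lambda>z. F (\<theta>, z)) ^^ n) z) \<longlonglongrightarrow> G (\<theta>, z)"
proof -
  interpret off: bounded_linear off by fact
  \<comment> \<open>Half of the gap between \<open>q\<close> and 1, so that the factor
    \<open>q' = q + e\<close> stays below 1.\<close>
  define e where "e = (1 - q) / 2"
  have e: "e > 0" using q by (simp add: e_def)
  obtain \<delta> where \<delta>: "\<delta> > 0" "ball (\<theta>0, z0) \<delta> \<subseteq> S" and
    strict: "\<And>p p'. p \<in> ball (\<theta>0, z0) \<delta> \<Longrightarrow> p' \<in> ball (\<theta>0, z0) \<delta> \<Longrightarrow>
      norm (F p - F p' - fderiv F (\<theta>0, z0) (p - p')) \<le> e * norm (p - p')"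
    using hol_strict_derivative[OF hol S e] by metis
  have bl: "bounded_linear (fderiv F (\<theta>0, z0))"
    using hol_fderiv(2)[OF hol S(2)] has_derivative_bounded_linear by blast
  obtain C where C: "C > 0" "\<And>v. norm (fderiv F (\<theta>0, z0) v) \<le> norm v * C"
    using bounded_linear.pos_bounded[OF bl] by blast
  define q' where "q' = q + e"
  have q': "0 \<le> q'" "q' < 1" using q by (auto simp: q'_def e_def field_simps)
  define M where "M = 1 + C + e"
  have M: "M > 0" using C e by (simp add: M_def)
  have step: "norm (off (F (\<theta>, z))) \<le> q' * norm (off z)" "norm (F (\<theta>, z) - z) \<le> M * norm (off z)"
    if "norm (\<theta> - \<theta>0) < \<delta> / 4" "norm (z - z0) < \<delta> / 4" for \<theta> z
  proof -
    \<comment> \<open>The point \<open>z - off z\<close> is the fixed point with which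
      \<open>z\<close> is compared. By strict differentiability \<open>F (\<theta>, z)\<close>
      differs from it by the derivative in direction \<open>off z\<close>, up to
      \<open>e * norm (off z)\<close>, for every parameter \<open>\<theta>\<close> nearby.\<close>
    have "norm ((z - off z) - z0) = norm ((z - z0) - off (z - z0))"
      using off(4) by (simp add: off.diff algebra_simps)
    also have "\<dots> \<le> norm (z - z0) + norm (off (z - z0))" by (rule norm_triangle_ineq4)
    also have "\<dots> < \<delta> / 2" using off(2)[of "z - z0"] that by linarith
    finally have 1: "(\<theta>, z - off z) \<in> ball (\<theta>0, z0) \<delta>"
      using dist_Pair_le[of \<theta>0 z0 \<theta> "z - off z"] that \<delta>(1) by (simp add: dist_norm norm_minus_commute)
    have 2: "(\<theta>, z) \<in> ball (\<theta>0, z0) \<delta>"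
      using dist_Pair_le[of \<theta>0 z0 \<theta> z] that \<delta>(1) by (simp add: dist_norm norm_minus_commute)
    have Fz: "F (\<theta>, z - off z) = z - off z"
      using 1 \<delta>(2) off(3) by (intro fixed) (auto simp: off.diff)
    define D where "D = fderiv F (\<theta>0, z0) (0, off z)"
    have err: "norm (F (\<theta>, z) - (z - off z) - D) \<le> e * norm (off z)"
      using strict[OF 2 1] by (simp add: Fz D_def norm_Pair)
    have "off (F (\<theta>, z)) = off (F (\<theta>, z) - (z - off z) - D) + off D"
      by (simp add: off.diff off(3))
    then have "norm (off (F (\<theta>, z))) \<le> norm (F (\<theta>, z) - (z - off z) - D) + norm (off D)"
      using norm_triangle_ineq off(2) by (metis add_right_mono order_trans)
    then show "norm (off (F (\<theta>, z))) \<le> q' * norm (off z)"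
      using err der[of z] by (simp add: D_def q'_def distrib_right)
    have "F (\<theta>, z) - z = (F (\<theta>, z) - (z - off z) - D) + (D - off z)" by simp
    then have "norm (F (\<theta>, z) - z) \<le> norm (F (\<theta>, z) - (z - off z) - D) + norm (D - off z)"
      by (metis norm_triangle_ineq)
    also have "norm (D - off z) \<le> norm D + norm (off z)" by (rule norm_triangle_ineq4)
    also have "norm D \<le> norm (off z) * C" using C(2)[of "(0, off z)"] by (simp add: D_def norm_Pair)
    finally show "norm (F (\<theta>, z) - z) \<le> M * norm (off z)"
      using err by (simp add: M_def algebra_simps)
  qed
  \<comment> \<open>The second bound confines the orbit: its steps sum to at most
    \<open>M * r / (1 - q') \<le> \<delta> / 8\<close>, so together with the initial distance it
    stays within \<open>\<delta> / 4\<close> of \<open>z0\<close>.\<close>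
  define r where "r = min (\<delta> / 8) (\<delta> / 8 * ((1 - q') / M))"
  have r: "r > 0" "r \<le> \<delta> / 8" using \<delta>(1) M q' by (auto simp: r_def)
  have "r \<le> \<delta> / 8 * ((1 - q') / M)" by (simp add: r_def)
  then have rM: "M * r / (1 - q') \<le> \<delta> / 8" using M q' by (simp add: field_simps)
  define Z where "Z n p = ((\<lambda>z. F (fst p, z)) ^^ n) (snd p)" for n p
  have Z0: "Z 0 p = snd p" and ZS: "Z (Suc n) p = F (fst p, Z n p)" for n p by (simp_all add: Z_def)
  have bounds: "norm (off (Z n p)) \<le> q' ^ n * r \<and> norm (Z n p - snd p) \<le> M * r * (\<Sum>k<n. q' ^ k)
      \<and> norm (fst p - \<theta>0) < \<delta> / 4 \<and> norm (Z n p - z0) < \<delta> / 4"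
    if p: "p \<in> ball (\<theta>0, z0) r" for n p
  proof -
    have p1: "norm (fst p - \<theta>0) < r" and p2: "norm (snd p - z0) < r"
      using p dist_fst_le[of "(\<theta>0, z0)" p] dist_snd_le[of "(\<theta>0, z0)" p]
      by (auto simp: dist_norm norm_minus_commute)
    have near: "norm (z - z0) < \<delta> / 4" if "norm (z - snd p) \<le> M * r * (\<Sum>k<n. q' ^ k)" for z n
    proof -
      have "(\<Sum>k<n. q' ^ k) \<le> 1 / (1 - q')"
        using sum_le_suminf[of "\<lambda>k. q' ^ k" "{..<n}"] q' by (simp add: suminf_geometric summable_geometric)
      then have "M * r * (\<Sum>k<n. q' ^ k) \<le> M * r * (1 / (1 - q'))"
        using M r by (intro mult_left_mono) auto
      also have "\<dots> = M * r / (1 - q')" by simp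
      finally have "norm (z - snd p) \<le> \<delta> / 8" using that rM by linarith
      then show ?thesis
        using norm_triangle_ineq[of "z - snd p" "snd p - z0"] p2 r by simp
    qed
    show ?thesis
    proof (induction n)
      case 0
      have "norm (off (snd p)) \<le> norm (snd p - z0)" using off(2)[of "snd p - z0"] off(4) by (simp add: off.diff)
      then show ?case using p1 p2 r by (simp add: Z0)
    next
      case (Suc n)
      have st: "norm (off (Z (Suc n) p)) \<le> q' * norm (off (Z n p))"
        "norm (Z (Suc n) p - Z n p) \<le> M * norm (off (Z n p))"
        unfolding ZS using Suc by (auto intro: step)
      have a: "norm (off (Z (Suc n) p)) \<le> q' ^ Suc n * r"
        using order_trans[OF st(1) mult_left_mono[OF _ q'(1)]] Suc by (simp add: mult.assoc)
      have "norm (Z (Suc n) p - snd p) \<le> norm (Z (Suc n) p - Z n p) + norm (Z n p - snd p)"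
        using norm_triangle_ineq[of "Z (Suc n) p - Z n p" "Z n p - snd p"] by simp
      also have "\<dots> \<le> M * (q' ^ n * r) + M * r * (\<Sum>k<n. q' ^ k)"
        using Suc M by (intro add_mono order_trans[OF st(2)] mult_left_mono) auto
      also have "\<dots> = M * r * (\<Sum>k<Suc n. q' ^ k)" by (simp add: algebra_simps)
      finally have b: "norm (Z (Suc n) p - snd p) \<le> M * r * (\<Sum>k<Suc n. q' ^ k)" .
      show ?case using a b near[OF b] Suc by blast
    qed
  qed
  have domZ: "(fst p, Z n p) \<in> S" if "p \<in> ball (\<theta>0, z0) r" for n p
    using dist_Pair_le[of \<theta>0 z0 "fst p" "Z n p"] bounds[OF that, of n] \<delta>
    by (intro subsetD[OF \<delta>(2)]) (simp add: dist_norm norm_minus_commute)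
  obtain G where G: "hol_on (ball (\<theta>0, z0) r) G"
    and lim: "\<And>p. p \<in> ball (\<theta>0, z0) r \<Longrightarrow> (\<lambda>n. Z n p) \<longlonglongrightarrow> G p"
  proof (rule hol_iterate_limit[where Z = Z and B = "ball (\<theta>0, z0) r" and C = "M * r" and q = q',
        OF hol open_ball hol_fst[OF hol_ident]])
    show "hol_on (ball (\<theta>0, z0) r) (Z 0)" "Z (Suc n) = (\<lambda>p. F (fst p, Z n p))" for n
      by (simp_all add: Z_def[abs_def] hol_snd)
    fix n p assume p: "p \<in> ball (\<theta>0, z0) r"
    show "(fst p, Z n p) \<in> S" by (rule domZ[OF p])
    have "norm (Z (Suc n) p - Z n p) \<le> M * norm (off (Z n p))"
      unfolding ZS using bounds[OF p, of n] by (intro step) auto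
    also have "\<dots> \<le> M * (q' ^ n * r)" using bounds[OF p, of n] M by (intro mult_left_mono) auto
    finally show "norm (Z (Suc n) p - Z n p) \<le> M * r * q' ^ n" by (simp add: mult_ac)
  qed (use q' in auto)
  show thesis
  proof (rule that[OF r(1) G])
    fix \<theta> z assume p: "(\<theta>, z) \<in> ball (\<theta>0, z0) r"
    show "(\<theta>, ((\<lambda>z. F (\<theta>, z)) ^^ n) z) \<in> S" for n using domZ[OF p, of n] by (simp add: Z_def)
    show "(\<lambda>n. ((\<lambda>z. F (\<theta>, z)) ^^ n) z) \<longlonglongrightarrow> G (\<theta>, z)"
      using lim[OF p] by (simp add: Z_def)
  qed
qed

section \<open>Eigenvector frames\<close>

definition dvec :: "complex ^ 'n \<Rightarrow> 'n::finite cmat" where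
  "dvec v = diag_matrix (\<lambda>i. v $ i)"

lemma dvec_nth [simp]: "dvec v $ i $ j = (if i = j then v $ i else 0)"
  by (simp add: dvec_def)

lemma hol_dvec: 
  assumes "hol_on S f" shows "hol_on S (\<lambda>x. dvec (f x))"
proof (intro hol_vec)
  fix i j
  show "hol_on S (\<lambda>x. dvec (f x) $ i $ j)"
    using assms by (cases "i = j") (auto intro: hol_nth)
qed

text \<open>The frame is normalised by ones on the diagonal, \<open>P = 1 + Y\<close>, because
  normalising lengths would not be holomorphic. With \<open>B = A - dvec d0\<close>, the diagonal of
  \<open>A ** P = P ** dvec e\<close> gives \<open>e = d0 + L\<close>, and the entry
  \<open>(i, j)\<close> gives \<open>(d0 i - d0 j) Y i j = Y i j L j - B i j - (B Y) i j\<close>.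
  Division by the differences of the distinct entries of \<open>d0\<close> makes this a fixed-point
  equation for \<open>Y\<close>.\<close>

lemma local_eigenframe_diag:
  fixes d0 :: "complex ^ 'n::finite"
  assumes inj: "inj (($) d0)"
  obtains r P Q e where "r > 0" "hol_on (ball (dvec d0) r) P" "hol_on (ball (dvec d0) r) Q"
      "hol_on (ball (dvec d0) r) e"
    "P (dvec d0) = mat 1" "e (dvec d0) = d0"
    "\<And>A. A \<in> ball (dvec d0) r \<Longrightarrow> P A ** Q A = mat 1 \<and> Q A ** P A = mat 1 \<and> A = P A ** dvec (e A) ** Q A"
proof -
  define L where "L p = (\<chi> j. (fst p - dvec d0) $ j $ j + ((fst p - dvec d0) ** snd p) $ j $ j)"
    for p :: "'n cmat \<times> 'n cmat"
  define \<Psi> where "\<Psi> p = (\<chi> i j. (if i = j then 0 else 1 / (d0 $ i - d0 $ j)) *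
      (snd p $ i $ j * L p $ j - (fst p - dvec d0) $ i $ j - ((fst p - dvec d0) ** snd p) $ i $ j))"
    for p :: "'n cmat \<times> 'n cmat"
  have base: "hol_on UNIV (\<lambda>p :: 'n cmat \<times> 'n cmat. fst p - dvec d0)"
    "hol_on UNIV (\<lambda>p :: 'n cmat \<times> 'n cmat. snd p)"
    by (intro hol_diff hol_fst hol_snd hol_ident hol_const)+
  note prod = hol_matrix_mult[OF base]
  have holL: "hol_on UNIV L"
  proof (rule hol_vec)
    show "hol_on UNIV (\<lambda>p. L p $ j)" for j
      unfolding L_def vec_lambda_beta by (rule hol_add[OF hol_nth[OF hol_nth[OF base(1)]] hol_nth[OF hol_nth[OF
          prod]]])
  qed
  have hol\<Psi>: "hol_on UNIV \<Psi>"
  proof (rule hol_vec, rule hol_vec)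
    show "hol_on UNIV (\<lambda>p. \<Psi> p $ i $ j)" for i j
      unfolding \<Psi>_def vec_lambda_beta
      by (rule hol_mult[OF hol_const hol_diff[OF hol_diff[OF hol_mult[OF hol_nth[OF hol_nth[OF base(2)]]
          hol_nth[OF holL]]
              hol_nth[OF hol_nth[OF base(1)]]] hol_nth[OF hol_nth[OF prod]]]])
  qed
  \<comment> \<open>At the base matrix \<open>B = 0\<close>, so the right side vanishes for every
    \<open>Y\<close>; hence the derivative in \<open>Y\<close> is zero, as
    \<open>hol_fixed_point\<close> requires.\<close>
  have zero: "\<Psi> (dvec d0, Y) = 0" for Y
    by (simp add: \<Psi>_def L_def vec_eq_iff)
  have "fderiv \<Psi> (dvec d0, 0) (0, w) = 0" for w
    by (rule fderiv_along_line[OF hol_fderiv(2)[OF hol\<Psi>]]) (simp_all add: zero)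
  from hol_fixed_point[OF hol\<Psi> open_UNIV UNIV_I zero this]
  obtain r1 Y where r1: "r1 > 0" "hol_on (ball (dvec d0) r1) Y" "Y (dvec d0) = 0"
    "\<And>A. A \<in> ball (dvec d0) r1 \<Longrightarrow> \<Psi> (A, Y A) = Y A" by blast
  define P where "P A = mat 1 + Y A" for A
  define e where "e A = d0 + L (A, Y A)" for A
  have P1: "hol_on (ball (dvec d0) r1) P" unfolding P_def by (intro hol_add hol_const r1)
  have e1: "hol_on (ball (dvec d0) r1) e"
    unfolding e_def by (intro hol_add hol_const hol_compose[OF hol_Pair[OF hol_ident r1(2)] holL]) auto
  have PD: "P (dvec d0) = mat 1" by (simp add: P_def r1)
  \<comment> \<open>Near the base matrix \<open>P\<close> is close to the identity, where its
    inverse is the holomorphic \<open>cpw 1 (- 1)\<close>.\<close>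
  have "opn (0 :: 'n cmat) \<le> 0" by (rule opn_leI) simp
  then have "(mat 1 :: 'n cmat) \<in> cpw_dom 1" by (simp add: cpw_dom_def)
  then have "open (ball (dvec d0) r1 \<inter> P -` cpw_dom 1)" "dvec d0 \<in> ball (dvec d0) r1 \<inter> P -` cpw_dom 1"
    using continuous_open_preimage[OF hol_continuous_on[OF P1] open_ball open_cpw_dom] r1(1) PD by auto
  then obtain r where r: "r > 0" "ball (dvec d0) r \<subseteq> ball (dvec d0) r1 \<inter> P -` cpw_dom 1"
    using open_contains_ball by blast
  have sub: "ball (dvec d0) r \<subseteq> ball (dvec d0) r1" using r by blast
  define Q where "Q A = cpw 1 (- 1) (P A)" for A
  have inv: "P A ** Q A = mat 1 \<and> Q A ** P A = mat 1" if "A \<in> ball (dvec d0) r" for A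
    using cpw_1_inverse[of "P A"] that r(2) unfolding Q_def by blast
  have eig: "A ** P A = P A ** dvec (e A)" if "A \<in> ball (dvec d0) r1" for A
  proof -
    define B where "B = A - dvec d0"
    have Yij: "Y A $ i $ j = (if i = j then 0 else 1 / (d0 $ i - d0 $ j)) *
      (Y A $ i $ j * L (A, Y A) $ j - B $ i $ j - (B ** Y A) $ i $ j)" for i j
      using arg_cong[OF r1(4)[OF that], of "\<lambda>M. M $ i $ j"] by (simp add: \<Psi>_def B_def)
    have Lj: "L (A, Y A) $ j = B $ j $ j + (B ** Y A) $ j $ j" for j by (simp add: L_def B_def)
    have Y0: "Y A $ i $ i = 0" for i using Yij[of i i] by simp
    have Y1: "(d0 $ i - d0 $ j) * Y A $ i $ j = Y A $ i $ j * L (A, Y A) $ j - B $ i $ j - (B ** Y A) $ i $ j"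
      if "i \<noteq> j" for i j
    proof -
      have "d0 $ i - d0 $ j \<noteq> 0" using inj that by (auto simp: inj_def)
      then show ?thesis using Yij[of i j] that by (simp add: field_simps)
    qed
    have "(A ** P A) $ i $ j = (P A ** dvec (e A)) $ i $ j" for i j
    proof -
      have "A ** P A = dvec d0 + dvec d0 ** Y A + B + B ** Y A"
        by (simp add: P_def B_def mmult.add_right mmult.diff_left)
      then have lhs: "(A ** P A) $ i $ j = dvec d0 $ i $ j + d0 $ i * Y A $ i $ j + B $ i $ j + (B ** Y A) $ i $ j"
        by (simp add: dvec_def)
      have rhs: "(P A ** dvec (e A)) $ i $ j = (mat 1 + Y A) $ i $ j * (d0 $ j + L (A, Y A) $ j)"
        by (simp add: dvec_def P_def e_def)
      show ?thesis
      proof (cases "i = j")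
        case True
        then show ?thesis unfolding lhs rhs by (simp add: Y0 Lj mat_def)
      next
        case False
        then show ?thesis unfolding lhs rhs using Y1[OF False] by (simp add: mat_def algebra_simps)
      qed
    qed
    then show ?thesis by (simp add: vec_eq_iff)
  qed
  show thesis
  proof (rule that[OF r(1)])
    show Pr: "hol_on (ball (dvec d0) r) P" and "hol_on (ball (dvec d0) r) e" by (rule hol_subset[OF _ sub], fact)+
    show "hol_on (ball (dvec d0) r) Q"
      unfolding Q_def by (rule hol_cpw[OF hol_const Pr]) (use r in auto)
    show "e (dvec d0) = d0" using zero[of 0] by (simp add: e_def r1 L_def vec_eq_iff)
    show "P A ** Q A = mat 1 \<and> Q A ** P A = mat 1 \<and> A = P A ** dvec (e A) ** Q A"
      if A: "A \<in> ball (dvec d0) r" for A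
    proof -
      have "P A ** dvec (e A) ** Q A = A ** (P A ** Q A)"
        using eig[of A] A sub by (auto simp: matrix_mul_assoc)
      then show ?thesis using inv[OF A] by simp
    qed
  qed (rule PD)
qed

lemma local_eigenframe:
  fixes d0 :: "complex ^ 'n::finite"
    and V V' :: "'n cmat"
  assumes inj: "inj (($) d0)" and V: "V ** V' = mat 1" "V' ** V = mat 1"
  obtains U P Q e where "open U" "V ** dvec d0 ** V' \<in> U" "hol_on U P" "hol_on U Q" "hol_on U e"
    "P (V ** dvec d0 ** V') = V" "e (V ** dvec d0 ** V') = d0"
    "\<And>A. A \<in> U \<Longrightarrow> P A ** Q A = mat 1 \<and> Q A ** P A = mat 1 \<and> A = P A ** dvec (e A) ** Q A"
proof -
  obtain r P Q e where r: "r > 0" and hol: "hol_on (ball (dvec d0) r) P" "hol_on (ball (dvec d0) r) Q"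
      "hol_on (ball (dvec d0) r) e"
    and base: "P (dvec d0) = mat 1" "e (dvec d0) = d0"
    and eig: "\<And>A. A \<in> ball (dvec d0) r \<Longrightarrow> P A ** Q A = mat 1 \<and> Q A ** P A = mat 1 \<and> A = P A ** dvec (e A) ** Q A"
    using local_eigenframe_diag[OF inj] by blast
  define c where "c A = V' ** A ** V" for A :: "'n cmat"
  define U where "U = c -` ball (dvec d0) r"
  have holc: "hol_on T c" for T
    unfolding c_def by (intro hol_matrix_mult hol_const hol_ident)
  have "V' ** (V ** dvec d0 ** V') ** V = (V' ** V) ** dvec d0 ** (V' ** V)"
    by (simp only: matrix_mul_assoc)
  then have cN: "c (V ** dvec d0 ** V') = dvec d0" by (simp add: c_def V)
  have c_inv: "V ** c A ** V' = A" for A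
  proof -
    have "V ** c A ** V' = (V ** V') ** A ** (V ** V')" by (simp only: c_def matrix_mul_assoc)
    then show ?thesis by (simp add: V)
  qed
  have U: "open U"
    unfolding U_def using hol_continuous_on[OF holc[of UNIV]] by (simp add: open_vimage)
  have comp: "hol_on U (\<lambda>A. f (c A))" if "hol_on (ball (dvec d0) r) f" for f :: "'n cmat \<Rightarrow> 'z::cvec"
    by (rule hol_compose[OF holc that]) (simp add: U_def)
  show thesis
  proof (rule that[of U "\<lambda>A. V ** P (c A)" "\<lambda>A. Q (c A) ** V'" "\<lambda>A. e (c A)"])
    show "V ** dvec d0 ** V' \<in> U" using r by (simp add: U_def cN)
    show "hol_on U (\<lambda>A. V ** P (c A))" "hol_on U (\<lambda>A. Q (c A) ** V')" "hol_on U (\<lambda>A. e (c A))"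
      by (intro hol_matrix_mult hol_const comp hol)+
    fix A assume "A \<in> U"
    then have "c A \<in> ball (dvec d0) r" by (simp add: U_def)
    note E = eig[OF this]
    have 1: "V ** P (c A) ** (Q (c A) ** V') = V ** (P (c A) ** Q (c A)) ** V'"
      and 2: "Q (c A) ** V' ** (V ** P (c A)) = Q (c A) ** (V' ** V) ** P (c A)"
      and 3: "V ** P (c A) ** dvec (e (c A)) ** (Q (c A) ** V') = V ** (P (c A) ** dvec (e (c A)) ** Q (c A)) ** V'"
      by (simp_all only: matrix_mul_assoc)
    show "V ** P (c A) ** (Q (c A) ** V') = mat 1 \<and> Q (c A) ** V' ** (V ** P (c A)) = mat 1 \<and>
      A = V ** P (c A) ** dvec (e (c A)) ** (Q (c A) ** V')"
      unfolding 1 2 3 using E V c_inv by simp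
  qed (use U base cN in auto)
qed

section \<open>Invertible matrices with simple spectrum\<close>

lemma eigenvalues_diagonalized:
  fixes P Q :: "'n::finite cmat"
  assumes "P ** Q = mat 1" "Q ** P = mat 1"
  shows "eigenvalues (P ** diag_matrix d ** Q) = range d"
proof -
  have "det (diag_matrix d - mat c) = (\<Prod>i\<in>UNIV. d i - c)" for c
    by (subst det_diagonal) (auto simp: mat_def)
  then show ?thesis
    by (auto simp: eigenvalues_iff_det eigenvalues_similar[OF assms])
qed

lemma invertible_diagonalized:
  fixes P Q :: "'n::finite cmat"
  assumes "P ** Q = mat 1" "Q ** P = mat 1"
  shows "invertible (P ** diag_matrix d ** Q) \<longleftrightarrow> (\<forall>i. d i \<noteq> 0)"
  using eigenvalues_similar[OF assms, of "diag_matrix d" 0]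
  by (simp add: invertible_det_nz det_diagonal)

lemma diag_inv_distinct_iff:
  "T \<in> diag_inv_distinct \<longleftrightarrow> (\<exists>(P :: 'n::finite cmat) Q d. P ** Q = mat 1 \<and> Q ** P = mat 1 \<and>
     T = P ** dvec d ** Q \<and> inj (($) d) \<and> (\<forall>i. d $ i \<noteq> 0))" (is "_ = ?R")
proof
  assume T: "T \<in> diag_inv_distinct"
  then obtain P Q :: "'n cmat" and d where PQ: "P ** Q = mat 1" "Q ** P = mat 1" "T = P ** diag_matrix d ** Q"
    by (auto simp: diag_inv_distinct_def diagonalizable_def)
  have "card (range d) = card (UNIV :: 'n set)"
    using T eigenvalues_diagonalized[OF PQ(1,2), of d] by (simp add: diag_inv_distinct_def PQ(3))
  then have "inj d" by (intro eq_card_imp_inj_on) auto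
  moreover have "\<forall>i. d i \<noteq> 0"
    using T invertible_diagonalized[OF PQ(1,2), of d] by (simp add: diag_inv_distinct_def PQ(3))
  ultimately show ?R
    using PQ by (intro exI[of _ P] exI[of _ Q] exI[of _ "\<chi> i. d i"]) (simp add: dvec_def inj_def)
next
  assume ?R
  then obtain P Q :: "'n cmat" and d where PQ: "P ** Q = mat 1" "Q ** P = mat 1" "T = P ** dvec d ** Q"
    and d: "inj (($) d)" "\<forall>i. d $ i \<noteq> 0" by blast
  have "eigenvalues T = range (($) d)"
    using eigenvalues_diagonalized[OF PQ(1,2), of "\<lambda>i. d $ i"] by (simp add: PQ(3) dvec_def)
  then have "card (eigenvalues T) = CARD('n)" using card_image[OF d(1)] by simp
  moreover have "diagonalizable T"
    unfolding diagonalizable_def using PQ unfolding dvec_def by blast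
  moreover have "invertible T"
    using invertible_diagonalized[OF PQ(1,2), of "\<lambda>i. d $ i"] d(2) by (simp add: PQ(3) dvec_def)
  ultimately show "T \<in> diag_inv_distinct" by (simp add: diag_inv_distinct_def)
qed

text \<open>The local eigenvalue map \<open>e\<close> is continuous, and having distinct non-zero
  entries is an open condition on \<open>e A\<close>.\<close>

lemma open_diag_inv_distinct: "open (diag_inv_distinct :: 'n::finite cmat set)"
proof (subst open_subopen, rule ballI)
  fix T :: "'n cmat" assume "T \<in> diag_inv_distinct"
  then obtain V V' :: "'n cmat" and d where V: "V ** V' = mat 1" "V' ** V = mat 1" and T: "T = V ** dvec d ** V'"
    and d: "inj (($) d)" "\<forall>i. d $ i \<noteq> 0" unfolding diag_inv_distinct_iff by blast
  obtain U P Q e where U: "open U" "T \<in> U" "hol_on U P" "hol_on U Q" "hol_on U e" "e T = d"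
    "\<And>A. A \<in> U \<Longrightarrow> P A ** Q A = mat 1 \<and> Q A ** P A = mat 1 \<and> A = P A ** dvec (e A) ** Q A"
    using local_eigenframe[OF d(1) V] unfolding T by metis
  define O1 where "O1 = {v :: complex ^ 'n. inj (($) v) \<and> (\<forall>i. v $ i \<noteq> 0)}"
  have "O1 = (\<Inter>i. \<Inter>j\<in>{j. j \<noteq> i}. {v. v $ i \<noteq> v $ j}) \<inter> (\<Inter>i. {v. v $ i \<noteq> 0})"
    by (auto simp: O1_def inj_def)
  moreover have "open \<dots>"
    by (intro open_Int open_INT ballI open_Collect_neq continuous_intros) auto
  ultimately have "open O1" by simp
  then have "open (U \<inter> e -` O1)"
    using continuous_open_preimage[OF hol_continuous_on[OF U(5)] U(1)] by simp
  moreover have "T \<in> U \<inter> e -` O1" using U d by (simp add: O1_def)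
  moreover have "U \<inter> e -` O1 \<subseteq> diag_inv_distinct"
    unfolding diag_inv_distinct_iff[abs_def] O1_def using U(7) by (auto simp: diag_inv_distinct_iff) blast
  ultimately show "\<exists>T'. open T' \<and> T \<in> T' \<and> T' \<subseteq> diag_inv_distinct" by blast
qed

section \<open>Dynamics of Gram matrices\<close>

definition vcnj :: "complex ^ 'n \<Rightarrow> complex ^ 'n::finite" where
  "vcnj v = (\<chi> i. cnj (v $ i))"

lemma vcnj_nth [simp]: "vcnj v $ i = cnj (v $ i)"
  by (simp add: vcnj_def)

lemma vcnj_vcnj [simp]: "vcnj (vcnj v) = v"
  by (simp add: vec_eq_iff)

lemma cadjoint_dvec: "cadjoint (dvec v) = dvec (vcnj v)"
  by (simp add: dvec_def cadjoint_diag_matrix)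

lemma dvec_commute: "dvec v ** diag_matrix k = diag_matrix k ** dvec v"
  by (simp add: dvec_def diag_matrix_mult mult.commute)

text \<open>If \<open>T = P diag(d) P\<^sup>-\<^sup>1\<close> has eigenvector Gram matrix \<open>K = P\<^sup>* P\<close>, then the transform of \<open>T\<close> has
  the eigenvector matrix \<open>P E\<close> with \<open>E = (K\<^sup>-\<^sup>1 diag(m) K diag(d))\<^sup>s (diag(m) diag(d))\<^bsup>-s\<^esup>\<close>, where
  \<open>s = l/2\<close> and \<open>m\<close> is the conjugate of \<open>d\<close>, and so the Gram matrix \<open>E\<^sup>* K E\<close>. Treating \<open>m\<close> as an
  independent variable makes this step holomorphic. The dynamics below also accumulates the product \<open>W\<close> of the
  matrices \<open>E\<close> and its inverse \<open>W'\<close>, which recover the iterates of \<open>T\<close> itself.\<close>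

definition gram_conj :: "complex ^ 'n \<Rightarrow> complex ^ 'n \<Rightarrow> 'n::finite cmat \<Rightarrow> 'n cmat" where
  "gram_conj d m K = cpw 1 (- 1) K ** dvec m ** K ** dvec d"

text \<open>For Hermitian \<open>K\<close> and \<open>m = vcnj d\<close> this is the adjoint of
  \<open>gram_conj\<close>. Taking adjoints is not holomorphic, so the adjoint is kept as a separate
  expression in \<open>d\<close>, \<open>m\<close> and \<open>K\<close>;
  \<open>frame_step_adj\<close> serves the same purpose for \<open>frame_step\<close>.\<close>

definition gram_conj' :: "complex ^ 'n \<Rightarrow> complex ^ 'n \<Rightarrow> 'n::finite cmat \<Rightarrow> 'n cmat" where
  "gram_conj' d m K = dvec m ** K ** dvec d ** cpw 1 (- 1) K"

definition frame_step :: "real \<Rightarrow> complex \<Rightarrow> complex ^ 'n \<Rightarrow> complex ^ 'n \<Rightarrow> 'n::finite cmat \<Rightarrow> 'n cmat" where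
  "frame_step c s d m K = cpw c s (gram_conj d m K) ** cpw c (- s) (dvec m ** dvec d)"

definition frame_step_inv :: "real \<Rightarrow> complex \<Rightarrow> complex ^ 'n \<Rightarrow> complex ^ 'n \<Rightarrow> 'n::finite cmat \<Rightarrow> 'n cmat" where
  "frame_step_inv c s d m K = cpw c s (dvec m ** dvec d) ** cpw c (- s) (gram_conj d m K)"

definition frame_step_adj :: "real \<Rightarrow> complex \<Rightarrow> complex ^ 'n \<Rightarrow> complex ^ 'n \<Rightarrow> 'n::finite cmat \<Rightarrow> 'n cmat" where
  "frame_step_adj c s d m K = cpw c (- s) (dvec m ** dvec d) ** cpw c s (gram_conj' d m K)"

definition gram_dom :: "real \<Rightarrow> complex ^ 'n \<Rightarrow> complex ^ 'n \<Rightarrow> 'n::finite cmat \<Rightarrow> bool" where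
  "gram_dom c d m K \<longleftrightarrow> K \<in> cpw_dom 1 \<and> gram_conj d m K \<in> cpw_dom c \<and> gram_conj' d m K \<in> cpw_dom c \<and>
     dvec m ** dvec d \<in> cpw_dom c"

text \<open>The parameters \<open>(s, d, m)\<close> come first and are constant along an orbit; the
  state \<open>(K, W, W')\<close> follows.\<close>

type_synonym 'n dyn = "(complex \<times> (complex ^ 'n) \<times> (complex ^ 'n)) \<times> 'n cmat \<times> 'n cmat \<times> 'n cmat"

definition dyn_set :: "real \<Rightarrow> 'n::finite dyn set" where
  "dyn_set c = {((s, d, m), (K, W, W')). gram_dom c d m K}"

definition dyn_map :: "real \<Rightarrow> 'n::finite dyn \<Rightarrow> 'n cmat \<times> 'n cmat \<times> 'n cmat" where
  "dyn_map c = (\<lambda>((s, d, m), (K, W, W')).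
     (frame_step_adj c s d m K ** K ** frame_step c s d m K, W ** frame_step c s d m K,
         frame_step_inv c s d m K ** W'))"

lemma hol_gram_conj:
  assumes "hol_on S d" "hol_on S m" "hol_on S K" "\<And>x. x \<in> S \<Longrightarrow> K x \<in> cpw_dom 1"
  shows "hol_on S (\<lambda>x. gram_conj (d x) (m x) (K x))" "hol_on S (\<lambda>x. gram_conj' (d x) (m x) (K x))"
  unfolding gram_conj_def gram_conj'_def
  by (intro hol_matrix_mult hol_dvec hol_cpw[OF hol_const] assms; simp)+

lemma open_dyn_set: "open (dyn_set c :: 'n::finite dyn set)"
  and hol_dyn_map: "hol_on (dyn_set c :: 'n::finite dyn set) (dyn_map c)"
proof -
  define s d m K W W' where
    "s = (\<lambda>p :: 'n dyn. fst (fst p))" and "d = (\<lambda>p :: 'n dyn. fst (snd (fst p)))" and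
    "m = (\<lambda>p :: 'n dyn. snd (snd (fst p)))" and "K = (\<lambda>p :: 'n dyn. fst (snd p))" and
    "W = (\<lambda>p :: 'n dyn. fst (snd (snd p)))" and "W' = (\<lambda>p :: 'n dyn. snd (snd (snd p)))"
  have hs: "hol_on S s" and hd: "hol_on S d" and hm: "hol_on S m" and hK: "hol_on S K" and hW: "hol_on S W" and
      hW': "hol_on S W'" for S
    unfolding s_def d_def m_def K_def W_def W'_def by (intro hol_fst hol_snd hol_ident)+
  define S1 where "S1 = {p. K p \<in> cpw_dom 1}"
  have "open S1"
    unfolding S1_def using open_vimage[OF open_cpw_dom hol_continuous_on[OF hK]] by (simp add: vimage_def)
  have dom1: "\<And>p. p \<in> S1 \<Longrightarrow> K p \<in> cpw_dom 1" by (simp add: S1_def)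
  have hA: "hol_on S1 (\<lambda>p. gram_conj (d p) (m p) (K p))" "hol_on S1 (\<lambda>p. gram_conj' (d p) (m p) (K p))"
    by (rule hol_gram_conj[OF hd hm hK dom1], assumption)+
  have hD: "hol_on S (\<lambda>p. dvec (m p) ** dvec (d p))" for S
    by (intro hol_matrix_mult hol_dvec hm hd)
  have eq: "dyn_set c = (S1 \<inter> (\<lambda>p. gram_conj (d p) (m p) (K p)) -` cpw_dom c) \<inter>
    ((S1 \<inter> (\<lambda>p. gram_conj' (d p) (m p) (K p)) -` cpw_dom c) \<inter> (\<lambda>p. dvec (m p) ** dvec (d p)) -` cpw_dom c)"
    by (auto simp: dyn_set_def gram_dom_def S1_def d_def m_def K_def)
  show op: "open (dyn_set c :: 'n dyn set)"
    unfolding eq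
    by (intro open_Int continuous_open_preimage[OF hol_continuous_on[OF hA(1)] \<open>open S1\<close> open_cpw_dom]
        continuous_open_preimage[OF hol_continuous_on[OF hA(2)] \<open>open S1\<close> open_cpw_dom]
        open_vimage[OF open_cpw_dom hol_continuous_on[OF hD]])
  have sub: "dyn_set c \<subseteq> S1" unfolding eq by blast
  note hA' = hA[THEN hol_subset, OF sub]
  have hs': "hol_on S (\<lambda>p. - s p)" for S using hol_scaleR[OF hs, of S "- 1"] by simp
  have E: "hol_on (dyn_set c) (\<lambda>p. frame_step c (s p) (d p) (m p) (K p))"
    "hol_on (dyn_set c) (\<lambda>p. frame_step_inv c (s p) (d p) (m p) (K p))"
    "hol_on (dyn_set c) (\<lambda>p. frame_step_adj c (s p) (d p) (m p) (K p))"
    unfolding frame_step_def frame_step_inv_def frame_step_adj_def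
    by (intro hol_matrix_mult hol_cpw hs hs' hA' hD; auto simp: eq)+
  have dm: "dyn_map c = (\<lambda>p. (frame_step_adj c (s p) (d p) (m p) (K p) ** K p ** frame_step c (s p) (d p) (m p)
      (K p),
      W p ** frame_step c (s p) (d p) (m p) (K p), frame_step_inv c (s p) (d p) (m p) (K p) ** W' p))"
    by (auto simp: dyn_map_def s_def d_def m_def K_def W_def W'_def fun_eq_iff)
  show "hol_on (dyn_set c :: 'n dyn set) (dyn_map c)"
    unfolding dm by (intro hol_Pair hol_matrix_mult E hK hW hW')
qed

section \<open>Fixed points of the Gram dynamics and linearization at the identity\<close>

definition offd :: "'n::finite cmat \<Rightarrow> 'n cmat" where
  "offd A = (\<chi> i j. if i = j then 0 else A $ i $ j)"

lemma offd_nth [simp]: "offd A $ i $ j = (if i = j then 0 else A $ i $ j)"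
  by (simp add: offd_def)

lemma norm_cmat_mono:
  fixes A B :: "'n::finite cmat"
  assumes "\<And>i j. norm (A $ i $ j) \<le> q * norm (B $ i $ j)" "0 \<le> q"
  shows "norm A \<le> q * norm B"
proof (rule power2_le_imp_le)
  have "(norm A)\<^sup>2 \<le> (\<Sum>i\<in>UNIV. \<Sum>j\<in>UNIV. (q * norm (B $ i $ j))\<^sup>2)"
    unfolding norm_cmat_sq by (intro sum_mono power_mono assms) auto
  also have "\<dots> = (q * norm B)\<^sup>2"
    by (simp add: power_mult_distrib norm_cmat_sq sum_distrib_left)
  finally show "(norm A)\<^sup>2 \<le> (q * norm B)\<^sup>2" .
qed (use assms in auto)

lemma cpw_dom_diag:
  assumes "diag_matrix x \<in> cpw_dom c"
  shows "norm (x i / of_real c - 1) < 1"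
proof -
  have "norm ((diag_matrix (\<lambda>i. x i / of_real c - 1)) $ i $ i) \<le> opn (diag_matrix (\<lambda>i. x i / of_real c - 1))"
    by (rule norm_nth_le_opn)
  then show ?thesis using assms by (simp add: cpw_dom_def diag_matrix_shift)
qed

text \<open>A diagonal \<open>K\<close> commutes with \<open>dvec m\<close>, so both conjugates
  reduce to \<open>dvec m ** dvec d\<close> and the two powers in each frame step cancel. The frames
  \<open>W\<close> and \<open>W'\<close> are arbitrary, so inside the domain these fixed points are
  cut out by the linear condition on \<open>K\<close> alone.\<close>

lemma dyn_map_fixed:
  fixes K :: "'n::finite cmat"
  assumes dom: "((s, d, m), (K, W, W')) \<in> dyn_set c" and K: "offd K = 0"
  shows "dyn_map c ((s, d, m), (K, W, W')) = (K, W, W')"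
proof -
  have dom': "K \<in> cpw_dom 1" "dvec m ** dvec d \<in> cpw_dom c" using dom by (auto simp: dyn_set_def gram_dom_def)
  define k where "k i = K $ i $ i" for i
  have Kk: "K = diag_matrix k"
  proof -
    have "K $ i $ j = diag_matrix k $ i $ j" for i j
      using arg_cong[OF K, of "\<lambda>A. A $ i $ j"] by (auto simp: k_def)
    then show ?thesis by (simp add: vec_eq_iff)
  qed
  have "k i \<noteq> 0" for i using cpw_dom_diag[of k 1 i] dom'(1) Kk by auto
  then have kk: "diag_matrix (\<lambda>i. 1 / k i) ** K = mat 1"
    unfolding Kk by (simp add: diag_matrix_mult)
  have inv: "cpw 1 (- 1) K = diag_matrix (\<lambda>i. 1 / k i)"
    by (metis kk cpw_1_inverse(1)[OF dom'(1)] matrix_mul_assoc matrix_mul_lid matrix_mul_rid)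
  have AB: "gram_conj d m K = dvec m ** dvec d" "gram_conj' d m K = dvec m ** dvec d"
    unfolding gram_conj_def gram_conj'_def inv unfolding Kk using \<open>\<And>i. k i \<noteq> 0\<close>
    by (simp_all add: dvec_def diag_matrix_mult)
  define x where "x i = m $ i * d $ i" for i
  have x: "dvec m ** dvec d = diag_matrix x" by (simp add: x_def[abs_def] dvec_def diag_matrix_mult)
  have "norm (x i / of_real c - 1) < 1" for i using cpw_dom_diag[of x c i] dom'(2) x by simp
  then have "cpw c s (diag_matrix x) ** cpw c (- s) (diag_matrix x) = mat 1"
    "cpw c (- s) (diag_matrix x) ** cpw c s (diag_matrix x) = mat 1"
    using cpw_diag_inverse[of x c s] cpw_diag_inverse[of x c "- s"] by simp_all
  then show ?thesis
    by (simp add: dyn_map_def frame_step_def frame_step_inv_def frame_step_adj_def AB x)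
qed

text \<open>The multiplier of the entry \<open>(i, j)\<close> in the linearized Gram step at
  \<open>mat 1\<close>, for \<open>p = d $ i\<close> and \<open>q = d $ j\<close>. The divided
  difference comes from the powers of \<open>gram_conj\<close> and \<open>gram_conj'\<close>, the
  two fractions from the factors to the left and to the right of \<open>K\<close>.\<close>

definition contraction_factor :: "real \<Rightarrow> complex \<Rightarrow> complex \<Rightarrow> complex" where
  "contraction_factor s p q = 1 + of_real (rdivdiff_powr s ((norm p)\<^sup>2) ((norm q)\<^sup>2)) *
     ((cnj p * q - of_real ((norm p)\<^sup>2)) / of_real (((norm p)\<^sup>2) powr s)
      + (cnj p * q - of_real ((norm q)\<^sup>2)) / of_real (((norm q)\<^sup>2) powr s))"

text \<open>Here \<open>a\<close> and \<open>b\<close> are the moduli of two eigenvalues, and the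
  exponent \<open>l\<close> is twice \<open>s\<close> because the factor is built from their
  squares. Over the common denominator the numerator is \<open>N\<close>, a non-negative number plus
  \<open>z\<close> times another one; the triangle inequality and \<open>norm z = a * b\<close>
  reduce the claim to \<open>(P - Q) * (a * Q - b * P) > 0\<close>.\<close>

lemma contraction_factor_aux:
  fixes a b l :: real and z :: complex
  assumes ab: "b > 0" "a > b" and l: "0 < l" "l < 1" and z: "norm z = a * b"
  shows "norm (1 + of_real ((a powr l - b powr l) / (a\<^sup>2 - b\<^sup>2)) *
    ((z - of_real (a\<^sup>2)) / of_real (a powr l) + (z - of_real (b\<^sup>2)) / of_real (b powr l))) < 1"
proof -
  define P Q where "P = a powr l" and "Q = b powr l"
  have a: "a > 0" using ab by simp
  have PQ: "P > 0" "Q > 0" "P > Q" using ab l by (auto simp: P_def Q_def powr_less_mono2)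
  \<comment> \<open>This gives \<open>a * Q > b * P\<close>, and it is here that
    \<open>l < 1\<close> enters.\<close>
  have "a powr (1 - l) > b powr (1 - l)" using ab l by (simp add: powr_less_mono2)
  then have "P * Q * a powr (1 - l) > P * Q * b powr (1 - l)" using PQ by simp
  moreover have "P * a powr (1 - l) = a" "Q * b powr (1 - l) = b"
    using a ab by (simp_all add: P_def Q_def powr_add[symmetric])
  then have "P * Q * a powr (1 - l) = a * Q" "P * Q * b powr (1 - l) = b * P"
    by (metis mult.commute mult.left_commute)+
  ultimately have aQ: "a * Q > b * P" by simp
  define D where "D = a\<^sup>2 - b\<^sup>2"
  have D: "D > 0" using ab by (simp add: D_def power_strict_mono)
  define \<rho> where "\<rho> = 1 + of_real ((P - Q) / D) * ((z - of_real (a\<^sup>2)) / of_real P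
      + (z - of_real (b\<^sup>2)) / of_real Q)"
  define N where "N = of_real (a\<^sup>2 * Q\<^sup>2 - b\<^sup>2 * P\<^sup>2) + z * of_real (P\<^sup>2 - Q\<^sup>2)"
  have "\<rho> * of_real (P * Q * D) = of_real (P * Q * D) + of_real (P - Q) * ((z - of_real (a\<^sup>2)) * of_real Q
      + (z - of_real (b\<^sup>2)) * of_real P)"
    using PQ D by (simp add: \<rho>_def field_simps)
  also have "\<dots> = N"
    unfolding N_def D_def by (simp add: algebra_simps power2_eq_square)
  finally have \<rho>N: "\<rho> * of_real (P * Q * D) = N" .
  have "(b * P)\<^sup>2 \<le> (a * Q)\<^sup>2" using aQ ab PQ by (intro power_mono) auto
  then have n1: "a\<^sup>2 * Q\<^sup>2 - b\<^sup>2 * P\<^sup>2 \<ge> 0" by (simp add: power_mult_distrib)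
  have n2: "P\<^sup>2 - Q\<^sup>2 \<ge> 0" using PQ by (simp add: power_mono)
  have "norm N \<le> norm (complex_of_real (a\<^sup>2 * Q\<^sup>2 - b\<^sup>2 * P\<^sup>2)) + norm (z * complex_of_real (P\<^sup>2 - Q\<^sup>2))"
    unfolding N_def by (rule norm_triangle_ineq)
  also have "\<dots> = (a\<^sup>2 * Q\<^sup>2 - b\<^sup>2 * P\<^sup>2) + a * b * (P\<^sup>2 - Q\<^sup>2)"
    unfolding norm_mult norm_of_real z using n1 n2 by simp
  also have "\<dots> = (a - b) * (a * Q\<^sup>2 + b * P\<^sup>2)" by (simp add: algebra_simps power2_eq_square)
  also have "\<dots> < (a - b) * (P * Q * (a + b))"
  proof (rule mult_strict_left_mono)
    have "(P - Q) * (a * Q - b * P) > 0" using PQ aQ by simp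
    then show "a * Q\<^sup>2 + b * P\<^sup>2 < P * Q * (a + b)" by (simp add: algebra_simps power2_eq_square)
  qed (use ab in simp)
  also have "\<dots> = P * Q * D" by (simp add: D_def algebra_simps power2_eq_square)
  finally have "norm (\<rho> * of_real (P * Q * D)) < P * Q * D" unfolding \<rho>N .
  then have "norm \<rho> * (P * Q * D) < 1 * (P * Q * D)"
    using PQ D by (simp add: norm_mult)
  then have "norm \<rho> < 1" using PQ D by (simp only: mult_less_cancel_right) auto
  then show ?thesis by (simp add: \<rho>_def P_def Q_def D_def)
qed

text \<open>Different moduli are covered by \<open>contraction_factor_aux\<close>, up to exchanging
  them. For equal moduli the factor is \<open>1 + 2 * s * (w - 1)\<close> with
  \<open>w \<noteq> 1\<close> on the unit circle: a proper convex combination of 1 and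
  \<open>w\<close>, hence inside the open disc.\<close>

lemma contraction_factor_less_1:
  assumes "p \<noteq> q" "p \<noteq> 0" "q \<noteq> 0" and s: "0 < s" "s < 1/2"
  shows "norm (contraction_factor s p q) < 1"
proof -
  define a b z where "a = norm p" and "b = norm q" and "z = cnj p * q"
  have ab: "a > 0" "b > 0" using assms by (simp_all add: a_def b_def)
  have z: "norm z = a * b" "norm z = b * a" by (simp_all add: z_def a_def b_def norm_mult)
  have pw: "(a\<^sup>2) powr s = a powr (2 * s)" "(b\<^sup>2) powr s = b powr (2 * s)"
    using ab powr_powr[of a 2 s] powr_powr[of b 2 s] by simp_all
  consider "a > b" | "b > a" | "a = b" by linarith
  then show ?thesis
  proof cases
    case 1
    then have "a\<^sup>2 \<noteq> b\<^sup>2" using ab by (simp add: power2_eq_iff)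
    then show ?thesis
      using contraction_factor_aux[OF ab(2) 1, of "2 * s" z] s z(1) pw
      by (simp add: contraction_factor_def rdivdiff_powr_def a_def b_def z_def)
  next
    case 2
    then have ne: "a\<^sup>2 \<noteq> b\<^sup>2" using ab by (simp add: power2_eq_iff)
    have sym: "(b powr (2 * s) - a powr (2 * s)) / (b\<^sup>2 - a\<^sup>2) = (a powr (2 * s) - b powr (2 * s)) / (a\<^sup>2 - b\<^sup>2)"
      by (metis minus_diff_eq minus_divide_divide)
    show ?thesis
      using contraction_factor_aux[OF ab(1) 2, of "2 * s" z] s z(2) pw ne unfolding sym
      by (simp add: contraction_factor_def rdivdiff_powr_def a_def b_def z_def add.commute)
  next
    case 3
    define w where "w = z / of_real (a\<^sup>2)"
    have zw: "z = w * of_real (a\<^sup>2)" using ab by (simp add: w_def)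
    have "norm w = 1" using z(1) 3 ab by (simp add: w_def norm_divide norm_mult power2_eq_square)
    have "w \<noteq> 1"
    proof
      assume "w = 1"
      then have "cnj p * q = cnj p * p"
        using zw by (simp add: z_def a_def complex_norm_square mult.commute del: of_real_power)
      then show False using assms by simp
    qed
    have Rw: "Re w < 1"
    proof (rule ccontr)
      assume "\<not> Re w < 1"
      then have "Re w = 1" using complex_Re_le_cmod[of w] \<open>norm w = 1\<close> by simp
      moreover then have "Im w = 0" using \<open>norm w = 1\<close> cmod_power2[of w] by simp
      ultimately show False using \<open>w \<noteq> 1\<close> by (simp add: complex_eq_iff)
    qed
    have x: "a\<^sup>2 powr (s - 1) * a\<^sup>2 / a\<^sup>2 powr s = 1" using ab by (simp add: powr_diff)
    have "contraction_factor s p q = 1 + of_real (s * a\<^sup>2 powr (s - 1)) * (2 * ((w - 1) * of_real (a\<^sup>2) /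
        of_real (a\<^sup>2 powr s)))"
      unfolding contraction_factor_def rdivdiff_powr_def z_def[symmetric] a_def[symmetric] b_def[symmetric]
          3[symmetric] zw
      by (simp add: algebra_simps)
    also have "\<dots> = 1 + of_real (2 * s) * of_real (a\<^sup>2 powr (s - 1) * a\<^sup>2 / a\<^sup>2 powr s) * (w - 1)"
      by simp
    finally have cf: "contraction_factor s p q = 1 + of_real (2 * s) * (w - 1)" unfolding x by simp
    have "(norm (contraction_factor s p q))\<^sup>2 = (1 + 2 * s * (Re w - 1))\<^sup>2 + (2 * s * Im w)\<^sup>2"
      unfolding cf cmod_power2 by simp
    also have "\<dots> = 1 + 4 * s * (1 - s * 2) * (Re w - 1) + 4 * s\<^sup>2 * ((Re w)\<^sup>2 + (Im w)\<^sup>2 - 1)"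
      by (simp add: algebra_simps power2_eq_square)
    also have "(Re w)\<^sup>2 + (Im w)\<^sup>2 = 1" using \<open>norm w = 1\<close> cmod_power2[of w] by simp
    also have "1 + 4 * s * (1 - s * 2) * (Re w - 1) + 4 * s\<^sup>2 * (1 - 1) < 1"
      using s Rw by (simp add: mult_pos_neg)
    finally show ?thesis by (simp add: power2_less_1_iff abs_square_less_1)
  qed
qed

lemma cpw_1_inverse_entry:
  assumes "i \<noteq> j"
  shows "cpw 1 (- 1) (diag_matrix (\<lambda>_. 1) + unit_entry i j u) = diag_matrix (\<lambda>_. 1) + unit_entry i j (- u)"
  using cpw_diag_plus_entry[OF assms, of "\<lambda>_. 1" 1 "- 1" u] by (simp add: rdivdiff_powr_def)

text \<open>Every matrix in the step is diagonal plus a multiple of the same off-diagonal unit, and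
  \<open>diag_plus_entry_mult\<close> multiplies such matrices. The step is thus computed exactly,
  and it is affine in \<open>u\<close>.\<close>

lemma dyn_map_entry:
  fixes d :: "complex ^ 'n::finite"
  assumes ij: "i \<noteq> j" and d: "\<And>k. d $ k \<noteq> 0" "\<And>k. (norm (d $ k))\<^sup>2 < 2 * c" and c: "c > 0"
  shows "fst (dyn_map c ((of_real s, d, vcnj d), (mat 1 + unit_entry i j u, W, W')))
    = mat 1 + unit_entry i j (contraction_factor s (d $ i) (d $ j) * u)"
proof -
  define x where "x k = (norm (d $ k))\<^sup>2" for k
  define m where "m k = cnj (d $ k)" for k
  have x: "0 < x k" "x k < 2 * c" for k using d by (auto simp: x_def)
  have mx: "m k * d $ k = of_real (x k)" for k
    by (simp add: m_def x_def complex_norm_square mult.commute del: of_real_power)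
  define g where "g = complex_of_real (rdivdiff_powr s (x i) (x j))"
  define al where "al k = complex_of_real (x k powr s)" for k
  have al: "al k \<noteq> 0" for k using x(1)[of k] by (simp add: al_def)
  have inv_al: "complex_of_real (x k powr (- s)) = 1 / al k" for k
    by (simp add: al_def powr_minus divide_inverse)
  let ?E = "unit_entry i j"
  note mult = diag_plus_entry_mult[OF ij]
  have z: "diag_matrix y = diag_matrix y + ?E 0" for y by (simp add: vec_eq_iff)
  define K where "K = diag_matrix (\<lambda>_. 1) + ?E u"
  have K: "mat 1 + ?E u = K" by (simp add: K_def)
  have Kinv: "cpw 1 (- 1) K = diag_matrix (\<lambda>_. 1) + ?E (- u)"
    unfolding K_def by (rule cpw_1_inverse_entry[OF ij])
  have dm: "dvec (vcnj d) = diag_matrix m + ?E 0" "dvec d = diag_matrix (\<lambda>k. d $ k) + ?E 0"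
    by (simp_all add: vec_eq_iff m_def)
  have D: "dvec (vcnj d) ** dvec d = diag_matrix (\<lambda>k. of_real (x k))"
    by (simp add: dvec_def diag_matrix_mult mx[symmetric] m_def)
  have A1: "gram_conj d (vcnj d) K = diag_matrix (\<lambda>k. of_real (x k)) + ?E ((m i - m j) * d $ j * u)"
    unfolding gram_conj_def Kinv unfolding K_def dm mult by (simp add: mx algebra_simps)
  have A2: "gram_conj' d (vcnj d) K = diag_matrix (\<lambda>k. of_real (x k)) + ?E (m i * (d $ j - d $ i) * u)"
    unfolding gram_conj'_def Kinv unfolding K_def dm mult by (simp add: mx algebra_simps)
  have p1: "cpw c (of_real s) (diag_matrix (\<lambda>k. of_real (x k)) + ?E v) = diag_matrix al + ?E (v * g)" for v
    using cpw_diag_plus_entry[where s = s and u = v, OF ij x c] by (simp add: al_def[abs_def] g_def)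
  have p2: "cpw c (- of_real s) (diag_matrix (\<lambda>k. of_real (x k))) = diag_matrix (\<lambda>k. 1 / al k) + ?E 0"
    using cpw_diag_real[of x c "- s", OF x c] z[of "\<lambda>k. 1 / al k"] by (simp add: inv_al)
  have E1: "frame_step c (of_real s) d (vcnj d) K = diag_matrix (\<lambda>_. 1) + ?E ((m i - m j) * d $ j * u * g / al j)"
    unfolding frame_step_def A1 D p1 p2 mult using al by simp
  have E2: "frame_step_adj c (of_real s) d (vcnj d) K = diag_matrix (\<lambda>_. 1)
      + ?E (m i * (d $ j - d $ i) * u * g / al i)"
    unfolding frame_step_adj_def A2 D p1 p2 mult using al by simp
  have mij: "m i * d $ j = cnj (d $ i) * d $ j" by (simp add: m_def)
  have "contraction_factor s (d $ i) (d $ j) * u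
    = u + m i * (d $ j - d $ i) * u * g / al i + (m i - m j) * d $ j * u * g / al j"
    unfolding contraction_factor_def x_def[symmetric] g_def[symmetric] al_def[symmetric] mij[symmetric]
        mx[symmetric]
    by (simp add: algebra_simps add_divide_distrib diff_divide_distrib)
  moreover have "fst (dyn_map c ((of_real s, d, vcnj d), (K, W, W')))
    = diag_matrix (\<lambda>_. 1) + ?E (u + m i * (d $ j - d $ i) * u * g / al i + (m i - m j) * d $ j * u * g / al j)"
    unfolding dyn_map_def prod.case fst_conv E1 E2 unfolding K_def mult by (simp add: algebra_simps)
  ultimately show ?thesis by (simp add: K)
qed

lemma gram_dom_base:
  fixes d :: "complex ^ 'n::finite"
  assumes d: "\<And>k. d $ k \<noteq> 0" "\<And>k. (norm (d $ k))\<^sup>2 < 2 * c" and c: "c > 0"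
  shows "gram_dom c d (vcnj d) (mat 1)"
proof -
  have opn0: "opn (0 :: 'n cmat) < 1"
    using opn_diag_less[of "\<lambda>_ :: 'n. 0" 1] by (simp add: diag_matrix_def zero_vec_def[symmetric] cong: if_cong)
  then have 1: "(mat 1 :: 'n cmat) \<in> cpw_dom 1" by (simp add: cpw_dom_def)
  have inv: "cpw 1 (- 1) (mat 1 :: 'n cmat) = mat 1"
    using cpw_1_inverse(1)[OF 1] by simp
  have D: "dvec (vcnj d) ** dvec d = diag_matrix (\<lambda>k. of_real ((norm (d $ k))\<^sup>2))"
    by (simp add: dvec_def diag_matrix_mult complex_norm_square mult.commute del: of_real_power)
  have "dvec (vcnj d) ** dvec d \<in> cpw_dom c"
    unfolding cpw_dom_def mem_Collect_eq D diag_matrix_shift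
    by (rule opn_diag_less, rule norm_shift_real) (use d in auto)
  then show ?thesis using 1 by (simp add: gram_dom_def gram_conj_def gram_conj'_def inv)
qed

lemma sum_unit_entry_nth: "(\<Sum>i\<in>UNIV. \<Sum>j\<in>UNIV. unit_entry i j (f i j)) $ k $ l = f k l"
proof -
  have "(\<Sum>i\<in>UNIV. \<Sum>j\<in>UNIV. unit_entry i j (f i j)) $ k $ l
    = (\<Sum>i\<in>UNIV. if k = i then (\<Sum>j\<in>UNIV. if l = j then f i j else 0) else 0)"
    by (simp only: sum_component unit_entry_nth, intro sum.cong refl) auto
  then show ?thesis by (simp only: sum.delta'[OF finite] UNIV_I if_True)
qed

text \<open>On off-diagonal directions the derivative of the Gram component multiplies each entry by
  its contraction factor, and finitely many moduli below 1 have a maximum below 1. The frames do not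
  enter \<open>off\<close>, so no contraction is asked of them.\<close>

lemma dyn_limit:
  fixes d0 :: "complex ^ 'n::finite"
  assumes inj: "inj (($) d0)" and d: "\<And>k. d0 $ k \<noteq> 0" "\<And>k. (norm (d0 $ k))\<^sup>2 < 2 * c" and c: "c > 0"
    and s: "0 < s" "s < 1/2"
  obtains r G where "r > 0" "hol_on (ball ((of_real s, d0, vcnj d0), (mat 1, mat 1, mat 1)) r) G"
    "\<And>\<theta> z n. (\<theta>, z) \<in> ball ((of_real s, d0, vcnj d0), (mat 1, mat 1, mat 1)) r \<Longrightarrow>
       (\<theta>, ((\<lambda>z. dyn_map c (\<theta>, z)) ^^ n) z) \<in> dyn_set c"
    "\<And>\<theta> z. (\<theta>, z) \<in> ball ((of_real s, d0, vcnj d0), (mat 1, mat 1, mat 1)) r \<Longrightarrow>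
       (\<lambda>n. ((\<lambda>z. dyn_map c (\<theta>, z)) ^^ n) z) \<longlonglongrightarrow> G (\<theta>, z)"
proof -
  let ?\<theta> = "(complex_of_real s, d0, vcnj d0)"
  let ?z = "(mat 1, mat 1, mat 1) :: 'n cmat \<times> 'n cmat \<times> 'n cmat"
  define off :: "'n cmat \<times> 'n cmat \<times> 'n cmat \<Rightarrow> 'n cmat \<times> 'n cmat \<times> 'n cmat"
    where "off z = (offd (fst z), 0, 0)" for z
  define \<rho> where "\<rho> i j = contraction_factor s (d0 $ i) (d0 $ j)" for i j
  have \<rho>: "norm (\<rho> i j) < 1" if "i \<noteq> j" for i j
    unfolding \<rho>_def using that inj d(1) s by (intro contraction_factor_less_1) (auto simp: inj_def)
  \<comment> \<open>The element 0 makes the maximum meaningful when there is only one index.\<close>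
  define A where "A = insert 0 ((\<lambda>(i, j). norm (\<rho> i j)) ` {(i, j). i \<noteq> j})"
  define q where "q = Max A"
  have A: "finite A" "A \<noteq> {}" by (auto simp: A_def)
  have q: "0 \<le> q" "q < 1" and q\<rho>: "\<And>i j. i \<noteq> j \<Longrightarrow> norm (\<rho> i j) \<le> q"
    unfolding q_def using A \<rho> by (auto simp: A_def intro!: Max_ge)
  have base: "(?\<theta>, ?z) \<in> dyn_set c"
    using gram_dom_base[OF d c] by (simp add: dyn_set_def)
  define D where "D = fderiv (dyn_map c) (?\<theta>, ?z)"
  have hD: "(dyn_map c has_derivative D) (at (?\<theta>, ?z))"
    unfolding D_def by (rule hol_fderiv(2)[OF hol_dyn_map base])
  then have fstD: "((\<lambda>p. fst (dyn_map c p)) has_derivative (\<lambda>v. fst (D v))) (at (?\<theta>, ?z))"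
    by (rule has_derivative_fst)
  have linD: "linear (\<lambda>v. fst (D v))" using has_derivative_linear[OF fstD] .
  have entry: "fst (D (0, (unit_entry i j u, 0, 0))) = unit_entry i j (\<rho> i j * u)" if "i \<noteq> j" for i j u
  proof (rule fderiv_along_line[OF fstD])
    fix t :: real
    have "t *\<^sub>R unit_entry i j u = unit_entry i j (of_real t * u)" for u
      by (simp add: vec_eq_iff scaleR_conv_of_real[where 'a = complex])
    then show "fst (dyn_map c ((?\<theta>, ?z) + t *\<^sub>R (0, (unit_entry i j u, 0, 0)))) =
        fst (dyn_map c (?\<theta>, ?z)) + t *\<^sub>R unit_entry i j (\<rho> i j * u)"
      using dyn_map_entry[OF that d c, of s "of_real t * u"] dyn_map_entry[OF that d c, of s 0]
      by (simp add: \<rho>_def zero_prod_def mult_ac)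
         (simp add: unit_entry_def zero_vec_def[symmetric] vec_eq_iff)
  qed
  have der: "norm (off (D (0, off z))) \<le> q * norm (off z)" for z
  proof -
    define Y where "Y = offd (fst z)"
    have Y: "Y $ i $ i = 0" for i by (simp add: Y_def)
    \<comment> \<open>By linearity it is enough to know the derivative on single entries, where
      \<open>dyn_map_entry\<close> has determined it.\<close>
    have "(0, off z) = (\<Sum>i\<in>UNIV. \<Sum>j\<in>UNIV. (0 :: complex \<times> (complex ^ 'n) \<times> (complex ^ 'n),
        (unit_entry i j (Y $ i $ j), 0 :: 'n cmat, 0 :: 'n cmat)))"
      (is "_ = ?S")
    proof -
      have "Y = (\<Sum>i\<in>UNIV. \<Sum>j\<in>UNIV. unit_entry i j (Y $ i $ j))"
        unfolding vec_eq_iff sum_unit_entry_nth by simp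
      then show ?thesis
        by (simp add: prod_eq_iff fst_sum snd_sum off_def Y_def[symmetric])
    qed
    then have "fst (D (0, off z)) = (\<Sum>i\<in>UNIV. \<Sum>j\<in>UNIV. fst (D (0, (unit_entry i j (Y $ i $ j), 0, 0))))"
      by (simp add: linear_sum[OF linD])
    also have "\<dots> = (\<Sum>i\<in>UNIV. \<Sum>j\<in>UNIV. unit_entry i j (\<rho> i j * Y $ i $ j))"
    proof (intro sum.cong refl)
      fix i j :: 'n
      show "fst (D (0, (unit_entry i j (Y $ i $ j), 0, 0))) = unit_entry i j (\<rho> i j * Y $ i $ j)"
      proof (cases "i = j")
        case True
        have "unit_entry j j 0 = (0 :: 'n cmat)" by (simp add: vec_eq_iff)
        then show ?thesis using True Y linear_0[OF linD] by (simp add: zero_prod_def)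
      qed (rule entry)
    qed
    finally have "fst (D (0, off z)) $ k $ l = \<rho> k l * Y $ k $ l" for k l
      by (simp only: sum_unit_entry_nth)
    then have "norm (offd (fst (D (0, off z)))) \<le> q * norm Y"
      using q\<rho> q Y by (intro norm_cmat_mono) (auto simp: norm_mult intro!: mult_right_mono)
    then show ?thesis by (simp add: off_def norm_Pair Y_def)
  qed
  obtain r G where rG: "r > 0" "hol_on (ball (?\<theta>, ?z) r) G"
    "\<And>\<theta> z n. (\<theta>, z) \<in> ball (?\<theta>, ?z) r \<Longrightarrow> (\<theta>, ((\<lambda>z. dyn_map c (\<theta>, z)) ^^ n) z) \<in> dyn_set c"
    "\<And>\<theta> z. (\<theta>, z) \<in> ball (?\<theta>, ?z) r \<Longrightarrow> (\<lambda>n. ((\<lambda>z. dyn_map c (\<theta>, z)) ^^ n) z) \<longlonglongrightarrow> G (\<theta>, z)"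
  proof (rule attracting_fixed_points[OF hol_dyn_map open_dyn_set base, of off q])
    show "bounded_linear off"
      unfolding linear_conv_bounded_linear[symmetric] off_def
      by (rule linearI) (auto simp: vec_eq_iff prod_eq_iff)
    show "norm (off z) \<le> norm z" for z
    proof -
      have "norm (offd (fst z)) \<le> 1 * norm (fst z)" by (rule norm_cmat_mono) auto
      then show ?thesis using norm_fst_le[of "fst z" "snd z"] by (simp add: off_def norm_Pair)
    qed
    show "off (off z) = off z" for z by (simp add: off_def vec_eq_iff)
    show "off ?z = 0" by (simp add: off_def vec_eq_iff mat_def prod_eq_iff)
    show "dyn_map c (\<theta>, z) = z" if "(\<theta>, z) \<in> dyn_set c" "off z = 0" for \<theta> z
    proof -
      obtain s' d m K W W' where eq: "\<theta> = (s', d, m)" "z = (K, W, W')" by (metis prod_cases3)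
      show ?thesis
        using that dyn_map_fixed[of s' d m K W W' c] unfolding eq by (simp add: off_def prod_eq_iff)
    qed
    show "norm (off (fderiv (dyn_map c) (?\<theta>, ?z) (0, off z))) \<le> q * norm (off z)" for z
      using der unfolding D_def .
  qed (use q in auto)
  show thesis by (rule that[OF rG])
qed

text \<open>Conjugation by \<open>P\<close> carries \<open>B = gram_conj d (vcnj d) K\<close> to
  \<open>cadjoint T ** T\<close>, so it carries the power \<open>Z\<close> of \<open>B\<close> to
  the one in \<open>aluthge_eq\<close>, and the transform becomes
  \<open>P ** Z ** dvec d ** Z' ** Q\<close>. The normalising power \<open>X'\<close> commutes with
  \<open>dvec d\<close>, so it can be inserted together with its inverse.\<close>

lemma aluthge_frame_step:
  fixes P Q :: "'n::finite cmat" and d :: "complex ^ 'n" and l :: real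
  assumes PQ: "P ** Q = mat 1" "Q ** P = mat 1" and d: "\<And>k. d $ k \<noteq> 0"
    and K: "K = cadjoint P ** P" and dom: "gram_dom c d (vcnj d) K" and c: "c > 0"
  defines "E \<equiv> frame_step c (of_real (l/2)) d (vcnj d) K" and "E' \<equiv> frame_step_inv c (of_real (l/2)) d (vcnj d) K"
  shows "aluthge l (P ** dvec d ** Q) = (P ** E) ** dvec d ** (E' ** Q)"
    and "(P ** E) ** (E' ** Q) = mat 1" and "(E' ** Q) ** (P ** E) = mat 1"
    and "cadjoint (P ** E) ** (P ** E) = frame_step_adj c (of_real (l/2)) d (vcnj d) K ** K ** E"
proof -
  define T where "T = P ** dvec d ** Q"
  define D where "D = dvec (vcnj d) ** dvec d"
  define B where "B = gram_conj d (vcnj d) K"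
  define s where "s = l / 2"
  have dom': "K \<in> cpw_dom 1" "B \<in> cpw_dom c" "gram_conj' d (vcnj d) K \<in> cpw_dom c" "D \<in> cpw_dom c"
    using dom by (auto simp: gram_dom_def B_def D_def)
  have "invertible T"
    unfolding T_def dvec_def using invertible_diagonalized[OF PQ] d by simp
  then obtain V e where V: "unitary_matrix V" and e: "\<And>i. 0 < e i" and T: "cadjoint T ** T = fun_calc V e"
    using gram_diagonalization by blast
  have PQ': "cadjoint P ** cadjoint Q = mat 1" "cadjoint Q ** cadjoint P = mat 1"
    using PQ by (simp_all flip: cadjoint_mult)
  have "K ** (Q ** cadjoint Q) = cadjoint P ** (P ** Q) ** cadjoint Q"
    unfolding K by (simp only: matrix_mul_assoc)
  then have "K ** (Q ** cadjoint Q) = mat 1" by (simp add: PQ PQ')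
  then have Kinv: "cpw 1 (- 1) K = Q ** cadjoint Q"
    by (metis cpw_1_inverse(2)[OF dom'(1)] matrix_mul_assoc matrix_mul_lid matrix_mul_rid)
  have "P ** B ** Q = (P ** Q) ** cadjoint Q ** dvec (vcnj d) ** cadjoint P ** P ** dvec d ** Q"
    unfolding B_def gram_conj_def Kinv unfolding K by (simp only: matrix_mul_assoc)
  also have "\<dots> = cadjoint T ** T"
    by (simp add: PQ T_def cadjoint_mult cadjoint_dvec matrix_mul_assoc)
  finally have PBQ: "P ** B ** Q = fun_calc V e" using T by simp
  have G: "fun_calc V (\<lambda>i. e i powr t) = P ** cpw c (of_real t) B ** Q" for t
    using cpw_eq_fun_calc[OF dom'(2) PQ V PBQ c] by simp
  define Z Z' where "Z = cpw c (of_real s) B" and "Z' = cpw c (- of_real s) B"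
  define X X' where "X = cpw c (of_real s) D" and "X' = cpw c (- of_real s) D"
  have ZZ': "Z ** Z' = mat 1"
  proof -
    have "fun_calc V (\<lambda>i. e i powr s) ** fun_calc V (\<lambda>i. e i powr (- s)) = mat 1"
      using e by (simp add: fun_calc_mult[OF V] powr_add[symmetric] less_imp_neq[THEN not_sym] fun_calc_one[OF V])
    then have "(P ** Z ** Q) ** (P ** Z' ** Q) = mat 1" using G[of s] G[of "- s"] by (simp add: Z_def Z'_def)
    moreover have "(P ** Z ** Q) ** (P ** Z' ** Q) = P ** (Z ** (Q ** P) ** Z') ** Q"
        by (simp only: matrix_mul_assoc)
    ultimately have "P ** (Z ** Z') ** Q = mat 1" by (simp add: PQ)
    then have "Q ** (P ** (Z ** Z') ** Q) ** P = mat 1" by (simp add: PQ)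
    moreover have "Q ** (P ** (Z ** Z') ** Q) ** P = (Q ** P) ** (Z ** Z') ** (Q ** P)"
        by (simp only: matrix_mul_assoc)
    ultimately show ?thesis by (simp add: PQ)
  qed
  have Ddiag: "D = diag_matrix (\<lambda>k. vcnj d $ k * d $ k)" by (simp add: D_def dvec_def diag_matrix_mult)
  have nD: "norm (vcnj d $ k * d $ k / of_real c - 1) < 1" for k
    using cpw_dom_diag[of "\<lambda>k. vcnj d $ k * d $ k" c k] dom'(4) Ddiag by simp
  have XX': "X ** X' = mat 1" "X' ** X = mat 1"
    unfolding X_def X'_def Ddiag using cpw_diag_inverse[OF nD, of "of_real s"] cpw_diag_inverse[OF nD,
        of "- of_real s"] by simp_all
  have Xd: "X' ** dvec d ** X = dvec d"
  proof -
    obtain x where "X = diag_matrix x" unfolding X_def Ddiag cpw_diag[OF nD] by blast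
    then have "X' ** dvec d ** X = X' ** X ** dvec d" by (simp add: matrix_mul_assoc[symmetric] dvec_commute)
    then show ?thesis by (simp add: XX')
  qed
  have E: "E = Z ** X'" "E' = X ** Z'"
    unfolding E_def E'_def frame_step_def frame_step_inv_def Z_def Z'_def X_def X'_def D_def B_def s_def by simp_all
  have "aluthge l T = (P ** Z ** Q) ** T ** (P ** Z' ** Q)"
    using aluthge_eq[OF V e T, of l] G[of s] G[of "- s"] by (simp add: Z_def Z'_def s_def)
  also have "\<dots> = P ** Z ** (Q ** P) ** dvec d ** (Q ** P) ** Z' ** Q"
    unfolding T_def by (simp only: matrix_mul_assoc)
  also have "\<dots> = P ** Z ** (X' ** dvec d ** X) ** Z' ** Q" by (simp add: PQ Xd)
  also have "\<dots> = (P ** E) ** dvec d ** (E' ** Q)" unfolding E by (simp only: matrix_mul_assoc)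
  finally show "aluthge l (P ** dvec d ** Q) = (P ** E) ** dvec d ** (E' ** Q)" unfolding T_def .
  have "(P ** E) ** (E' ** Q) = P ** (Z ** (X' ** X) ** Z') ** Q" unfolding E by (simp only: matrix_mul_assoc)
  then show 1: "(P ** E) ** (E' ** Q) = mat 1" by (simp add: XX' ZZ' PQ)
  then show "(E' ** Q) ** (P ** E) = mat 1" by (simp add: matrix_left_right_inverse)
  have "cadjoint K = K" by (simp add: K cadjoint_mult)
  then have "cadjoint B = gram_conj' d (vcnj d) K"
    unfolding B_def gram_conj_def gram_conj'_def Kinv
    by (simp add: cadjoint_mult cadjoint_dvec matrix_mul_assoc)
  then have Zadj: "cadjoint Z = cpw c (of_real s) (gram_conj' d (vcnj d) K)"
    using cpw_cadjoint[OF dom'(2), of s] by (simp add: Z_def)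
  have "cadjoint D = D" unfolding D_def by (simp add: cadjoint_mult cadjoint_dvec)
  then have Xadj: "cadjoint X' = X'"
    using cpw_cadjoint[OF dom'(4), of "- s"] by (simp add: X'_def)
  have "cadjoint E = frame_step_adj c (of_real (l/2)) d (vcnj d) K"
    unfolding E cadjoint_mult Zadj Xadj by (simp add: frame_step_adj_def X'_def D_def s_def)
  then show "cadjoint (P ** E) ** (P ** E) = frame_step_adj c (of_real (l/2)) d (vcnj d) K ** K ** E"
    by (simp add: cadjoint_mult K matrix_mul_assoc)
qed

section \<open>Smoothness of the limit\<close>

definition complexify :: "real \<times> 'n::finite cmat \<Rightarrow> complex \<times> 'n cmat \<times> 'n cmat" where
  "complexify y = (of_real (fst y), snd y, cadjoint (snd y))"

lemma bounded_linear_complexify: "bounded_linear complexify"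
  unfolding linear_conv_bounded_linear[symmetric]
  by (rule linearI) (auto simp: complexify_def vec_eq_iff scaleR_conv_of_real[where 'a = complex])

lemma continuous_on_complexify: "continuous_on S complexify"
  by (rule linear_continuous_on[OF bounded_linear_complexify])

lemma opn_unitary: "unitary_matrix V \<Longrightarrow> opn V \<le> 1"
proof (rule opn_leI)
  fix x :: "complex ^ 'a" assume V: "unitary_matrix V"
  have "hip (V *v x) (V *v x) = hip x x"
    by (simp add: hip_matrix matrix_vector_mul_assoc unitary_matrixD[OF V])
  then have "(norm (V *v x))\<^sup>2 = (norm x)\<^sup>2" by (simp only: hip_self of_real_eq_iff)
  then show "norm (V *v x) \<le> 1 * norm x" by simp
qed

lemma fun_calc_cpw_dom:
  fixes V :: "'n::finite cmat"
  assumes V: "unitary_matrix V" and d: "\<And>i. 0 < d i" "\<And>i. d i < 2 * c"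
  shows "fun_calc V d \<in> cpw_dom c"
proof -
  let ?M = "(1 / c) *\<^sub>R real_diag d - mat 1"
  have M: "opn ?M < 1"
    unfolding real_diag_def diag_matrix_shift by (rule opn_diag_less) (rule norm_shift_real[OF d])
  have "opn (V ** ?M ** cadjoint V) \<le> opn (V ** ?M) * opn (cadjoint V)" by (rule opn_mult)
  also have "\<dots> \<le> (opn V * opn ?M) * 1"
    by (intro mult_mono opn_mult opn_unitary unitary_cadjoint V mult_nonneg_nonneg opn_nonneg)
  also have "\<dots> \<le> 1 * opn ?M * 1"
    by (intro mult_right_mono opn_unitary V opn_nonneg) auto
  finally show ?thesis
    unfolding cpw_dom_def fun_calc_def using M by (simp add: conj_shift unitary_matrixD[OF V])
qed

lemma exists_upper_bound: "\<exists>c>0. \<forall>i. d i < 2 * c" for d :: "'n::finite \<Rightarrow> real"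
proof -
  define M where "M = (\<Sum>i\<in>UNIV. \<bar>d i\<bar>)"
  have "\<bar>d i\<bar> \<le> M" for i unfolding M_def by (rule member_le_sum) auto
  then have "d i < 2 * (M + 1)" for i by (smt (verit, best))
  moreover have "M \<ge> 0" unfolding M_def by (rule sum_nonneg) auto
  ultimately show ?thesis by (intro exI[of _ "M + 1"]) auto
qed

lemma open_invertible: "open {T :: 'n::finite cmat. invertible T}"
  unfolding invertible_det_nz
  by (intro open_Collect_neq continuous_det continuous_on_const)

text \<open>With \<open>S\<close> in place of the adjoint, \<open>aluthge_eq\<close> conjugates
  \<open>T\<close> by the power \<open>l/2\<close> of \<open>S ** T\<close>. The adjoint of the
  result is \<open>S\<close> conjugated by the inverse power; this is the third component of
  \<open>H\<close>, which makes \<open>H\<close> map complexified points to complexified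
  points.\<close>

lemma aluthge_extension:
  fixes T0 :: "'n::finite cmat"
  assumes inv: "invertible T0"
  obtains U \<Omega> H where "open U" "(l0, T0) \<in> U" "open \<Omega>" "hol_on \<Omega> H"
    "\<And>l T. (l, T) \<in> U \<Longrightarrow> complexify (l, T) \<in> \<Omega> \<and> complexify (l, aluthge l T) = H (complexify (l, T))"
proof -
  obtain V0 d0 where V0: "unitary_matrix V0" "\<And>i. 0 < d0 i" "cadjoint T0 ** T0 = fun_calc V0 d0"
    using gram_diagonalization[OF inv] by blast
  \<comment> \<open>The constant is adapted to the singular values of \<open>T0\<close>; as the
    domain of the power is open, it serves a whole neighbourhood.\<close>
  obtain c where c: "c > 0" "\<And>i. d0 i < 2 * c" using exists_upper_bound[of d0] by blast
  define A where "A p = snd (snd p) ** fst (snd p)" for p :: "complex \<times> 'n cmat \<times> 'n cmat"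
  define \<Omega> where "\<Omega> = A -` cpw_dom c"
  have T: "hol_on S (\<lambda>p :: complex \<times> 'n cmat \<times> 'n cmat. fst (snd p))"
    and S: "hol_on S (\<lambda>p :: complex \<times> 'n cmat \<times> 'n cmat. snd (snd p))"
    and l: "hol_on S (\<lambda>p :: complex \<times> 'n cmat \<times> 'n cmat. fst p)" for S
    by (intro hol_fst hol_snd hol_ident)+
  have A: "hol_on S A" for S unfolding A_def by (intro hol_matrix_mult T S)
  have \<Omega>: "open \<Omega>"
    unfolding \<Omega>_def by (rule open_vimage[OF open_cpw_dom hol_continuous_on[OF A]])
  define G G' where "G p = cpw c (1/2 * fst p) (A p)" and "G' p = cpw c (- 1/2 * fst p) (A p)"
    for p :: "complex \<times> 'n cmat \<times> 'n cmat"
  have G: "hol_on \<Omega> G" "hol_on \<Omega> G'"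
    unfolding G_def G'_def by (intro hol_cpw hol_mult hol_const l A; simp add: \<Omega>_def)+
  define H where "H p = (fst p, G p ** fst (snd p) ** G' p, G' p ** snd (snd p) ** G p)" for p
  have H: "hol_on \<Omega> H"
    unfolding H_def by (intro hol_Pair hol_matrix_mult l G T S)
  define U where "U = {y. complexify y \<in> \<Omega>} \<inter> (UNIV \<times> {T. invertible T})"
  have "open U"
    unfolding U_def
    by (intro open_Int open_Times open_UNIV open_invertible open_vimage[OF \<Omega> continuous_on_complexify,
        unfolded vimage_def])
  moreover have "(l0, T0) \<in> U"
    using inv fun_calc_cpw_dom[OF V0(1,2) c(2)] V0(3) by (simp add: U_def \<Omega>_def A_def complexify_def)
  moreover have "complexify (l, T) \<in> \<Omega> \<and> complexify (l, aluthge l T) = H (complexify (l, T))"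
    if "(l, T) \<in> U" for l T
  proof -
    have dom: "complexify (l, T) \<in> \<Omega>" "invertible T" using that by (auto simp: U_def)
    have B: "cadjoint T ** T \<in> cpw_dom c" using dom(1) by (simp add: \<Omega>_def A_def complexify_def)
    obtain V d where V: "unitary_matrix V" and d: "\<And>i. 0 < d i" and T: "cadjoint T ** T = fun_calc V d"
      using gram_diagonalization[OF dom(2)] by blast
    have f: "cpw c (of_real s) (cadjoint T ** T) = fun_calc V (\<lambda>i. d i powr s)" for s
      using cpw_eq_fun_calc[OF B _ _ V _ c(1), of "mat 1" "mat 1" d s] T by simp
    have GG: "G (complexify (l, T)) = fun_calc V (\<lambda>i. d i powr (l/2))"
      "G' (complexify (l, T)) = fun_calc V (\<lambda>i. d i powr (- (l/2)))"
      using f[of "l/2"] f[of "- (l/2)"] by (simp_all add: G_def G'_def A_def complexify_def)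
    show ?thesis
      using dom aluthge_eq[OF V d T, of l] GG
      by (simp add: H_def complexify_def[of "(l, aluthge l T)"] cadjoint_mult cadjoint_fun_calc matrix_mul_assoc)
         (simp add: complexify_def cadjoint_mult cadjoint_fun_calc matrix_mul_assoc)
  qed
  ultimately show thesis using that \<Omega> H by blast
qed

lemma isCont_aluthge_joint:
  fixes T0 :: "'n::finite cmat"
  assumes "invertible T0"
  shows "isCont (\<lambda>(l, T). aluthge l T) (l0, T0)"
proof -
  obtain U \<Omega> H where U: "open U" "(l0, T0) \<in> U" "open \<Omega>" "hol_on \<Omega> H"
    "\<And>l T. (l, T) \<in> U \<Longrightarrow> complexify (l, T) \<in> \<Omega> \<and> complexify (l, aluthge l T) = H (complexify (l, T))"
    using aluthge_extension[OF assms] by metis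
  have cont: "isCont (\<lambda>y. fst (snd (H (complexify y)))) (l0, T0)"
    using U(2,5) by (intro continuous_intros isCont_o2[OF linear_continuous_at[OF bounded_linear_complexify]
        hol_fderiv(4)[OF U(4)]]) auto
  have "\<forall>\<^sub>F y in nhds (l0, T0). y \<in> U" by (rule eventually_nhds_in_open[OF U(1,2)])
  then have "\<forall>\<^sub>F y in nhds (l0, T0). (\<lambda>(l, T). aluthge l T) y = fst (snd (H (complexify y)))"
  proof (rule eventually_mono)
    fix y assume "y \<in> U"
    then have "complexify (fst y, aluthge (fst y) (snd y)) = H (complexify y)" using U(5)[of "fst y"
        "snd y"] by simp
    from arg_cong[OF this, of "\<lambda>p. fst (snd p)"]
    show "(\<lambda>(l, T). aluthge l T) y = fst (snd (H (complexify y)))"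
      by (simp add: complexify_def case_prod_unfold)
  qed
  from isCont_cong[OF this] cont show ?thesis by blast
qed

lemma isCont_aluthge: "invertible N \<Longrightarrow> isCont (aluthge l) N" for N :: "'n::finite cmat"
  using isCont_o2[where f = "\<lambda>N. (l, N)" and g = "\<lambda>(l, T). aluthge l T" and a = N]
    isCont_aluthge_joint[of N l] by simp

text \<open>The local form of the claim: the iterates converge at all real points near
  \<open>y0\<close>, and their limits are restrictions of one holomorphic map. In this form the
  claim can be moved backwards along an orbit.\<close>

definition limit_extends :: "real \<times> 'n::finite cmat \<Rightarrow> bool" where
  "limit_extends y0 \<longleftrightarrow> (\<exists>U \<Omega> L. open U \<and> y0 \<in> U \<and> open \<Omega> \<and> hol_on \<Omega> L \<and>
     (\<forall>(l, T)\<in>U. complexify (l, T) \<in> \<Omega> \<and> (\<lambda>n. aluthge_iter l n T) \<longlonglongrightarrow> L (complexify (l, T))))"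

lemma aluthge_iter_shift: "aluthge_iter l n (aluthge l T) = aluthge_iter l (Suc n) T"
  by (simp add: aluthge_iter_def funpow_swap1)

text \<open>If \<open>L\<close> describes the limits near the transform of \<open>T0\<close>, then
  \<open>L\<close> after the one-step extension \<open>H\<close> describes them near
  \<open>T0\<close>, because dropping the first iterate does not change a limit.\<close>

lemma limit_extends_pullback:
  fixes T0 :: "'n::finite cmat"
  assumes inv: "invertible T0" and ext: "limit_extends (l0, aluthge l0 T0)"
  shows "limit_extends (l0, T0)"
proof -
  obtain U \<Omega> H where U: "open U" "(l0, T0) \<in> U" "open \<Omega>" "hol_on \<Omega> H"
    "\<And>l T. (l, T) \<in> U \<Longrightarrow> complexify (l, T) \<in> \<Omega> \<and> complexify (l, aluthge l T) = H (complexify (l, T))"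
    using aluthge_extension[OF inv] by metis
  obtain U' \<Omega>' L where U': "open U'" "(l0, aluthge l0 T0) \<in> U'" "open \<Omega>'" "hol_on \<Omega>' L"
    "\<And>l T. (l, T) \<in> U' \<Longrightarrow> complexify (l, T) \<in> \<Omega>' \<and> (\<lambda>n. aluthge_iter l n T) \<longlonglongrightarrow> L (complexify (l, T))"
    using ext unfolding limit_extends_def by blast
  define W where "W = \<Omega> \<inter> H -` \<Omega>'"
  have W: "open W"
    unfolding W_def by (rule continuous_open_preimage[OF hol_continuous_on[OF U(4)] U(3) U'(3)])
  have holW: "hol_on W (\<lambda>p. L (H p))"
    by (rule hol_compose[OF hol_subset[OF U(4)] U'(4)]) (auto simp: W_def)
  define h where "h y = (fst y, fst (snd (H (complexify y))))" for y :: "real \<times> 'n cmat"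
  have h: "h (l, T) = (l, aluthge l T)" if "(l, T) \<in> U" for l T
    using arg_cong[OF conjunct2[OF U(5)[OF that]], of "\<lambda>p. fst (snd p)"] by (simp add: h_def complexify_def)
  have "continuous_on U (\<lambda>y. H (complexify y))"
    by (rule continuous_on_compose2[OF hol_continuous_on[OF U(4)] continuous_on_complexify]) (use U(5) in auto)
  then have "continuous_on U h" unfolding h_def by (intro continuous_intros)
  then have V: "open (U \<inter> h -` U')" by (rule continuous_open_preimage[OF _ U(1) U'(1)])
  moreover have "(l0, T0) \<in> U \<inter> h -` U'" using U(2) U'(2) h[OF U(2)] by simp
  moreover have "complexify (l, T) \<in> W \<and> (\<lambda>n. aluthge_iter l n T) \<longlonglongrightarrow> L (H (complexify (l, T)))"
    if "(l, T) \<in> U \<inter> h -` U'" for l T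
  proof -
    have lT: "(l, T) \<in> U" "(l, aluthge l T) \<in> U'" using that h by auto
    have "(\<lambda>n. aluthge_iter l (Suc n) T) \<longlonglongrightarrow> L (H (complexify (l, T)))"
      using U'(5)[OF lT(2)] U(5)[OF lT(1)] by (simp add: aluthge_iter_shift)
    then have "(\<lambda>n. aluthge_iter l n T) \<longlonglongrightarrow> L (H (complexify (l, T)))"
      by (rule LIMSEQ_imp_Suc)
    then show ?thesis using U'(5)[OF lT(2)] U(5)[OF lT(1)] by (auto simp: W_def)
  qed
  ultimately show ?thesis
    unfolding limit_extends_def using W holW
    by (intro exI[of _ "U \<inter> h -` U'"] exI[of _ W] exI[of _ "\<lambda>p. L (H p)"]) auto
qed

lemma limit_extends_iter:
  "invertible T \<Longrightarrow> limit_extends (l, aluthge_iter l n T) \<Longrightarrow> limit_extends (l, T)" for T :: "'n::finite cmat"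
proof (induction n arbitrary: T)
  case (Suc n)
  then show ?case
    using limit_extends_pullback invertible_aluthge aluthge_iter_shift by metis
qed (simp add: aluthge_iter_def)

text \<open>The inner and the outer map are both conjugate linear, so the two conjugations cancel in
  the derivative.\<close>

lemma hol_conj:
  fixes f :: "'n::finite cmat \<Rightarrow> 'b::cvec" and \<sigma> :: "'b \<Rightarrow> 'b"
  assumes f: "hol_on U f" and \<sigma>: "bounded_linear \<sigma>" "\<And>c v. \<sigma> (c *\<^sub>C v) = cnj c *\<^sub>C \<sigma> v"
  shows "hol_on (cadjoint -` U) (\<lambda>S. \<sigma> (f (cadjoint S)))"
  unfolding hol_on_def
proof
  fix S assume "S \<in> cadjoint -` U"
  then obtain D where D: "has_cderiv f D (cadjoint S)" using f unfolding hol_on_def by auto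
  have "((\<lambda>S. f (cadjoint S)) has_derivative (\<lambda>v. D (cadjoint v))) (at S)"
    using has_derivative_compose[OF bounded_linear_imp_has_derivative[OF bounded_linear_cadjoint]] D
    unfolding has_cderiv_def by blast
  from bounded_linear.has_derivative[OF \<sigma>(1) this]
  have "has_cderiv (\<lambda>S. \<sigma> (f (cadjoint S))) (\<lambda>v. \<sigma> (D (cadjoint v))) S"
    using D \<sigma>(2) unfolding has_cderiv_def by (simp add: cadjoint_csc)
  then show "\<exists>D. has_cderiv (\<lambda>S. \<sigma> (f (cadjoint S))) D S" by blast
qed

lemma bounded_linear_vcnj: "bounded_linear (vcnj :: complex ^ 'n::finite \<Rightarrow> complex ^ 'n)"
  unfolding linear_conv_bounded_linear[symmetric] by (rule linearI) (auto simp: vec_eq_iff)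

text \<open>The invariant is that \<open>P ** W\<close> is an eigenvector frame of the current
  iterate, with inverse \<open>W' ** Q\<close> and Gram matrix \<open>K\<close>; so
  \<open>aluthge_frame_step\<close> applies again, always with the same \<open>d\<close>.\<close>

lemma aluthge_iter_frame:
  fixes P Q :: "'n::finite cmat" and d :: "complex ^ 'n" and l :: real
  assumes PQ: "P ** Q = mat 1" "Q ** P = mat 1" and c: "c > 0"
  defines "Z \<equiv> \<lambda>n. ((\<lambda>z. dyn_map c ((of_real (l/2), d, vcnj d), z)) ^^ n) (cadjoint P ** P, mat 1, mat 1)"
  assumes dom: "\<And>n. ((of_real (l/2), d, vcnj d), Z n) \<in> dyn_set c"
  shows "aluthge_iter l n (P ** dvec d ** Q) = P ** fst (snd (Z n)) ** dvec d ** (snd (snd (Z n)) ** Q)"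
proof -
  let ?P = "\<lambda>n. P ** fst (snd (Z n))" and ?Q = "\<lambda>n. snd (snd (Z n)) ** Q"
  have gd: "gram_dom c d (vcnj d) (fst (Z n))" for n
    using dom[of n] by (auto simp: dyn_set_def case_prod_unfold)
  \<comment> \<open>The domain itself excludes zero eigenvalues: the squared modulus of
    \<open>d $ k\<close>, divided by \<open>c\<close>, has distance less than 1 from 1.\<close>
  have d: "d $ k \<noteq> 0" for k
  proof -
    have "diag_matrix (\<lambda>k. vcnj d $ k * d $ k) \<in> cpw_dom c"
      using gd[of 0] by (simp add: gram_dom_def dvec_def diag_matrix_mult)
    from cpw_dom_diag[OF this, of k] show ?thesis by auto
  qed
  have "?P n ** ?Q n = mat 1 \<and> ?Q n ** ?P n = mat 1 \<and> fst (Z n) = cadjoint (?P n) ** ?P n \<and>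
    aluthge_iter l n (P ** dvec d ** Q) = ?P n ** dvec d ** ?Q n"
  proof (induction n)
    case 0
    then show ?case by (simp add: Z_def PQ aluthge_iter_def)
  next
    case (Suc n)
    define K where "K = fst (Z n)"
    define E E' where "E = frame_step c (of_real (l/2)) d (vcnj d) K"
        and "E' = frame_step_inv c (of_real (l/2)) d (vcnj d) K"
    have ZS: "Z (Suc n) = dyn_map c ((of_real (l/2), d, vcnj d), Z n)" by (simp add: Z_def)
    have Z: "Z (Suc n) = (frame_step_adj c (of_real (l/2)) d (vcnj d) K ** K ** E, fst (snd (Z n)) ** E,
        E' ** snd (snd (Z n)))"
      unfolding ZS dyn_map_def E_def E'_def K_def by (simp add: case_prod_unfold)
    have K: "K = cadjoint (?P n) ** ?P n" using Suc by (simp add: K_def)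
    have PQn: "?P n ** ?Q n = mat 1" "?Q n ** ?P n = mat 1" using Suc by auto
    note step = aluthge_frame_step[OF PQn d K gd[of n, folded K_def] c, of l, folded E_def E'_def]
    have assoc: "P ** (fst (snd (Z n)) ** E) = ?P n ** E" "E' ** snd (snd (Z n)) ** Q = E' ** ?Q n"
      by (simp_all add: matrix_mul_assoc)
    show ?case
      unfolding aluthge_iter_Suc Z fst_conv snd_conv assoc using step Suc by simp
  qed
  then show ?thesis by blast
qed

text \<open>The map \<open>\<Phi>\<close> sends \<open>(l, T, S)\<close> to an initial state of the
  Gram dynamics: exponent \<open>l/2\<close>, eigenvalues and frame from \<open>T\<close>, conjugate
  eigenvalues and adjoint frame from \<open>S\<close>. It is holomorphic and gives the true data
  when \<open>S\<close> is the adjoint of \<open>T\<close>. The limit state is recombined into a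
  limit of matrices as in \<open>aluthge_iter_frame\<close>.\<close>

lemma limit_extends_normal:
  fixes V :: "'n::finite cmat" and d0 :: "complex ^ 'n"
  assumes V: "unitary_matrix V" and inj: "inj (($) d0)" and d0: "\<And>k. d0 $ k \<noteq> 0" and l0: "0 < l0" "l0 < 1"
  shows "limit_extends (l0, V ** dvec d0 ** cadjoint V)"
proof -
  let ?N = "V ** dvec d0 ** cadjoint V"
  obtain c where c: "c > 0" "\<And>k. (norm (d0 $ k))\<^sup>2 < 2 * c"
    using exists_upper_bound[of "\<lambda>k. (norm (d0 $ k))\<^sup>2"] by blast
  have s: "0 < l0 / 2" "l0 / 2 < 1 / 2" using l0 by auto
  let ?p = "((complex_of_real (l0/2), d0, vcnj d0), (mat 1, mat 1, mat 1)) :: 'n dyn"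
  obtain r G where r: "r > 0" and G: "hol_on (ball ?p r) G"
    and dom: "\<And>\<theta> z n. (\<theta>, z) \<in> ball ?p r \<Longrightarrow> (\<theta>, ((\<lambda>z. dyn_map c (\<theta>, z)) ^^ n) z) \<in> dyn_set c"
    and lim: "\<And>\<theta> z. (\<theta>, z) \<in> ball ?p r \<Longrightarrow> (\<lambda>n. ((\<lambda>z. dyn_map c (\<theta>, z)) ^^ n) z) \<longlonglongrightarrow> G (\<theta>, z)"
    using dyn_limit[OF inj d0 c(2,1) s] by metis
  obtain U P Q e where U: "open U" "?N \<in> U" and hol: "hol_on U P" "hol_on U Q" "hol_on U e"
    and base: "P ?N = V" "e ?N = d0"
    and eig: "\<And>A. A \<in> U \<Longrightarrow> P A ** Q A = mat 1 \<and> Q A ** P A = mat 1 \<and> A = P A ** dvec (e A) ** Q A"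
    using local_eigenframe[OF inj unitary_matrixD(2,1)[OF V]] by metis
  define R where "R S = cadjoint (P (cadjoint S))" for S
  define m where "m S = vcnj (e (cadjoint S))" for S
  have R: "hol_on (cadjoint -` U) R"
    unfolding R_def by (rule hol_conj[OF hol(1) bounded_linear_cadjoint]) (simp add: cadjoint_csc)
  have m: "hol_on (cadjoint -` U) m"
    unfolding m_def by (rule hol_conj[OF hol(3) bounded_linear_vcnj]) (simp add: vec_eq_iff)
  define \<Omega>1 where "\<Omega>1 = (UNIV :: complex set) \<times> U \<times> (cadjoint -` U)"
  have "open (cadjoint -` U)"
    by (rule open_vimage[OF U(1) linear_continuous_on[OF bounded_linear_cadjoint]])
  then have \<Omega>1: "open \<Omega>1" unfolding \<Omega>1_def by (intro open_Times open_UNIV U(1))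
  have onT: "hol_on \<Omega>1 (\<lambda>p. f (fst (snd p)))" if "hol_on U f" for f :: "'n cmat \<Rightarrow> 'z::cvec"
    by (rule hol_compose[OF hol_fst[OF hol_snd[OF hol_ident]] that]) (auto simp: \<Omega>1_def)
  have onS: "hol_on \<Omega>1 (\<lambda>p. f (snd (snd p)))" if "hol_on (cadjoint -` U) f" for f :: "'n cmat \<Rightarrow> 'z::cvec"
    by (rule hol_compose[OF hol_snd[OF hol_snd[OF hol_ident]] that]) (auto simp: \<Omega>1_def)
  define \<Phi> :: "complex \<times> 'n cmat \<times> 'n cmat \<Rightarrow> 'n dyn" where
    "\<Phi> p = ((1/2 * fst p, e (fst (snd p)), m (snd (snd p))), (R (snd (snd p)) ** P (fst (snd p)), mat 1,
        mat 1))" for p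
  have \<Phi>: "hol_on \<Omega>1 \<Phi>"
    unfolding \<Phi>_def
    by (intro hol_Pair hol_const hol_mult hol_fst[OF hol_ident] onT[OF hol(3)] onS[OF m] hol_matrix_mult onS[OF
        R] onT[OF hol(1)])
  define \<Omega> where "\<Omega> = \<Omega>1 \<inter> \<Phi> -` ball ?p r"
  have \<Omega>: "open \<Omega>" "\<Omega> \<subseteq> \<Omega>1"
    unfolding \<Omega>_def using continuous_open_preimage[OF hol_continuous_on[OF \<Phi>] \<Omega>1 open_ball] by auto
  have G\<Phi>: "hol_on \<Omega> (\<lambda>p. G (\<Phi> p))"
    by (rule hol_compose[OF hol_subset[OF \<Phi> \<Omega>(2)] G]) (auto simp: \<Omega>_def)
  define L where "L p = P (fst (snd p)) ** fst (snd (G (\<Phi> p))) ** dvec (e (fst (snd p))) ** (snd (snd (G (\<Phi>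
      p))) ** Q (fst (snd p)))" for p
  have L: "hol_on \<Omega> L"
    unfolding L_def
    by (intro hol_matrix_mult hol_dvec hol_fst[OF hol_snd[OF G\<Phi>]] hol_snd[OF hol_snd[OF G\<Phi>]]
        hol_subset[OF onT[OF hol(1)] \<Omega>(2)] hol_subset[OF onT[OF hol(2)] \<Omega>(2)] hol_subset[OF onT[OF hol(3)] \<Omega>(2)])
  have C: "\<Phi> (complexify (l, T)) = ((of_real (l/2), e T, vcnj (e T)), (cadjoint (P T) ** P T, mat 1,
      mat 1))" for l T
    by (simp add: \<Phi>_def complexify_def m_def R_def)
  have limit: "(\<lambda>n. aluthge_iter l n T) \<longlonglongrightarrow> L (complexify (l, T))" if y: "complexify (l, T) \<in> \<Omega>" for l T
  proof -
    have TU: "T \<in> U" using y by (auto simp: \<Omega>_def \<Omega>1_def complexify_def)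
    have ball: "((of_real (l/2), e T, vcnj (e T)), (cadjoint (P T) ** P T, mat 1, mat 1)) \<in> ball ?p r"
      using y unfolding \<Omega>_def C[symmetric] by blast
    define Z where "Z n = ((\<lambda>z. dyn_map c ((of_real (l/2), e T, vcnj (e T)), z)) ^^ n) (cadjoint (P T) ** P T,
        mat 1, mat 1)" for n
    have Zlim: "Z \<longlonglongrightarrow> G (\<Phi> (complexify (l, T)))"
      using lim[OF ball] unfolding C Z_def .
    have "aluthge_iter l n T = P T ** fst (snd (Z n)) ** dvec (e T) ** (snd (snd (Z n)) ** Q T)" for n
      using aluthge_iter_frame[OF _ _ c(1) dom[OF ball], of "Q T" n] eig[OF TU] unfolding Z_def by metis
    moreover have "(\<lambda>n. P T ** fst (snd (Z n)) ** dvec (e T) ** (snd (snd (Z n)) ** Q T)) \<longlonglongrightarrow> L (complexify (l, T))"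
      unfolding L_def complexify_def fst_conv snd_conv
      by (intro mmult.tendsto tendsto_const tendsto_fst tendsto_snd Zlim[unfolded complexify_def fst_conv snd_conv])
    ultimately show ?thesis by simp
  qed
  \<comment> \<open>At \<open>?N\<close> the frame is the unitary \<open>V\<close>, whose Gram
    matrix is \<open>mat 1\<close>, so \<open>\<Phi>\<close> hits the centre of the ball.\<close>
  have "complexify (l0, ?N) \<in> \<Omega>"
  proof -
    have "complexify (l0, ?N) \<in> \<Omega>1" using U(2) by (simp add: \<Omega>1_def complexify_def)
    then show ?thesis
      using r C[of l0 ?N] by (simp add: \<Omega>_def base unitary_matrixD[OF V])
  qed
  moreover have "\<forall>(l, T)\<in>complexify -` \<Omega>. complexify (l, T) \<in> \<Omega> \<and> (\<lambda>n. aluthge_iter l n T) \<longlonglongrightarrow> L (complexify (l, T))"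
    using limit[of "fst y" "snd y" for y] by (simp add: case_prod_unfold)
  ultimately show ?thesis
    unfolding limit_extends_def
    using \<Omega>(1) L open_vimage[OF \<Omega>(1) continuous_on_complexify]
    by (intro exI[of _ "complexify -` \<Omega>"] exI[of _ \<Omega>] exI[of _ L] conjI) auto
qed

text \<open>A limit point \<open>N\<close> of the orbit is normal with the same simple non-zero
  spectrum, so the local result holds around \<open>(l, N)\<close>. Some iterate lies in that
  neighbourhood, and the claim is pulled back from it to the start; convergence of the full orbit is
  an outcome.\<close>

lemma limit_extends_everywhere:
  fixes T :: "'n::finite cmat"
  assumes T: "T \<in> diag_inv_distinct" and l: "0 < l" "l < 1"
  shows "limit_extends (l, T)"
proof -
  have inv: "invertible T" and card: "card (eigenvalues T) = CARD('n)"
    using T by (auto simp: diag_inv_distinct_def)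
  obtain N r where N: "(\<lambda>k. aluthge_iter l (r k) T) \<longlonglongrightarrow> N" "normal_matrix N" "invertible N"
    "eigenvalues N = eigenvalues T"
    using aluthge_iter_limit_point[OF inv l isCont_aluthge] by blast
  obtain V d where V: "unitary_matrix V" "inj d" "N = V ** diag_matrix d ** cadjoint V"
    using normal_matrix_diagonalization[OF N(2)] card N(4) by metis
  define d0 where "d0 = (\<chi> i. d i)"
  have Nd: "N = V ** dvec d0 ** cadjoint V" by (simp add: V(3) dvec_def d0_def)
  have "\<forall>k. d k \<noteq> 0"
    using N(3) invertible_diagonalized[OF unitary_matrixD(2,1)[OF V(1)]] unfolding V(3) by blast
  then have "limit_extends (l, N)"
    unfolding Nd using V(2) by (intro limit_extends_normal V(1) l) (auto simp: d0_def inj_def)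
  then obtain U \<Omega> L where U: "open U" "(l, N) \<in> U" "open \<Omega>" "hol_on \<Omega> L"
    "\<forall>(l, T)\<in>U. complexify (l, T) \<in> \<Omega> \<and> (\<lambda>n. aluthge_iter l n T) \<longlonglongrightarrow> L (complexify (l, T))"
    unfolding limit_extends_def by blast
  have "(\<lambda>k. (l, aluthge_iter l (r k) T)) \<longlonglongrightarrow> (l, N)" by (intro tendsto_intros N(1))
  then have "\<forall>\<^sub>F k in sequentially. (l, aluthge_iter l (r k) T) \<in> U"
    using U(1,2) topological_tendstoD by blast
  then obtain k where "(l, aluthge_iter l (r k) T) \<in> U"
    by (meson eventually_happens' sequentially_bot)
  then have "limit_extends (l, aluthge_iter l (r k) T)"
    unfolding limit_extends_def using U by blast
  then show ?thesis by (rule limit_extends_iter[OF inv])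
qed

theorem theorem4p3p1:
  shows "open (diag_inv_distinct :: (complex ^ 'n::finite ^ 'n) set) \<and>
    (\<forall>lam\<in>{0<..<1}. \<forall>T\<in>(diag_inv_distinct :: (complex ^ 'n ^ 'n) set).
       convergent (\<lambda>n. aluthge_iter lam n T)) \<and>
    C_inf_on ({0<..<1} \<times> (diag_inv_distinct :: (complex ^ 'n ^ 'n) set))
      (\<lambda>(lam, T). aluthge_limit lam T)"
proof (intro conjI ballI)
  show op: "open (diag_inv_distinct :: (complex ^ 'n ^ 'n) set)" by (rule open_diag_inv_distinct)
  let ?S = "{0<..<1 :: real} \<times> (diag_inv_distinct :: (complex ^ 'n ^ 'n) set)"
  have ext: "\<exists>U \<Omega> L. open U \<and> y \<in> U \<and> open \<Omega> \<and> hol_on \<Omega> L \<and>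
     (\<forall>(l, T)\<in>U. complexify (l, T) \<in> \<Omega> \<and> (\<lambda>n. aluthge_iter l n T) \<longlonglongrightarrow> L (complexify (l, T)))"
    if "y \<in> ?S" for y
    using limit_extends_everywhere[of "snd y" "fst y"] that unfolding limit_extends_def by auto
  show "convergent (\<lambda>n. aluthge_iter lam n T)" if "lam \<in> {0<..<1}" "T \<in> diag_inv_distinct"
    for lam :: real and T :: "complex ^ 'n ^ 'n"
    using ext[of "(lam, T)"] that unfolding convergent_def by blast
  show "C_inf_on ?S (\<lambda>(lam, T). aluthge_limit lam T)"
  proof (rule C_inf_on_of_local_extension[OF _ bounded_linear_complexify])
    show "open ?S" by (intro open_Times open_greaterThanLessThan op)
    fix y assume "y \<in> ?S"
    from ext[OF this] obtain U \<Omega> L where U: "open U" "y \<in> U" "open \<Omega>" "hol_on \<Omega> L"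
      "\<And>l T. (l, T) \<in> U \<Longrightarrow> complexify (l, T) \<in> \<Omega> \<and> (\<lambda>n. aluthge_iter l n T) \<longlonglongrightarrow> L (complexify (l, T))"
      by blast
    \<comment> \<open>The iterates converge at these points, so \<open>lim\<close> is their genuine
      limit and agrees with the extension.\<close>
    have "complexify z \<in> \<Omega> \<and> (\<lambda>(lam, T). aluthge_limit lam T) z = L (complexify z)" if "z \<in> U \<inter> ?S" for z
      using U(5)[of "fst z" "snd z"] that by (auto simp: aluthge_limit_def case_prod_unfold intro: limI)
    then show "\<exists>U \<Omega> G. open U \<and> y \<in> U \<and> open \<Omega> \<and> hol_on \<Omega> G \<and>
      (\<forall>z\<in>U \<inter> ?S. complexify z \<in> \<Omega> \<and> (\<lambda>(lam, T). aluthge_limit lam T) z = G (complexify z))"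
      using U(1-4) by blast
  qed
qed

end
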